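(* Suppose that $1\leq n<m-3$. Then the complex $\mathcal{VR}(\mathcal{F}_n^{m}\cup \mathcal{F}_{n+2}^m, 2)$ is homotopy equivalent to a wedge sum of copies of $S^3$. More specifically, for $n=1$, $$\mathcal{VR}(\mathcal{F}_1^{m}\cup \mathcal{F}_{3}^m, 2)\simeq \bigvee_{\binom{m}{4}} S^3;$$ and for $n\geq 2$, with $o_{m, n} = \sum \{s_A: A\in\mathcal{F}^m_{n+2} \text{ with }\min A\geq 2\}$, $$\mathcal{VR}(\mathcal{F}_n^{m}\cup \mathcal{F}_{n+2}^m, 2)\simeq\mathcal{VR}(\mathcal{F}^{m-1}_{n-1}\cup \mathcal{F}^{m-1}_{n+1}, 2)\vee \bigvee_{o_{m, n}}S^3.$$ Therefore, $\mathcal{VR}(\mathcal{F}_n^{m}\cup \mathcal{F}_{n+2}^m, 2)$ is homotopy equivalent to a wedge sum of $\sum_{k=2}^n o_{m+k-n, k} +\binom{m+1-n}{4}$ copies of $S^3$.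
   Context: $[m]=\{1,\dots,m\}$. Any collection of subsets of $[m]$ is a finite metric space with $d(A,B)=|A\Delta B|$ (size of the symmetric difference). $\mathcal{F}_n^m$ is the collection of all subsets of $[m]$ of size $n$. For a metric space $X$ and $r\ge 0$, the Vietoris-Rips complex $\mathcal{VR}(X,r)$ is the simplicial complex with vertex set $X$ whose simplices are the nonempty finite subsets of $X$ of diameter at most $r$. For a set $A=\{i_1<i_2<\cdots<i_{p}\}\subseteq[m]$ of size $p$, set $c_1=i_1-1$ and $c_\ell=i_\ell-(i_{\ell-1}+1)$ for $\ell=2,\dots,p$, and $$s_A= \sum_{k=2}^{p-2}\binom{k}{2}+\sum_{\ell=1}^{p-2} c_\ell \binom{p-\ell}{2}.$$ A sum whose upper limit is less than its lower limit is $0$ by convention. $\simeq$ denotes homotopy equivalence (of geometric realizations), $\vee$ wedge sum, and $\bigvee_k X$ the wedge sum of $k$ copies of $X$. *)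

theory Defs
  imports "HOL-Analysis.Analysis"
begin

definition slice :: "nat \<Rightarrow> nat \<Rightarrow> nat set set" where
  "slice m n = {A. A \<subseteq> {1..m} \<and> card A = n}"

lemma finite_slice: "finite (slice m n)"
  unfolding slice_def by (rule finite_subset[of _ "Pow {1..m}"]) auto

lemma finite_in_slice: "A \<in> slice m n \<Longrightarrow> finite A"
  unfolding slice_def using finite_subset by blast

text \<open>
  Only meaningful if all members of the collection are finite: \<^const>\<open>card\<close> is \<open>0\<close>
  on infinite sets, and \<^const>\<open>metric\<close> is unspecified on non-metrics.
\<close>
definition symdiff_metric :: "'a set set \<Rightarrow> 'a set metric" where
  "symdiff_metric S = metric (S, \<lambda>A B. real (card (sym_diff A B)))"

lemma Metric_space_symdiff:
  assumes fin: "\<And>A. A \<in> S \<Longrightarrow> finite A"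
  shows "Metric_space S (\<lambda>A B. real (card (sym_diff A B)))"
proof
  fix A B C :: "'a set"
  show "0 \<le> real (card (sym_diff A B))" by simp
  show "real (card (sym_diff A B)) = real (card (sym_diff B A))"
    by (simp add: Un_commute)
  assume A: "A \<in> S" and B: "B \<in> S"
  then have AB: "finite A" "finite B" using fin by auto
  then show "real (card (sym_diff A B)) = 0 \<longleftrightarrow> A = B" by auto
  assume "C \<in> S"
  with AB have "finite (sym_diff A B \<union> sym_diff B C)" using fin by auto
  then have "card (sym_diff A C) \<le> card (sym_diff A B \<union> sym_diff B C)"
    by (rule card_mono) auto
  also have "\<dots> \<le> card (sym_diff A B) + card (sym_diff B C)"
    by (rule card_Un_le)
  finally show "real (card (sym_diff A C)) \<le> real (card (sym_diff A B)) + real (card (sym_diff B C))"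
    by simp
qed

lemma mspace_symdiff_metric:
  "(\<And>A. A \<in> S \<Longrightarrow> finite A) \<Longrightarrow> mspace (symdiff_metric S) = S"
  unfolding symdiff_metric_def
  by (rule Metric_space.mspace_metric[OF Metric_space_symdiff])

lemma mdist_symdiff_metric:
  "(\<And>A. A \<in> S \<Longrightarrow> finite A) \<Longrightarrow>
     mdist (symdiff_metric S) A B = real (card (sym_diff A B))"
  unfolding symdiff_metric_def
  by (subst Metric_space.mdist_metric[OF Metric_space_symdiff]) auto

definition vietoris_rips :: "'a metric \<Rightarrow> real \<Rightarrow> 'a set set" where
  "vietoris_rips M r =
     {\<sigma>. \<sigma> \<noteq> {} \<and> finite \<sigma> \<and> \<sigma> \<subseteq> mspace M \<and> (\<forall>x\<in>\<sigma>. \<forall>y\<in>\<sigma>. mdist M x y \<le> r)}"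

text \<open>The closed simplex spanned by a finite vertex set, in barycentric coordinates.\<close>
definition simplex_points :: "'a set \<Rightarrow> ('a \<Rightarrow> real) set" where
  "simplex_points \<sigma> =
     {\<alpha>. (\<forall>v. 0 \<le> \<alpha> v) \<and> (\<forall>v. v \<notin> \<sigma> \<longrightarrow> \<alpha> v = 0) \<and> (\<Sum>v\<in>\<sigma>. \<alpha> v) = 1}"

text \<open>The realization carries the weak topology determined by its closed simplices.\<close>
definition realization :: "'a set set \<Rightarrow> ('a \<Rightarrow> real) topology" where
  "realization K = topology (\<lambda>U. U \<subseteq> (\<Union>\<sigma>\<in>K. simplex_points \<sigma>) \<and>
     (\<forall>\<sigma>\<in>K. openin (subtopology (powertop_real UNIV) (simplex_points \<sigma>))
               (U \<inter> simplex_points \<sigma>)))"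

lemma openin_realization:
  "openin (realization K) U \<longleftrightarrow> U \<subseteq> (\<Union>\<sigma>\<in>K. simplex_points \<sigma>) \<and>
     (\<forall>\<sigma>\<in>K. openin (subtopology (powertop_real UNIV) (simplex_points \<sigma>))
               (U \<inter> simplex_points \<sigma>))"
proof -
  have "istopology (\<lambda>U. U \<subseteq> (\<Union>\<sigma>\<in>K. simplex_points \<sigma>) \<and>
     (\<forall>\<sigma>\<in>K. openin (subtopology (powertop_real UNIV) (simplex_points \<sigma>))
               (U \<inter> simplex_points \<sigma>)))" (is "istopology ?L")
    unfolding istopology_def
  proof (intro conjI allI impI)
    fix S T assume S: "?L S" and T: "?L T"
    show "S \<inter> T \<subseteq> (\<Union>\<sigma>\<in>K. simplex_points \<sigma>)" using S by blast
    show "\<forall>\<sigma>\<in>K. openin (subtopology (powertop_real UNIV) (simplex_points \<sigma>))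
               (S \<inter> T \<inter> simplex_points \<sigma>)"
    proof
      fix \<sigma> assume "\<sigma> \<in> K"
      then have "openin (subtopology (powertop_real UNIV) (simplex_points \<sigma>))
               ((S \<inter> simplex_points \<sigma>) \<inter> (T \<inter> simplex_points \<sigma>))"
        using S T by (blast intro: openin_Int)
      moreover have "(S \<inter> simplex_points \<sigma>) \<inter> (T \<inter> simplex_points \<sigma>)
          = S \<inter> T \<inter> simplex_points \<sigma>" by blast
      ultimately show "openin (subtopology (powertop_real UNIV) (simplex_points \<sigma>))
               (S \<inter> T \<inter> simplex_points \<sigma>)" by simp
    qed
  next
    fix \<K> assume H: "\<forall>S\<in>\<K>. ?L S"
    show "\<Union>\<K> \<subseteq> (\<Union>\<sigma>\<in>K. simplex_points \<sigma>)" using H by blast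
    show "\<forall>\<sigma>\<in>K. openin (subtopology (powertop_real UNIV) (simplex_points \<sigma>))
               (\<Union>\<K> \<inter> simplex_points \<sigma>)"
    proof
      fix \<sigma> assume "\<sigma> \<in> K"
      then have "openin (subtopology (powertop_real UNIV) (simplex_points \<sigma>))
               (\<Union>S\<in>\<K>. S \<inter> simplex_points \<sigma>)"
        using H by (intro openin_Union) blast
      then show "openin (subtopology (powertop_real UNIV) (simplex_points \<sigma>))
               (\<Union>\<K> \<inter> simplex_points \<sigma>)" by (simp only: Int_Union2)
    qed
  qed
  then show ?thesis
    by (simp add: realization_def topology_inverse')
qed

lemma topspace_realization: "topspace (realization K) = (\<Union>\<sigma>\<in>K. simplex_points \<sigma>)"
proof
  show "topspace (realization K) \<subseteq> (\<Union>\<sigma>\<in>K. simplex_points \<sigma>)"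
    using openin_realization openin_topspace by blast
  have "openin (realization K) (\<Union>\<sigma>\<in>K. simplex_points \<sigma>)"
    unfolding openin_realization
  proof (intro conjI ballI subset_refl)
    fix \<sigma> assume "\<sigma> \<in> K"
    then have eq: "(\<Union>\<sigma>\<in>K. simplex_points \<sigma>) \<inter> simplex_points \<sigma> = simplex_points \<sigma>" by blast
    have "topspace (subtopology (powertop_real UNIV) (simplex_points \<sigma>)) = simplex_points \<sigma>"
      by simp
    then show "openin (subtopology (powertop_real UNIV) (simplex_points \<sigma>))
               ((\<Union>\<sigma>\<in>K. simplex_points \<sigma>) \<inter> simplex_points \<sigma>)"
      unfolding eq by (metis openin_topspace)
  qed
  then show "(\<Union>\<sigma>\<in>K. simplex_points \<sigma>) \<subseteq> topspace (realization K)"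
    by (rule openin_subset)
qed

definition disjoint_union :: "'a topology \<Rightarrow> 'b topology \<Rightarrow> ('a + 'b) topology" where
  "disjoint_union X Y = topology (\<lambda>U. openin X (Inl -` U) \<and> openin Y (Inr -` U))"

lemma openin_disjoint_union:
  "openin (disjoint_union X Y) U \<longleftrightarrow> openin X (Inl -` U) \<and> openin Y (Inr -` U)"
proof -
  have "istopology (\<lambda>U. openin X (Inl -` U) \<and> openin Y (Inr -` U))"
    unfolding istopology_def by (auto simp: vimage_Union)
  then show ?thesis
    by (simp add: disjoint_union_def topology_inverse')
qed

lemma topspace_disjoint_union: "topspace (disjoint_union X Y) = topspace X <+> topspace Y"
proof
  have "openin (disjoint_union X Y) (topspace (disjoint_union X Y))" by simp
  then have "Inl -` topspace (disjoint_union X Y) \<subseteq> topspace X"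
      "Inr -` topspace (disjoint_union X Y) \<subseteq> topspace Y"
    unfolding openin_disjoint_union by (auto dest: openin_subset)
  then have "z \<in> topspace X <+> topspace Y" if "z \<in> topspace (disjoint_union X Y)" for z
    using that by (cases z) auto
  then show "topspace (disjoint_union X Y) \<subseteq> topspace X <+> topspace Y" by blast
  have "Inl -` (topspace X <+> topspace Y) = topspace X"
      "Inr -` (topspace X <+> topspace Y) = topspace Y" by auto
  then have "openin (disjoint_union X Y) (topspace X <+> topspace Y)"
    by (simp add: openin_disjoint_union)
  then show "topspace X <+> topspace Y \<subseteq> topspace (disjoint_union X Y)"
    by (rule openin_subset)
qed

text \<open>
  The quotient space \<open>X / A\<close> with its quotient topology; \<^const>\<open>None\<close> is the point to which
  \<open>A\<close> is collapsed. With the usual convention, \<open>X / {}\<close> is \<open>X\<close> with an isolated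
  point added, so that the result always has the base point \<^const>\<open>None\<close>.
\<close>
definition collapse_map :: "'a set \<Rightarrow> 'a \<Rightarrow> 'a option" where
  "collapse_map A x = (if x \<in> A then None else Some x)"

definition collapse :: "'a topology \<Rightarrow> 'a set \<Rightarrow> 'a option topology" where
  "collapse X A = topology (\<lambda>U. U \<subseteq> insert None (Some ` (topspace X - A)) \<and>
     openin X {x \<in> topspace X. collapse_map A x \<in> U})"

lemma openin_collapse:
  "openin (collapse X A) U \<longleftrightarrow> U \<subseteq> insert None (Some ` (topspace X - A)) \<and>
     openin X {x \<in> topspace X. collapse_map A x \<in> U}"
proof -
  have "istopology (\<lambda>U. U \<subseteq> insert None (Some ` (topspace X - A)) \<and>
     openin X {x \<in> topspace X. collapse_map A x \<in> U})" (is "istopology ?L")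
    unfolding istopology_def
  proof (intro conjI allI impI)
    fix S T assume S: "?L S" and T: "?L T"
    show "S \<inter> T \<subseteq> insert None (Some ` (topspace X - A))" using S by blast
    have "{x \<in> topspace X. collapse_map A x \<in> S \<inter> T} =
        {x \<in> topspace X. collapse_map A x \<in> S} \<inter> {x \<in> topspace X. collapse_map A x \<in> T}"
      by blast
    then show "openin X {x \<in> topspace X. collapse_map A x \<in> S \<inter> T}"
      using S T by (simp add: openin_Int)
  next
    fix \<K> assume H: "\<forall>S\<in>\<K>. ?L S"
    show "\<Union>\<K> \<subseteq> insert None (Some ` (topspace X - A))" using H by blast
    have "{x \<in> topspace X. collapse_map A x \<in> \<Union>\<K>} =
        (\<Union>S\<in>\<K>. {x \<in> topspace X. collapse_map A x \<in> S})"
      by blast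
    moreover have "openin X (\<Union>S\<in>\<K>. {x \<in> topspace X. collapse_map A x \<in> S})"
      using H by (intro openin_Union) blast
    ultimately show "openin X {x \<in> topspace X. collapse_map A x \<in> \<Union>\<K>}" by simp
  qed
  then show ?thesis
    by (simp add: collapse_def topology_inverse')
qed

lemma topspace_collapse: "topspace (collapse X A) = insert None (Some ` (topspace X - A))"
proof
  show "topspace (collapse X A) \<subseteq> insert None (Some ` (topspace X - A))"
    using openin_collapse openin_topspace by blast
  have "{x \<in> topspace X. collapse_map A x \<in> insert None (Some ` (topspace X - A))} = topspace X"
    by (auto simp: collapse_map_def)
  then have "openin (collapse X A) (insert None (Some ` (topspace X - A)))"
    by (simp add: openin_collapse)
  then show "insert None (Some ` (topspace X - A)) \<subseteq> topspace (collapse X A)"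
    by (rule openin_subset)
qed

lemma quotient_map_collapse:
  assumes "A \<inter> topspace X \<noteq> {}"
  shows "quotient_map X (collapse X A) (collapse_map A)"
proof -
  have "collapse_map A ` topspace X = insert None (Some ` (topspace X - A))"
    using assms by (auto simp: collapse_map_def image_iff)
  then show ?thesis
    by (auto simp: quotient_map_def topspace_collapse openin_collapse)
qed

definition wedge :: "'a topology \<Rightarrow> 'a \<Rightarrow> 'b topology \<Rightarrow> 'b \<Rightarrow> ('a + 'b) option topology" where
  "wedge X x Y y = collapse (disjoint_union X Y) {Inl x, Inr y}"

text \<open>The wedge sum of \<open>k\<close> copies of \<open>(X, x)\<close>; for \<open>k = 0\<close> it is a single point.\<close>
definition wedge_copies :: "nat \<Rightarrow> 'a topology \<Rightarrow> 'a \<Rightarrow> (nat \<times> 'a) option topology" where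
  "wedge_copies k X x = collapse (sum_topology (\<lambda>_. X) {..<k}) ({..<k} \<times> {x})"

definition wedge_S3 :: "nat \<Rightarrow> (nat \<times> (nat \<Rightarrow> real)) option topology" where
  "wedge_S3 k = wedge_copies k (nsphere 3) (\<lambda>i. if i = 0 then 1 else 0)"

text \<open>
  For \<open>A = {i 1 < \<dots> < i p}\<close>, \<open>gap A 1\<close> counts the positive integers below \<open>i 1\<close>, and
  \<open>gap A l\<close> those strictly between \<open>i (l - 1)\<close> and \<open>i l\<close>; only used for \<open>1 \<le> l \<le> p\<close>.
\<close>
definition gap :: "nat set \<Rightarrow> nat \<Rightarrow> nat" where
  "gap A l = (let i = (\<lambda>j. sorted_list_of_set A ! (j - 1))
     in if l = 1 then i 1 - 1 else i l - (i (l - 1) + 1))"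

definition s_num :: "nat set \<Rightarrow> nat" where
  "s_num A = (let p = card A in
     (\<Sum>k = 2..p - 2. k choose 2) + (\<Sum>l = 1..p - 2. gap A l * ((p - l) choose 2)))"

definition o_num :: "nat \<Rightarrow> nat \<Rightarrow> nat" where
  "o_num m n = (\<Sum>A\<in>{A \<in> slice m (n + 2). 2 \<le> Min A}. s_num A)"

definition VR_two_slices :: "nat \<Rightarrow> nat \<Rightarrow> (nat set \<Rightarrow> real) topology" where
  "VR_two_slices m n =
     realization (vietoris_rips (symdiff_metric (slice m n \<union> slice m (n + 2))) 2)"

end

theory Submission
  imports Defs
begin

text \<open>
  The complex is collapsed, by removing open stars of simplices whose links are cones, until it
  consists of a subcomplex \<open>M\<close> and a set of maximal tetrahedra. Then \<open>M\<close> itself is collapsed to a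
  point: in stage \<open>j \<le> n\<close>, where all sets contain \<open>{1..<j}\<close>, all simplices with a vertex
  avoiding \<open>j\<close> are eliminated, and what remains after stage \<open>n\<close> is a cone over the vertex
  \<open>{1..n}\<close>. Hence the complex is homotopy equivalent to its quotient by \<open>M\<close>, a wedge of one
  \<open>S\<^sup>3\<close> for each tetrahedron.

  A tetrahedron in this set has union \<open>T\<close> and intersection \<open>A\<close>, and is determined by the pair;
  splitting these pairs by the least number \<open>j\<close> missing from \<open>T\<close> gives the number
  of spheres, while a double count of pairs of a set and an element of one of its gaps gives
  \<open>o_num m n = (m choose (n + 3)) * ((n + 2) choose 3)\<close>.

  For the wedge sum at an arbitrary point it is used that points of finite complexes are
  nondegenerate base points, so that a free homotopy equivalence can be made a pointed one.
\<close>

section \<open>Simplicial complexes and collapses\<close>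

text \<open>The open star of a simplex can be removed as soon as some vertex may be added to every
  simplex of that star. In stage \<open>j\<close> the natural candidate is a set obtained by putting
  \<open>j\<close> into the sets at hand, and the order of the families is dictated by the search
  for it: configurations with many vertices avoiding \<open>j\<close> go first, because their
  absence bounds the star of a smaller simplex so tightly that a single apex serves all of it. The
  search fails at certain maximal tetrahedra whose vertices all avoid \<open>j\<close>; a stage
  would get stuck there, and so these are set aside as cells from the start. The facets of an
  \<open>(n + 3)\<close>-set span a simplex of dimension \<open>n + 2\<close>, which does not fit
  this scheme; this is why its tetrahedra missing one chosen vertex are collapsed beforehand.

  The recursion in \<open>n\<close> is not derived from a map between the two complexes. Both of its
  sides are recognised as wedges of three-spheres whose number is known, and the numbers
  agree.\<close>

definition simplicial_complex :: "'a set set \<Rightarrow> bool" where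
  "simplicial_complex K \<longleftrightarrow> (\<forall>\<sigma>\<in>K. finite \<sigma> \<and> \<sigma> \<noteq> {} \<and> (\<forall>\<rho>. \<rho> \<subseteq> \<sigma> \<and> \<rho> \<noteq> {} \<longrightarrow> \<rho> \<in> K))"

lemma simplicial_complexD:
  assumes "simplicial_complex K" "\<sigma> \<in> K"
  shows "finite \<sigma>" "\<sigma> \<noteq> {}" "\<And>\<rho>. \<rho> \<subseteq> \<sigma> \<Longrightarrow> \<rho> \<noteq> {} \<Longrightarrow> \<rho> \<in> K"
  using assms unfolding simplicial_complex_def by blast+

section \<open>Realizations of finite complexes as subspaces of a function space\<close>

definition geom :: "'a set set \<Rightarrow> ('a \<Rightarrow> real) set" where
  "geom K = (\<Union>\<sigma>\<in>K. simplex_points \<sigma>)"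

lemma continuous_on_apply: "continuous_on S (\<lambda>\<alpha>::'a \<Rightarrow> 'b::topological_space. \<alpha> v)"
  by (rule continuous_on_subset[OF continuous_on_product_coordinates]) auto

lemma closed_simplex_points: "closed (simplex_points \<sigma>)"
proof -
  have eq: "simplex_points \<sigma> = (\<Inter>v. {\<alpha>. 0 \<le> \<alpha> v}) \<inter> (\<Inter>v\<in>-\<sigma>. {\<alpha>. \<alpha> v = 0}) \<inter> {\<alpha>. (\<Sum>v\<in>\<sigma>. \<alpha> v) = 1}"
    by (auto simp: simplex_points_def)
  show ?thesis unfolding eq
    by (intro closed_Int closed_INT ballI closed_Collect_le closed_Collect_eq continuous_on_sum
        continuous_on_apply continuous_on_const)
qed

text \<open>A closed subset of the cube of all functions into \<open>{0..1}\<close>, which is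
  compact by Tychonoff's theorem for every vertex type.\<close>

lemma compact_simplex_points:
  assumes "finite \<sigma>" shows "compact (simplex_points \<sigma>)"
proof -
  have "compactin (powertop_real UNIV) (PiE UNIV (\<lambda>_. {0..1}))"
    by (subst compactin_PiE) auto
  then have c: "compact (PiE UNIV (\<lambda>_::'a. {0..1::real}))"
    by (simp add: euclidean_product_topology)
  have "simplex_points \<sigma> \<subseteq> PiE UNIV (\<lambda>_. {0..1})"
  proof
    fix \<alpha> assume a: "\<alpha> \<in> simplex_points \<sigma>"
    have "\<alpha> v \<le> 1" for v
    proof (cases "v \<in> \<sigma>")
      case True
      have "\<alpha> v \<le> (\<Sum>v\<in>\<sigma>. \<alpha> v)"
        using a assms True by (intro member_le_sum) (auto simp: simplex_points_def)
      then show ?thesis using a by (simp add: simplex_points_def)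
    qed (use a in \<open>auto simp: simplex_points_def\<close>)
    then show "\<alpha> \<in> PiE UNIV (\<lambda>_. {0..1})" using a by (auto simp: simplex_points_def)
  qed
  then have "simplex_points \<sigma> = PiE UNIV (\<lambda>_. {0..1}) \<inter> simplex_points \<sigma>" by blast
  then show ?thesis using compact_Int_closed[OF c closed_simplex_points, of \<sigma>] by simp
qed

lemma compact_geom:
  assumes "finite K" "\<And>\<sigma>. \<sigma> \<in> K \<Longrightarrow> finite \<sigma>" shows "compact (geom K)"
  unfolding geom_def using assms by (intro compact_UN compact_simplex_points) auto

text \<open>The closed simplices are closed in the ambient product, and there are finitely many of
  them, so a subset of their union is closed as soon as all its traces are. From here on a
  realization is an ordinary subspace, and homotopies can be written down in coordinates.\<close>

lemma realization_eq_geom: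
  assumes "finite K"
  shows "realization K = top_of_set (geom K)"
proof (rule topology_eq[THEN iffD2], intro allI iffI)
  fix U assume U: "openin (realization K) U"
  then have sub: "U \<subseteq> geom K" and
    op: "\<And>\<sigma>. \<sigma> \<in> K \<Longrightarrow> openin (top_of_set (simplex_points \<sigma>)) (U \<inter> simplex_points \<sigma>)"
    unfolding openin_realization geom_def by (auto simp: euclidean_product_topology)
  have "closed (simplex_points \<sigma> - U)" if sK: "\<sigma> \<in> K" for \<sigma>
  proof -
    obtain T where "open T" "U \<inter> simplex_points \<sigma> = simplex_points \<sigma> \<inter> T"
      using op[OF sK] by (auto simp: openin_open)
    then have "simplex_points \<sigma> - U = simplex_points \<sigma> - T" by blast
    then show ?thesis using \<open>open T\<close> by (simp add: closed_Diff closed_simplex_points)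
  qed
  then have "closed (\<Union>\<sigma>\<in>K. simplex_points \<sigma> - U)" using assms by (intro closed_UN) auto
  moreover have "geom K \<inter> - (\<Union>\<sigma>\<in>K. simplex_points \<sigma> - U) = U"
    using sub by (auto simp: geom_def)
  ultimately show "openin (top_of_set (geom K)) U"
    unfolding openin_open by (metis open_Compl)
next
  fix U assume U: "openin (top_of_set (geom K)) U"
  then obtain T where T: "open T" "U = geom K \<inter> T" by (auto simp: openin_open)
  have "openin (top_of_set (simplex_points \<sigma>)) (U \<inter> simplex_points \<sigma>)" if "\<sigma> \<in> K" for \<sigma>
  proof -
    have "U \<inter> simplex_points \<sigma> = simplex_points \<sigma> \<inter> T" using T that by (auto simp: geom_def)
    then show ?thesis using T(1) unfolding openin_open by blast
  qed
  then show "openin (realization K) U"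
    unfolding openin_realization using T by (auto simp: euclidean_product_topology geom_def)
qed

lemma simplex_points_mono:
  assumes "\<sigma> \<subseteq> \<tau>" "finite \<tau>" shows "simplex_points \<sigma> \<subseteq> simplex_points \<tau>"
proof
  fix \<alpha> assume a: "\<alpha> \<in> simplex_points \<sigma>"
  have "(\<Sum>v\<in>\<tau>. \<alpha> v) = (\<Sum>v\<in>\<sigma>. \<alpha> v)"
    using assms a by (intro sum.mono_neutral_right) (auto simp: simplex_points_def)
  then show "\<alpha> \<in> simplex_points \<tau>" using a assms by (auto simp: simplex_points_def)
qed

definition supp :: "('a \<Rightarrow> real) \<Rightarrow> 'a set" where "supp \<alpha> = {v. \<alpha> v \<noteq> 0}"

lemma simplex_points_supp:
  assumes "\<alpha> \<in> simplex_points \<sigma>" "finite \<sigma>"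
  shows "\<alpha> \<in> simplex_points (supp \<alpha>)" "supp \<alpha> \<subseteq> \<sigma>" "supp \<alpha> \<noteq> {}"
proof -
  show s: "supp \<alpha> \<subseteq> \<sigma>" using assms by (auto simp: simplex_points_def supp_def)
  have "(\<Sum>v\<in>supp \<alpha>. \<alpha> v) = (\<Sum>v\<in>\<sigma>. \<alpha> v)"
    using assms s by (intro sum.mono_neutral_left) (auto simp: supp_def)
  then show "\<alpha> \<in> simplex_points (supp \<alpha>)" using assms by (auto simp: simplex_points_def supp_def)
  then show "supp \<alpha> \<noteq> {}" by (auto simp: simplex_points_def)
qed

text \<open>Each point lies in the interior of exactly one simplex, its support. Whether a point
  belongs to a subcomplex is thereby a question about its support alone.\<close>

lemma mem_geom:
  assumes "simplicial_complex K"
  shows "\<alpha> \<in> geom K \<longleftrightarrow> supp \<alpha> \<in> K \<and> \<alpha> \<in> simplex_points (supp \<alpha>)"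
proof
  assume "\<alpha> \<in> geom K"
  then obtain \<sigma> where s: "\<sigma> \<in> K" "\<alpha> \<in> simplex_points \<sigma>" by (auto simp: geom_def)
  then have "finite \<sigma>" using simplicial_complexD assms by blast
  from simplex_points_supp[OF s(2) this] show "supp \<alpha> \<in> K \<and> \<alpha> \<in> simplex_points (supp \<alpha>)"
    using simplicial_complexD(3)[OF assms s(1)] by blast
qed (auto simp: geom_def)

lemma simplex_points_segment:
  assumes "\<alpha> \<in> simplex_points \<sigma>" "\<beta> \<in> simplex_points \<sigma>" "0 \<le> t" "t \<le> 1"
  shows "(\<lambda>v. (1 - t) * \<alpha> v + t * \<beta> v) \<in> simplex_points \<sigma>"
  using assms by (simp add: simplex_points_def sum.distrib flip: sum_distrib_left)

section \<open>Deformation retractions and collapses of complexes\<close>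

definition hequiv :: "'a set set \<Rightarrow> 'a set set \<Rightarrow> bool" where
  "hequiv K L \<longleftrightarrow> geom K homotopy_eqv geom L"

lemma hequiv_refl: "hequiv K K" 
  by (simp add: hequiv_def homotopy_equivalent_space_refl)

lemma hequiv_trans: "hequiv K L \<Longrightarrow> hequiv L N \<Longrightarrow> hequiv K N"
  unfolding hequiv_def by (rule homotopy_eqv_trans)

text \<open>If a point and its image under \<open>r\<close> lie in a common closed simplex, then the
  segment joining them stays in the complex. The straight-line homotopy therefore exists and makes
  the retraction \<open>r\<close> a deformation retraction.\<close>

lemma straight_line_homotopy_eqv:
  fixes r :: "('a \<Rightarrow> real) \<Rightarrow> 'a \<Rightarrow> real"
  assumes cont: "continuous_on (geom K) r"
    and LK: "geom L \<subseteq> geom K"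
    and rL: "\<And>\<alpha>. \<alpha> \<in> geom K \<Longrightarrow> r \<alpha> \<in> geom L"
    and fixL: "\<And>\<alpha>. \<alpha> \<in> geom L \<Longrightarrow> r \<alpha> = \<alpha>"
    and seg: "\<And>\<alpha>. \<alpha> \<in> geom K \<Longrightarrow> \<exists>\<sigma>\<in>K. \<alpha> \<in> simplex_points \<sigma> \<and> r \<alpha> \<in> simplex_points \<sigma>"
  shows "hequiv K L"
proof -
  let ?h = "\<lambda>z. \<lambda>v. (1 - fst z) * r (snd z) v + fst z * (snd z) v"
  have c2: "continuous_on ({0..1} \<times> geom K) (\<lambda>z::real \<times> _. r (snd z) v)" for v
    by (rule continuous_on_product_then_coordinatewise)
       (rule continuous_on_compose2[OF cont continuous_on_snd[OF continuous_on_id]], auto)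
  have c3: "continuous_on ({0..1} \<times> geom K) (\<lambda>z::real \<times> ('a \<Rightarrow> real). snd z v)" for v
    by (rule continuous_on_product_then_coordinatewise) (intro continuous_intros)
  have ch: "continuous_on ({0..1} \<times> geom K) ?h"
    by (intro continuous_on_coordinatewise_then_product continuous_intros c2 c3)
  have "?h ` ({0..1} \<times> geom K) \<subseteq> geom K"
  proof clarify
    fix t :: real and \<alpha> assume t: "t \<in> {0..1}" and a: "\<alpha> \<in> geom K"
    obtain \<sigma> where "\<sigma> \<in> K" "\<alpha> \<in> simplex_points \<sigma>" "r \<alpha> \<in> simplex_points \<sigma>" using seg[OF a] by auto
    then have "?h (t, \<alpha>) \<in> simplex_points \<sigma>" using t by (auto intro!: simplex_points_segment)
    then show "?h (t, \<alpha>) \<in> geom K" using \<open>\<sigma> \<in> K\<close> by (auto simp: geom_def)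
  qed
  then have "homotopic_with_canon (\<lambda>x. True) (geom K) (geom K) r id"
    unfolding homotopic_with_def using ch by (intro exI[of _ ?h]) (auto simp: Pi_iff image_subset_iff)
  then show ?thesis unfolding hequiv_def
    by (rule deformation_retract_imp_homotopy_equivalent_space)
       (use cont LK rL fixL in \<open>auto simp: retraction_maps_def\<close>)
qed

lemma continuous_on_Min:
  assumes "finite A" "A \<noteq> {}" "\<And>v. v \<in> A \<Longrightarrow> continuous_on S (f v :: _ \<Rightarrow> real)"
  shows "continuous_on S (\<lambda>x. Min ((\<lambda>v. f v x) ` A))"
  using assms
proof (induction rule: finite_ne_induct)
  case (insert a A)
  have "(\<lambda>x. Min ((\<lambda>v. f v x) ` insert a A)) = (\<lambda>x. min (f a x) (Min ((\<lambda>v. f v x) ` A)))"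
    using insert by (auto simp: fun_eq_iff)
  then show ?case using insert by (auto intro!: continuous_on_min)
qed auto

text \<open>The point of smallest barycentric coordinate on \<open>\<sigma>\<close> is pushed towards the apex \<open>v\<close>
  until one of the coordinates on \<open>\<sigma>\<close> vanishes.\<close>
lemma hequiv_remove_simplex:
  assumes K: "simplicial_complex K" and s: "finite \<sigma>" "\<sigma> \<noteq> {}" and v: "v \<notin> \<sigma>"
    and cone: "\<And>\<rho>. \<rho> \<in> K \<Longrightarrow> \<sigma> \<subseteq> \<rho> \<Longrightarrow> insert v \<rho> \<in> K"
  shows "hequiv K {\<rho> \<in> K. \<not> \<sigma> \<subseteq> \<rho>}"
proof -
  let ?L = "{\<rho> \<in> K. \<not> \<sigma> \<subseteq> \<rho>}"
  have L: "simplicial_complex ?L" using K unfolding simplicial_complex_def by blast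
  \<comment> \<open>The amount \<open>t\<close> is taken from each of the
    \<open>card \<sigma>\<close> coordinates on \<sigma> and handed to the apex, so the coordinate
    sum remains \<open>1\<close>. Where the support does not contain \<sigma>, \<open>t\<close>
    vanishes and nothing moves.\<close>
  define t where "t \<alpha> = Min ((\<lambda>w. \<alpha> w) ` \<sigma>)" for \<alpha> :: "'a \<Rightarrow> real"
  define r where "r \<alpha> w = \<alpha> w - (if w \<in> \<sigma> then t \<alpha> else 0) + (if w = v then real (card \<sigma>) * t \<alpha> else 0)" for \<alpha> w
  have ct: "continuous_on S t" for S unfolding t_def
    by (intro continuous_on_Min s continuous_on_apply)
  have "continuous_on (geom K) (\<lambda>\<alpha>. r \<alpha> w)" for w
    unfolding r_def by (cases "w \<in> \<sigma>"; cases "w = v"; simp; intro continuous_intros ct continuous_on_apply)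
  then have cr: "continuous_on (geom K) r" by (rule continuous_on_coordinatewise_then_product)
  have t0: "t \<alpha> = 0" if pos: "\<forall>w. 0 \<le> \<alpha> w" and ns: "\<not> \<sigma> \<subseteq> supp \<alpha>" for \<alpha>
  proof -
    obtain w where w: "w \<in> \<sigma>" "\<alpha> w = 0" using ns by (auto simp: supp_def)
    then have "0 \<in> (\<lambda>w. \<alpha> w) ` \<sigma>" by force
    then show ?thesis unfolding t_def using s pos by (intro Min_eqI) auto
  qed
  have r_id: "r \<alpha> = \<alpha>" if "t \<alpha> = 0" for \<alpha> by (auto simp: r_def that)
  have tle: "t \<alpha> \<le> \<alpha> w" if "w \<in> \<sigma>" for \<alpha> w unfolding t_def using s that by auto
  have main: "r \<alpha> \<in> geom ?L \<and> (\<exists>\<sigma>\<in>K. \<alpha> \<in> simplex_points \<sigma> \<and> r \<alpha> \<in> simplex_points \<sigma>)"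
    if a: "\<alpha> \<in> geom K" for \<alpha>
  proof (cases "\<sigma> \<subseteq> supp \<alpha>")
    case False
    have A: "supp \<alpha> \<in> K" "\<alpha> \<in> simplex_points (supp \<alpha>)" using a mem_geom[OF K] by auto
    then have "r \<alpha> = \<alpha>" using False by (intro r_id t0) (auto simp: simplex_points_def)
    then show ?thesis using A False mem_geom[OF L, of \<alpha>] by auto
  next
    case True
    have A: "supp \<alpha> \<in> K" "\<alpha> \<in> simplex_points (supp \<alpha>)" using a mem_geom[OF K] by auto
    let ?\<rho> = "insert v (supp \<alpha>)"
    have \<rho>: "?\<rho> \<in> K" using cone[OF A(1) True] .
    then have f: "finite ?\<rho>" by (rule simplicial_complexD(1)[OF K])
    have a\<rho>: "\<alpha> \<in> simplex_points ?\<rho>" using A(2) simplex_points_mono[OF _ f, of "supp \<alpha>"] by blast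
    have t: "0 \<le> t \<alpha>" unfolding t_def using s A(2) by (simp add: simplex_points_def)
    have nn: "0 \<le> \<alpha> w" for w using A(2) by (simp add: simplex_points_def)
    have pos: "0 \<le> r \<alpha> w" for w
      using tle[of w \<alpha>] t nn[of w] v by (simp add: r_def)
    have out: "r \<alpha> w = 0" if "w \<notin> ?\<rho>" for w
    proof -
      have "w \<notin> \<sigma>" "w \<noteq> v" "\<alpha> w = 0" using that True by (auto simp: supp_def)
      then show ?thesis by (simp add: r_def)
    qed
    have "(\<Sum>w\<in>?\<rho>. r \<alpha> w) = (\<Sum>w\<in>?\<rho>. \<alpha> w) - (\<Sum>w\<in>?\<rho>. if w \<in> \<sigma> then t \<alpha> else 0) 
        + (\<Sum>w\<in>?\<rho>. if w = v then real (card \<sigma>) * t \<alpha> else 0)"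
      by (simp only: r_def sum.distrib sum_subtractf)
    also have "(\<Sum>w\<in>?\<rho>. if w \<in> \<sigma> then t \<alpha> else 0) = real (card \<sigma>) * t \<alpha>"
    proof -
      have "?\<rho> \<inter> \<sigma> = \<sigma>" using True by auto
      then show ?thesis using f by (subst sum.inter_restrict[symmetric]) auto
    qed
    also have "(\<Sum>w\<in>?\<rho>. if w = v then real (card \<sigma>) * t \<alpha> else 0) = real (card \<sigma>) * t \<alpha>"
      using f by (subst sum.delta) auto
    finally have "(\<Sum>w\<in>?\<rho>. r \<alpha> w) = 1" using a\<rho> by (simp add: simplex_points_def)
    then have r\<rho>: "r \<alpha> \<in> simplex_points ?\<rho>" using pos out unfolding simplex_points_def by blast
    have "t \<alpha> \<in> \<alpha> ` \<sigma>" unfolding t_def using s by (intro Min_in) auto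
    then obtain w where "w \<in> \<sigma>" "\<alpha> w = t \<alpha>" by auto
    then have "r \<alpha> w = 0" using v by (auto simp: r_def)
    then have "w \<notin> supp (r \<alpha>)" by (simp add: supp_def)
    then have "\<not> \<sigma> \<subseteq> supp (r \<alpha>)" using \<open>w \<in> \<sigma>\<close> by auto
    moreover have "supp (r \<alpha>) \<in> K \<and> r \<alpha> \<in> simplex_points (supp (r \<alpha>))"
      using r\<rho> \<rho> mem_geom[OF K, of "r \<alpha>"] unfolding geom_def by blast
    ultimately show ?thesis using mem_geom[OF L, of "r \<alpha>"] a\<rho> r\<rho> \<rho> by blast
  qed
  show ?thesis
  proof (rule straight_line_homotopy_eqv[OF cr])
    show "geom ?L \<subseteq> geom K" by (auto simp: geom_def)
    show "r \<alpha> = \<alpha>" if "\<alpha> \<in> geom ?L" for \<alpha>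
      using that mem_geom[OF L, of \<alpha>] by (intro r_id t0) (auto simp: simplex_points_def)
  qed (use main in auto)
qed

lemma simplicial_complex_filter:
  assumes "simplicial_complex K" "\<And>\<rho> \<sigma>. \<sigma> \<subseteq> \<rho> \<Longrightarrow> P \<rho> \<Longrightarrow> P \<sigma>"
  shows "simplicial_complex {\<rho> \<in> K. P \<rho>}"
  unfolding simplicial_complex_def
proof (intro ballI conjI allI impI)
  fix \<sigma> assume "\<sigma> \<in> {\<rho> \<in> K. P \<rho>}"
  then have s: "\<sigma> \<in> K" "P \<sigma>" by auto
  show "finite \<sigma>" "\<sigma> \<noteq> {}" using simplicial_complexD[OF assms(1) s(1)] by auto
  fix \<rho> assume "\<rho> \<subseteq> \<sigma> \<and> \<rho> \<noteq> {}"
  then show "\<rho> \<in> {\<rho> \<in> K. P \<rho>}"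
    using simplicial_complexD(3)[OF assms(1) s(1)] assms(2)[OF _ s(2)] by blast
qed

text \<open>The members of \<open>S\<close> are removed one at a time, in any order. The last
  hypothesis says that adding an apex never completes another member of \<open>S\<close>; this is
  why the cone condition, assumed for \<open>K\<close> only, is inherited by all intermediate
  complexes.\<close>

lemma hequiv_remove_simplices:
  assumes K: "simplicial_complex K" and S: "finite S" "\<And>\<sigma>. \<sigma> \<in> S \<Longrightarrow> finite \<sigma> \<and> \<sigma> \<noteq> {} \<and> a \<sigma> \<notin> \<sigma>"
    and cone: "\<And>\<rho> \<sigma>. \<sigma> \<in> S \<Longrightarrow> \<rho> \<in> K \<Longrightarrow> \<sigma> \<subseteq> \<rho> \<Longrightarrow> insert (a \<sigma>) \<rho> \<in> K"
    and indep: "\<And>\<rho> \<sigma> \<tau>. \<sigma> \<in> S \<Longrightarrow> \<tau> \<in> S \<Longrightarrow> \<rho> \<in> K \<Longrightarrow> \<sigma> \<subseteq> \<rho> \<Longrightarrow> \<tau> \<subseteq> insert (a \<sigma>) \<rho> \<Longrightarrow> \<tau> \<subseteq> \<rho>"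
  shows "hequiv K {\<rho> \<in> K. \<forall>\<sigma>\<in>S. \<not> \<sigma> \<subseteq> \<rho>}"
proof -
  have "hequiv K {\<rho> \<in> K. \<forall>\<sigma>\<in>T. \<not> \<sigma> \<subseteq> \<rho>}" if "T \<subseteq> S" for T
    using finite_subset[OF that S(1)] that
  proof (induction T rule: finite_induct)
    case empty then show ?case by (simp add: hequiv_refl)
  next
    case (insert \<sigma> T)
    let ?K = "{\<rho> \<in> K. \<forall>\<sigma>\<in>T. \<not> \<sigma> \<subseteq> \<rho>}"
    have "hequiv ?K {\<rho> \<in> ?K. \<not> \<sigma> \<subseteq> \<rho>}"
    proof (rule hequiv_remove_simplex)
      show "simplicial_complex ?K" by (rule simplicial_complex_filter[OF K]) auto
      show "finite \<sigma>" "\<sigma> \<noteq> {}" "a \<sigma> \<notin> \<sigma>" using S(2)[of \<sigma>] insert.prems by auto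
      show "insert (a \<sigma>) \<rho> \<in> ?K" if "\<rho> \<in> ?K" "\<sigma> \<subseteq> \<rho>" for \<rho>
      proof -
        have \<rho>: "\<rho> \<in> K" "\<sigma> \<in> S" using that(1) insert.prems by auto
        have "\<not> \<tau> \<subseteq> insert (a \<sigma>) \<rho>" if "\<tau> \<in> T" for \<tau>
          using indep[OF \<rho>(2) _ \<rho>(1) \<open>\<sigma> \<subseteq> \<rho>\<close>, of \<tau>] that \<open>\<rho> \<in> ?K\<close> insert.prems by blast
        then show ?thesis using cone[OF \<rho>(2,1) that(2)] by simp
      qed
    qed
    also have "{\<rho> \<in> ?K. \<not> \<sigma> \<subseteq> \<rho>} = {\<rho> \<in> K. \<forall>\<sigma>\<in>insert \<sigma> T. \<not> \<sigma> \<subseteq> \<rho>}" by auto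
    finally show ?case using hequiv_trans[OF insert.IH] insert.prems by simp
  qed
  then show ?thesis by blast
qed

text \<open>The constant map to the apex is a retraction whose segments stay inside the simplices
  \<open>insert v \<rho>\<close>. The one-point complex \<open>{{v}}\<close> is the form in which
  contractibility is handed on to the attaching of cells.\<close>

lemma hequiv_apex_of_cone:
  assumes K: "simplicial_complex K" and v: "{v} \<in> K" and cone: "\<And>\<rho>. \<rho> \<in> K \<Longrightarrow> insert v \<rho> \<in> K"
  shows "hequiv K {{v}}"
proof (rule straight_line_homotopy_eqv[where r = "\<lambda>_. (\<lambda>w. if w = v then 1 else 0)"])
  let ?e = "\<lambda>w. if w = v then 1 else 0 :: real"
  have e: "?e \<in> simplex_points {v}" by (auto simp: simplex_points_def)
  have e2: "\<alpha> = ?e" if "\<alpha> \<in> simplex_points {v}" for \<alpha>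
    using that by (auto simp: simplex_points_def fun_eq_iff)
  show "geom {{v}} \<subseteq> geom K" using v by (auto simp: geom_def)
  show "?e \<in> geom {{v}}" using e by (auto simp: geom_def)
  show "\<And>\<alpha>. \<alpha> \<in> geom {{v}} \<Longrightarrow> ?e = \<alpha>" using e2 by (auto simp: geom_def)
  fix \<alpha> assume "\<alpha> \<in> geom K"
  then have A: "supp \<alpha> \<in> K" "\<alpha> \<in> simplex_points (supp \<alpha>)" using mem_geom[OF K] by auto
  then have i: "insert v (supp \<alpha>) \<in> K" using cone by blast
  then have f: "finite (insert v (supp \<alpha>))" by (rule simplicial_complexD(1)[OF K])
  show "\<exists>\<sigma>\<in>K. \<alpha> \<in> simplex_points \<sigma> \<and> ?e \<in> simplex_points \<sigma>"
    using simplex_points_mono[OF _ f] A(2) e i by (intro bexI[OF _ i] conjI) blast+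
qed (rule continuous_on_const)

section \<open>Wedges of three-spheres\<close>

lemma Hausdorff_fun_euclidean:
  assumes "Hausdorff_space (euclidean :: 'b::topological_space topology)"
  shows "Hausdorff_space (euclidean :: ('a \<Rightarrow> 'b) topology)"
  unfolding euclidean_product_topology[symmetric] using assms by (simp add: Hausdorff_space_product_topology)

definition three_sphere :: "(nat \<Rightarrow> real) set" where
  "three_sphere = {x. (\<Sum>i\<le>3. x i ^ 2) = 1 \<and> (\<forall>i>3. x i = 0)}"

definition pole :: "nat \<Rightarrow> real" where
  "pole = (\<lambda>i. if i = 0 then 1 else 0)"

lemma nsphere_3: "nsphere 3 = top_of_set three_sphere"
  by (simp add: nsphere three_sphere_def euclidean_product_topology)

lemma sum_le_3: "(\<Sum>i\<le>3. f i) = f 0 + f 1 + f 2 + (f 3 :: real)" for f :: "nat \<Rightarrow> real"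
  by (simp add: numeral_3_eq_3 numeral_2_eq_2)

lemma pole_in_three_sphere: "pole \<in> three_sphere"
  by (simp add: three_sphere_def pole_def sum_le_3)

lemma compact_box_fun: 
  assumes "\<And>i. compact (B i)" shows "compact (PiE UNIV (B :: 'a \<Rightarrow> ('b::topological_space) set))"
proof -
  have "compactin (product_topology (\<lambda>_. euclidean) UNIV) (PiE UNIV B)"
    using assms by (subst compactin_PiE) auto
  then show ?thesis by (simp add: euclidean_product_topology)
qed

lemma compact_three_sphere: "compact three_sphere"
proof -
  have "three_sphere \<subseteq> PiE UNIV (\<lambda>_. {-1..1})"
  proof
    fix x assume x: "x \<in> three_sphere"
    have "\<bar>x i\<bar> \<le> 1" for i
    proof (cases "i \<le> 3")
      case True
      have "x i ^ 2 \<le> (\<Sum>i\<le>3. x i ^ 2)" using True by (intro member_le_sum) auto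
      then show ?thesis using x by (simp add: three_sphere_def abs_square_le_1)
    qed (use x in \<open>auto simp: three_sphere_def\<close>)
    then show "x \<in> PiE UNIV (\<lambda>_. {-1..1})" by (auto simp: abs_le_iff minus_le_iff)
  qed
  moreover have "closed three_sphere"
  proof -
    have eq: "three_sphere = {x. (\<Sum>i\<le>3. x i ^ 2) = 1} \<inter> (\<Inter>i\<in>{3<..}. {x. x i = 0})"
      by (auto simp: three_sphere_def)
    show ?thesis unfolding eq
      by (intro closed_Int closed_INT ballI closed_Collect_eq continuous_on_sum continuous_on_power
          continuous_on_const continuous_on_apply)
  qed
  moreover have "compact (PiE UNIV (\<lambda>_::nat. {-1..1::real}))" by (rule compact_box_fun) simp
  ultimately show ?thesis using compact_Int_closed[of "PiE UNIV (\<lambda>_. {-1..1})" three_sphere]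
    by (simp add: inf_absorb2)
qed

text \<open>The wedge of \<open>k\<close> spheres as the union of the coordinate axes in a product of spheres.\<close>
definition sphere_axes :: "nat \<Rightarrow> (nat \<Rightarrow> nat \<Rightarrow> real) set" where
  "sphere_axes k = {F. (\<forall>i. F i \<in> three_sphere) \<and> (\<forall>i\<ge>k. F i = pole) \<and>
      (\<forall>i j. i \<noteq> j \<longrightarrow> F i = pole \<or> F j = pole)}"

lemma Hausdorff_sphere_axes: "Hausdorff_space (top_of_set (sphere_axes k))"
  by (intro Hausdorff_space_subtopology Hausdorff_fun_euclidean) simp

text \<open>The universal property of the quotient. The value at \<open>None\<close> needs its own
  assumption because for \<open>A\<close> disjoint from \<open>X\<close> the base point is isolated
  and not hit by \<open>collapse_map A\<close>.\<close>

lemma continuous_map_from_collapse: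
  assumes f: "continuous_map X Y (f \<circ> collapse_map A)" and n: "f None \<in> topspace Y"
  shows "continuous_map (collapse X A) Y f"
  unfolding continuous_map_def
proof (intro conjI allI impI)
  show "f \<in> topspace (collapse X A) \<rightarrow> topspace Y"
  proof
    fix z assume "z \<in> topspace (collapse X A)"
    then consider "z = None" | x where "x \<in> topspace X" "x \<notin> A" "z = Some x"
      by (auto simp: topspace_collapse)
    then show "f z \<in> topspace Y"
    proof cases
      case 2
      then have "f z = (f \<circ> collapse_map A) x" by (simp add: collapse_map_def)
      then show ?thesis using f 2(1) by (metis continuous_map_image_subset_topspace image_subset_iff)
    qed (use n in simp)
  qed
  fix U assume "openin Y U"
  then have "openin X {x \<in> topspace X. (f \<circ> collapse_map A) x \<in> U}"
    using f by (simp add: continuous_map_def)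
  moreover have "{x \<in> topspace X. (f \<circ> collapse_map A) x \<in> U}
     = {x \<in> topspace X. collapse_map A x \<in> {z \<in> topspace (collapse X A). f z \<in> U}}"
    by (auto simp: topspace_collapse collapse_map_def)
  ultimately show "openin (collapse X A) {z \<in> topspace (collapse X A). f z \<in> U}"
    unfolding openin_collapse by (auto simp: topspace_collapse)
qed

lemma continuous_map_collapse_map: "continuous_map X (collapse X A) (collapse_map A)"
  unfolding continuous_map_def by (auto simp: topspace_collapse collapse_map_def openin_collapse)

lemma compact_space_collapse:
  assumes "compact_space X" shows "compact_space (collapse X A)"
proof -
  have "compactin (collapse X A) (collapse_map A ` topspace X)"
    using assms continuous_map_collapse_map compact_space_def image_compactin by blast
  \<comment> \<open>If \<open>A\<close> misses the space, \<open>None\<close> lies outside the image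
    of the quotient map and must be added.\<close>
  moreover have "compactin (collapse X A) {None}"
    by (simp add: topspace_collapse)
  ultimately have "compactin (collapse X A) (collapse_map A ` topspace X \<union> {None})"
    by (rule compactin_Un)
  moreover have "topspace (collapse X A) = collapse_map A ` topspace X \<union> {None}"
    by (auto simp: topspace_collapse collapse_map_def image_iff)
  ultimately show ?thesis by (simp add: compact_space_def)
qed

lemma compact_space_sum_topology:
  assumes "finite I" "\<And>i. i \<in> I \<Longrightarrow> compact_space (X i)"
  shows "compact_space (sum_topology X I)"
proof -
  have "compactin (sum_topology X I) (\<Union>i\<in>I. Pair i ` topspace (X i))"
  proof (rule compactin_Union)
    show "finite ((\<lambda>i. Pair i ` topspace (X i)) ` I)" using assms by auto
    fix S assume "S \<in> (\<lambda>i. Pair i ` topspace (X i)) ` I"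
    then obtain i where i: "i \<in> I" "S = Pair i ` topspace (X i)" by auto
    have "continuous_map (X i) (sum_topology X I) (Pair i)"
      using continuous_map_component_injection[OF i(1), of X] by simp
    then show "compactin (sum_topology X I) S"
      using i assms(2) compact_space_def image_compactin by blast
  qed
  moreover have "(\<Union>i\<in>I. Pair i ` topspace (X i)) = topspace (sum_topology X I)" by auto
  ultimately show ?thesis by (simp add: compact_space_def)
qed

definition axes_map :: "(nat \<times> (nat \<Rightarrow> real)) option \<Rightarrow> nat \<Rightarrow> nat \<Rightarrow> real" where
  "axes_map z = (case z of None \<Rightarrow> \<lambda>_. pole | Some (i, x) \<Rightarrow> (\<lambda>j. if j = i then x else pole))"

lemma wedge_S3_eq:
  "wedge_S3 k = collapse (sum_topology (\<lambda>_. nsphere 3) {..<k}) ({..<k} \<times> {pole})"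
  by (simp add: wedge_S3_def wedge_copies_def pole_def)

lemma None_in_wedge_S3: "None \<in> topspace (wedge_S3 k)"
  by (simp add: wedge_S3_eq topspace_collapse)

lemma compact_wedge_S3: "compact_space (wedge_S3 k)"
  unfolding wedge_S3_eq
  by (intro compact_space_collapse compact_space_sum_topology)
     (auto simp: nsphere_3 compact_space_subtopology compact_three_sphere)

text \<open>A continuous bijection from a compact space onto a Hausdorff one. It trades the abstract
  quotient for a set of functions, where continuity is checked coordinatewise and the Hausdorff
  property is inherited.\<close>

lemma homeomorphic_map_axes:
  "homeomorphic_map (wedge_S3 k) (top_of_set (sphere_axes k)) axes_map"
proof (rule T1_Spaces.continuous_imp_homeomorphic_map)
  note W = wedge_S3_eq
  have ts: "topspace (wedge_S3 k) = insert None (Some ` ({..<k} \<times> (three_sphere - {pole})))"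
    unfolding W topspace_collapse by (auto simp: nsphere_3)
  show "continuous_map (wedge_S3 k) (top_of_set (sphere_axes k)) axes_map"
    unfolding W
  proof (rule continuous_map_from_collapse)
    show "axes_map None \<in> topspace (top_of_set (sphere_axes k))"
      by (simp add: axes_map_def sphere_axes_def pole_in_three_sphere)
    let ?f = "\<lambda>(i, x). (\<lambda>j. if j = i then x else pole) :: nat \<Rightarrow> nat \<Rightarrow> real"
    have eq: "(axes_map \<circ> collapse_map ({..<k} \<times> {pole})) z = ?f z"
      if "z \<in> topspace (sum_topology (\<lambda>_. nsphere 3) {..<k})" for z
      using that by (auto simp: axes_map_def collapse_map_def)
    have "continuous_map (sum_topology (\<lambda>_. nsphere 3) {..<k}) (top_of_set (sphere_axes k)) ?f"
    proof -
      have c: "continuous_on three_sphere (\<lambda>x j. if j = i then x else pole)" for i :: nat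
      proof (rule continuous_on_coordinatewise_then_product)
        show "continuous_on three_sphere (\<lambda>x. if j = i then x else pole)" for j
          by (cases "j = i") (simp_all add: continuous_on_id)
      qed
      have "continuous_map (nsphere 3) (top_of_set (sphere_axes k)) (\<lambda>x. ?f (i, x))" if "i < k" for i
        using c[of i] that pole_in_three_sphere by (auto simp: nsphere_3 sphere_axes_def)
      then show ?thesis unfolding continuous_map_def openin_sum_topology
        by (auto simp: nsphere_3 sphere_axes_def pole_in_three_sphere)
    qed
    then show "continuous_map (sum_topology (\<lambda>_. nsphere 3) {..<k}) (top_of_set (sphere_axes k))
        (axes_map \<circ> collapse_map ({..<k} \<times> {pole}))"
      using continuous_map_eq eq by (metis (no_types, lifting))
  qed
  show "compact_space (wedge_S3 k)" by (rule compact_wedge_S3)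
  show "Hausdorff_space (top_of_set (sphere_axes k))" by (rule Hausdorff_sphere_axes)
  show "inj_on axes_map (topspace (wedge_S3 k))"
    unfolding ts
  proof (rule inj_onI)
    fix y z assume y: "y \<in> insert None (Some ` ({..<k} \<times> (three_sphere - {pole})))"
      and z: "z \<in> insert None (Some ` ({..<k} \<times> (three_sphere - {pole})))" and eq: "axes_map y = axes_map z"
    have e: "axes_map y i = axes_map z i" for i using eq by simp
    show "y = z"
    proof (cases y)
      case None
      show ?thesis
      proof (cases z)
        case (Some p)
        then show ?thesis using None e[of "fst p"] z by (auto simp: axes_map_def)
      qed (use None in simp)
    next
      case y': (Some p)
      show ?thesis
      proof (cases z)
        case None
        then show ?thesis using y' e[of "fst p"] y by (auto simp: axes_map_def)
      next
        case (Some q)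
        then have "fst p = fst q" using y' e[of "fst p"] y
          by (cases p; cases q) (auto simp: axes_map_def split: if_splits)
        then show ?thesis using y' Some e[of "fst p"] by (cases p; cases q) (auto simp: axes_map_def)
      qed
    qed
  qed
  show "axes_map ` topspace (wedge_S3 k) = topspace (top_of_set (sphere_axes k))"
  proof
    show "axes_map ` topspace (wedge_S3 k) \<subseteq> topspace (top_of_set (sphere_axes k))"
      unfolding ts by (auto simp: axes_map_def sphere_axes_def pole_in_three_sphere)
    show "topspace (top_of_set (sphere_axes k)) \<subseteq> axes_map ` topspace (wedge_S3 k)"
    proof
      fix F assume "F \<in> topspace (top_of_set (sphere_axes k))"
      then have F: "\<And>i. F i \<in> three_sphere" "\<And>i. i \<ge> k \<Longrightarrow> F i = pole"
        "\<And>i j. i \<noteq> j \<Longrightarrow> F i = pole \<or> F j = pole" by (auto simp: sphere_axes_def)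
      show "F \<in> axes_map ` topspace (wedge_S3 k)"
      proof (cases "\<forall>i. F i = pole")
        case True
        then have "F = axes_map None" by (auto simp: axes_map_def)
        then show ?thesis unfolding ts by blast
      next
        case False
        then obtain i where i: "F i \<noteq> pole" by auto
        then have "i < k" using F(2) not_le by blast
        moreover have "F = axes_map (Some (i, F i))" using F(3)[of i] i by (auto simp: axes_map_def)
        ultimately show ?thesis unfolding ts using F(1)[of i] i by blast
      qed
    qed
  qed
qed

lemma wedge_S3_homeomorphic_axes: "wedge_S3 k homeomorphic_space top_of_set (sphere_axes k)"
  using homeomorphic_map_axes homeomorphic_map_imp_homeomorphic_space by blast

lemma compact_sphere_axes: "compact_space (top_of_set (sphere_axes k))"
  using wedge_S3_homeomorphic_axes compact_wedge_S3 homeomorphic_compact_space by blast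

lemma Hausdorff_wedge_S3: "Hausdorff_space (wedge_S3 k)"
  using wedge_S3_homeomorphic_axes Hausdorff_sphere_axes homeomorphic_Hausdorff_space by blast

text \<open>The homotopy inverse of \<open>q\<close> is \<open>H\<close> at time \<open>1\<close>:
  it is constant on \<open>M\<close> and so factors through \<open>q\<close>. The deformation
  \<open>H\<close> itself descends to a homotopy on \<open>W\<close>, because it maps
  \<open>M\<close> into \<open>M\<close> at all times. Compactness of \<open>X\<close> and the
  Hausdorff property of \<open>W\<close> supply the quotient topology, so \<open>W\<close> may be
  any concrete model of the space \<open>X / M\<close>.\<close>

lemma collapse_contractible_homotopy_equivalent:
  assumes X: "compact_space X" and W: "Hausdorff_space W"
    and q: "continuous_map X W q" "q ` topspace X = topspace W"
    and M: "M \<subseteq> topspace X" "M \<noteq> {}" and qM: "\<And>x y. x \<in> M \<Longrightarrow> y \<in> M \<Longrightarrow> q x = q y"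
    and inj: "\<And>x y. x \<in> topspace X \<Longrightarrow> y \<in> topspace X \<Longrightarrow> q x = q y \<Longrightarrow> x \<noteq> y \<Longrightarrow> x \<in> M \<and> y \<in> M"
    and H: "continuous_map (prod_topology (top_of_set {0..1::real}) X) X H"
    and H0: "\<And>x. x \<in> topspace X \<Longrightarrow> H (0, x) = x"
    and HM: "\<And>t x. t \<in> {0..1} \<Longrightarrow> x \<in> M \<Longrightarrow> H (t, x) \<in> M"
    and H1: "\<And>x. x \<in> M \<Longrightarrow> H (1, x) = p"
  shows "X homotopy_equivalent_space W"
proof -
  \<comment> \<open>A set-theoretic section, in general not continuous. It is used only where the
    choice of a point of \<open>M\<close> makes no difference: under \<open>H\<close> at time
    \<open>1\<close>, and under \<open>H\<close> followed by \<open>q\<close>.\<close>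
  define s where "s w = (SOME x. x \<in> topspace X \<and> q x = w)" for w
  have s: "s w \<in> topspace X" "q (s w) = w" if "w \<in> topspace W" for w
  proof -
    have "\<exists>x. x \<in> topspace X \<and> q x = w" using that q(2) by (metis image_iff)
    from someI_ex[OF this] show "s w \<in> topspace X" "q (s w) = w" by (auto simp: s_def)
  qed
  have sq: "s (q x) = x \<or> (s (q x) \<in> M \<and> x \<in> M)" if "x \<in> topspace X" for x
    using inj[of "s (q x)" x] s[of "q x"] that q(2) by (metis imageI)
  define g where "g w = H (1, s w)" for w
  have gq: "g (q x) = H (1, x)" if "x \<in> topspace X" for x
    using sq[OF that] H1 by (auto simp: g_def)
  have cH: "continuous_map X X (\<lambda>x. H (t, x))" if "t \<in> {0..1}" for t
    using continuous_map_o_Pair[OF H, of t] that by (simp add: o_def)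
  have quo: "quotient_map X W q" using T1_Spaces.continuous_imp_quotient_map[OF q(1) X W q(2)] .
  have "continuous_map X X (g \<circ> q)"
    by (rule continuous_map_eq[OF cH[of 1]]) (auto simp: gq)
  then have cg: "continuous_map W X g" by (rule continuous_compose_quotient_map[OF quo])
  let ?I = "top_of_set {0..1::real}"
  let ?Q = "\<lambda>z. (fst z, q (snd z))"
  have cQ: "continuous_map (prod_topology ?I X) (prod_topology ?I W) ?Q"
  proof -
    have "continuous_map (prod_topology ?I X) W (q \<circ> snd)"
      by (rule continuous_map_compose[OF continuous_map_snd q(1)])
    then show ?thesis by (intro continuous_map_pairedI continuous_map_fst) (simp add: o_def)
  qed
  \<comment> \<open>The product of a quotient map with the interval has to be a quotient map again;
    here this follows once more from mapping a compact space onto a Hausdorff space.\<close>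
  have quo2: "quotient_map (prod_topology ?I X) (prod_topology ?I W) ?Q"
  proof (rule T1_Spaces.continuous_imp_quotient_map[OF cQ])
    show "compact_space (prod_topology ?I X)"
      using X by (simp add: compact_space_prod_topology compact_space_subtopology)
    show "Hausdorff_space (prod_topology ?I W)"
      using W by (simp add: Hausdorff_space_prod_topology Hausdorff_space_subtopology)
    show "?Q ` topspace (prod_topology ?I X) = topspace (prod_topology ?I W)"
      using q(2) by (force simp: image_iff)
  qed
  let ?K = "\<lambda>z. q (H (fst z, s (snd z)))"
  have Kq: "(?K \<circ> ?Q) z = (q \<circ> H) z" if z: "z \<in> topspace (prod_topology ?I X)" for z
  proof (cases z)
    case (Pair t x)
    then have t: "t \<in> {0..1}" "x \<in> topspace X" using z by auto
    show ?thesis using sq[OF t(2)] HM[OF t(1)] qM Pair by (auto simp: o_def)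
  qed
  have "continuous_map (prod_topology ?I X) W (?K \<circ> ?Q)"
    by (rule continuous_map_eq[OF continuous_map_compose[OF H q(1)]]) (rule Kq[symmetric])
  then have cK: "continuous_map (prod_topology ?I W) W ?K"
    by (rule continuous_compose_quotient_map[OF quo2])
  have 1: "homotopic_with (\<lambda>x. True) X X id (g \<circ> q)"
    by (subst homotopic_with) (auto intro!: exI[of _ H] simp: H H0 gq)
  have "homotopic_with (\<lambda>x. True) W W id (q \<circ> g)"
    by (subst homotopic_with) (auto intro!: exI[of _ ?K] cK simp: H0 s g_def)
  then have 2: "homotopic_with (\<lambda>x. True) W W (q \<circ> g) id" by (rule homotopic_with_symD)
  show ?thesis unfolding homotopy_equivalent_space_def
    by (intro exI[of _ q] exI[of _ g] conjI q(1) cg homotopic_with_symD[OF 1] 2)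
qed

section \<open>Attaching tetrahedra to a contractible complex\<close>

definition min_coord :: "'a set \<Rightarrow> ('a \<Rightarrow> real) \<Rightarrow> real" where
  "min_coord \<sigma> \<alpha> = Min (\<alpha> ` \<sigma>)"

lemma min_coord_le: "finite \<sigma> \<Longrightarrow> v \<in> \<sigma> \<Longrightarrow> min_coord \<sigma> \<alpha> \<le> \<alpha> v"
  by (simp add: min_coord_def)

lemma min_coord_attained: "finite \<sigma> \<Longrightarrow> \<sigma> \<noteq> {} \<Longrightarrow> \<exists>v\<in>\<sigma>. \<alpha> v = min_coord \<sigma> \<alpha>"
  unfolding min_coord_def using Min_in[of "\<alpha> ` \<sigma>"] by (metis (no_types) finite_imageI image_iff image_is_empty)

lemma min_coord_eq_0:
  assumes "finite \<sigma>" "\<And>v. 0 \<le> \<alpha> v" "\<not> \<sigma> \<subseteq> supp \<alpha>" shows "min_coord \<sigma> \<alpha> = 0"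
proof -
  obtain w where w: "w \<in> \<sigma>" "\<alpha> w = 0" using assms(3) by (auto simp: supp_def)
  then have "0 \<in> \<alpha> ` \<sigma>" by force
  then show ?thesis unfolding min_coord_def using assms by (intro Min_eqI) auto
qed

lemma continuous_on_min_coord: "finite \<sigma> \<Longrightarrow> \<sigma> \<noteq> {} \<Longrightarrow> continuous_on S (min_coord \<sigma>)"
proof -
  assume "finite \<sigma>" "\<sigma> \<noteq> {}"
  then have "continuous_on S (\<lambda>\<alpha>. Min ((\<lambda>v. \<alpha> v) ` \<sigma>))" by (intro continuous_on_Min continuous_on_apply)
  then show ?thesis by (simp add: min_coord_def[abs_def])
qed

lemma simplex_points_nonneg: "\<alpha> \<in> simplex_points \<sigma> \<Longrightarrow> 0 \<le> \<alpha> v"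
  by (simp add: simplex_points_def)

section \<open>Extending a contraction of the base over the tetrahedra\<close>

locale three_cells =
  fixes K C :: "'a set set"
  assumes complex: "simplicial_complex K" and fin: "finite K" and CK: "C \<subseteq> K"
    and card4: "\<And>\<sigma>. \<sigma> \<in> C \<Longrightarrow> card \<sigma> = 4"
    and maximal: "\<And>\<sigma> \<rho>. \<sigma> \<in> C \<Longrightarrow> \<rho> \<in> K \<Longrightarrow> \<sigma> \<subseteq> \<rho> \<Longrightarrow> \<rho> = \<sigma>"
begin

lemma finC: "finite C" using finite_subset[OF CK fin] .

lemma cellD: "\<sigma> \<in> C \<Longrightarrow> finite \<sigma> \<and> \<sigma> \<noteq> {}"
  using card4 by (metis card.empty card.infinite zero_neq_numeral)

lemma complex_M: "simplicial_complex (K - C)"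
  unfolding simplicial_complex_def
proof (intro ballI conjI allI impI)
  fix \<sigma> assume s: "\<sigma> \<in> K - C"
  then show "finite \<sigma>" "\<sigma> \<noteq> {}" using simplicial_complexD[OF complex] by blast+
  fix \<rho> assume r: "\<rho> \<subseteq> \<sigma> \<and> \<rho> \<noteq> {}"
  then have "\<rho> \<in> K" using simplicial_complexD(3)[OF complex] s by blast
  moreover have "\<rho> \<notin> C" using maximal[of \<rho> \<sigma>] r s by blast
  ultimately show "\<rho> \<in> K - C" by blast
qed

text \<open>By maximality no simplex other than the cell itself contains all vertices of a cell, so
  at most one of the numbers \<open>min_coord \<sigma> \<alpha>\<close> is nonzero at a given point.
  This turns the sums over \<open>C\<close> below into single terms. The minimum is at most
  \<open>1/4\<close> because four coordinates sum to \<open>1\<close>; the barycentre attains this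
  bound.\<close>

lemma point_cases:
  assumes "\<alpha> \<in> geom K"
  obtains (base) "\<alpha> \<in> geom (K - C)" "supp \<alpha> \<notin> C" "\<And>\<sigma>. \<sigma> \<in> C \<Longrightarrow> min_coord \<sigma> \<alpha> = 0"
  | (cell) \<sigma> where "\<sigma> \<in> C" "supp \<alpha> = \<sigma>" "\<alpha> \<in> simplex_points \<sigma>" "0 < min_coord \<sigma> \<alpha>" "4 * min_coord \<sigma> \<alpha> \<le> 1"
      "\<And>\<tau>. \<tau> \<in> C \<Longrightarrow> \<tau> \<noteq> \<sigma> \<Longrightarrow> min_coord \<tau> \<alpha> = 0"
proof -
  have A: "supp \<alpha> \<in> K" "\<alpha> \<in> simplex_points (supp \<alpha>)" using assms mem_geom[OF complex] by blast+
  have nn: "\<And>v. 0 \<le> \<alpha> v" using A(2) by (rule simplex_points_nonneg)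
  have z: "min_coord \<tau> \<alpha> = 0" if "\<tau> \<in> C" "\<tau> \<noteq> supp \<alpha>" for \<tau>
    using that cellD maximal[OF that(1) A(1)] by (intro min_coord_eq_0 nn) auto
  show thesis
  proof (cases "supp \<alpha> \<in> C")
    case False
    then have "\<alpha> \<in> geom (K - C)" using A mem_geom[OF complex_M, of \<alpha>] by blast
    then show ?thesis using base False z by metis
  next
    case True
    have f: "finite (supp \<alpha>)" "supp \<alpha> \<noteq> {}" using cellD[OF True] by auto
    obtain v where v: "v \<in> supp \<alpha>" "\<alpha> v = min_coord (supp \<alpha>) \<alpha>" using min_coord_attained[OF f] by blast
    then have pos: "0 < min_coord (supp \<alpha>) \<alpha>" using nn[of v] by (auto simp: supp_def)
    have "(\<Sum>v\<in>supp \<alpha>. min_coord (supp \<alpha>) \<alpha>) \<le> (\<Sum>v\<in>supp \<alpha>. \<alpha> v)"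
      by (intro sum_mono min_coord_le f)
    then have "4 * min_coord (supp \<alpha>) \<alpha> \<le> 1" using card4[OF True] A(2) by (simp add: simplex_points_def)
    then show ?thesis using cell[OF True refl A(2) pos] z by blast
  qed
qed

text \<open>Subtracting the same number from all four coordinates and rescaling moves a point of a
  cell away from the barycentre. Points whose minimum is at most \<open>u / 8\<close> land on the
  boundary, and the inner tetrahedron is stretched over the whole cell. For \<open>u\<close> in the
  unit interval the denominator stays at least \<open>1/2\<close>. Writing sums over
  \<open>C\<close> avoids a case distinction between the cells and gives continuity at once.\<close>

definition shave :: "real \<Rightarrow> ('a \<Rightarrow> real) \<Rightarrow> 'a \<Rightarrow> real" where
  "shave u \<alpha> v = (\<alpha> v - (\<Sum>\<sigma>\<in>C. if v \<in> \<sigma> then min (min_coord \<sigma> \<alpha>) (u / 8) else 0))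
     / (1 - (\<Sum>\<sigma>\<in>C. 4 * min (min_coord \<sigma> \<alpha>) (u / 8)))"

text \<open>Normalised so that it runs from \<open>0\<close> on the base to \<open>1\<close> at the
  barycentre of a cell.\<close>

definition depth :: "('a \<Rightarrow> real) \<Rightarrow> real" where
  "depth \<alpha> = (\<Sum>\<sigma>\<in>C. 4 * min_coord \<sigma> \<alpha>)"

lemma base_simps:
  assumes "\<And>\<sigma>. \<sigma> \<in> C \<Longrightarrow> min_coord \<sigma> \<alpha> = 0" "0 \<le> u"
  shows "shave u \<alpha> = \<alpha>" "depth \<alpha> = 0" "(\<Sum>\<sigma>\<in>C. 4 * min (min_coord \<sigma> \<alpha>) (u / 8)) = 0"
proof -
  have 1: "(\<Sum>\<sigma>\<in>C. 4 * min (min_coord \<sigma> \<alpha>) (u / 8)) = (\<Sum>\<sigma>\<in>C. 0)"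
    using assms by (intro sum.cong) auto
  then show "(\<Sum>\<sigma>\<in>C. 4 * min (min_coord \<sigma> \<alpha>) (u / 8)) = 0" by simp
  have 2: "(\<Sum>\<sigma>\<in>C. if v \<in> \<sigma> then min (min_coord \<sigma> \<alpha>) (u / 8) else 0) = (\<Sum>\<sigma>\<in>C. 0)" for v
    using assms by (intro sum.cong) auto
  show "shave u \<alpha> = \<alpha>" unfolding shave_def 1 2 by simp
  have "depth \<alpha> = (\<Sum>\<sigma>\<in>C. 0)" unfolding depth_def using assms by (intro sum.cong) auto
  then show "depth \<alpha> = 0" by simp
qed

lemma cell_simps:
  assumes s: "\<sigma> \<in> C" and z: "\<And>\<tau>. \<tau> \<in> C \<Longrightarrow> \<tau> \<noteq> \<sigma> \<Longrightarrow> min_coord \<tau> \<alpha> = 0" and u: "0 \<le> u"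
  shows "\<And>v. shave u \<alpha> v = (\<alpha> v - (if v \<in> \<sigma> then min (min_coord \<sigma> \<alpha>) (u / 8) else 0))
     / (1 - 4 * min (min_coord \<sigma> \<alpha>) (u / 8))" "depth \<alpha> = 4 * min_coord \<sigma> \<alpha>"
    "(\<Sum>\<sigma>\<in>C. 4 * min (min_coord \<sigma> \<alpha>) (u / 8)) = 4 * min (min_coord \<sigma> \<alpha>) (u / 8)"
proof -
  have one: "(\<Sum>\<tau>\<in>C. f \<tau>) = f \<sigma>" if "\<And>\<tau>. \<tau> \<in> C \<Longrightarrow> \<tau> \<noteq> \<sigma> \<Longrightarrow> f \<tau> = 0" for f :: "'a set \<Rightarrow> real"
    using sum.remove[OF finC s, of f] that by (simp add: sum.neutral)
  show 1: "(\<Sum>\<sigma>\<in>C. 4 * min (min_coord \<sigma> \<alpha>) (u / 8)) = 4 * min (min_coord \<sigma> \<alpha>) (u / 8)"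
    by (rule one) (use z u in auto)
  have 2: "(\<Sum>\<tau>\<in>C. if v \<in> \<tau> then min (min_coord \<tau> \<alpha>) (u / 8) else 0)
       = (if v \<in> \<sigma> then min (min_coord \<sigma> \<alpha>) (u / 8) else 0)" for v
    by (rule one) (use z u in auto)
  show "shave u \<alpha> v = (\<alpha> v - (if v \<in> \<sigma> then min (min_coord \<sigma> \<alpha>) (u / 8) else 0))
     / (1 - 4 * min (min_coord \<sigma> \<alpha>) (u / 8))" for v by (simp only: shave_def 1 2)
  show "depth \<alpha> = 4 * min_coord \<sigma> \<alpha>" unfolding depth_def by (rule one) (use z in auto)
qed

lemma shave_in_simplex:
  assumes s: "\<sigma> \<in> C" and a: "\<alpha> \<in> simplex_points \<sigma>" and u: "0 \<le> u" "u \<le> 1"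
    and z: "\<And>\<tau>. \<tau> \<in> C \<Longrightarrow> \<tau> \<noteq> \<sigma> \<Longrightarrow> min_coord \<tau> \<alpha> = 0"
  shows "shave u \<alpha> \<in> simplex_points \<sigma>"
proof -
  have cs: "shave u \<alpha> v = (\<alpha> v - (if v \<in> \<sigma> then min (min_coord \<sigma> \<alpha>) (u / 8) else 0))
     / (1 - 4 * min (min_coord \<sigma> \<alpha>) (u / 8))" for v
    using cell_simps(1)[of \<sigma> \<alpha> u v] s z u by blast
  let ?e = "min (min_coord \<sigma> \<alpha>) (u / 8)"
  have d: "1 - 4 * ?e > 0" using u by auto
  have f: "finite \<sigma>" using cellD s by auto
  have "0 \<le> \<alpha> v - (if v \<in> \<sigma> then ?e else 0)" for v
    using min_coord_le[OF f, of v \<alpha>] simplex_points_nonneg[OF a, of v] by auto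
  then have pos: "0 \<le> shave u \<alpha> v" for v
    unfolding cs using d by (intro divide_nonneg_pos) auto
  have out: "shave u \<alpha> v = 0" if "v \<notin> \<sigma>" for v
    unfolding cs using that a by (simp add: simplex_points_def)
  have "(\<Sum>v\<in>\<sigma>. shave u \<alpha> v) = (\<Sum>v\<in>\<sigma>. \<alpha> v - ?e) / (1 - 4 * ?e)"
    unfolding cs sum_divide_distrib by (intro sum.cong) auto
  also have "(\<Sum>v\<in>\<sigma>. \<alpha> v - ?e) = 1 - 4 * ?e"
    using a card4[OF s] by (simp add: sum_subtractf simplex_points_def)
  finally have "(\<Sum>v\<in>\<sigma>. shave u \<alpha> v) = 1" using d by simp
  then show ?thesis using pos out unfolding simplex_points_def by blast
qed

text \<open>In the collar the full minimum is subtracted, so a vertex where it is attained drops out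
  of the support; by maximality a proper face of a cell is not itself a cell.\<close>

lemma shave_in_base:
  assumes s: "\<sigma> \<in> C" and a: "\<alpha> \<in> simplex_points \<sigma>" and u: "0 \<le> u" "u \<le> 1"
    and z: "\<And>\<tau>. \<tau> \<in> C \<Longrightarrow> \<tau> \<noteq> \<sigma> \<Longrightarrow> min_coord \<tau> \<alpha> = 0" and le: "4 * min_coord \<sigma> \<alpha> \<le> u / 2"
  shows "shave u \<alpha> \<in> geom (K - C)"
proof -
  have cs: "shave u \<alpha> v = (\<alpha> v - (if v \<in> \<sigma> then min (min_coord \<sigma> \<alpha>) (u / 8) else 0))
     / (1 - 4 * min (min_coord \<sigma> \<alpha>) (u / 8))" for v
    using cell_simps(1)[of \<sigma> \<alpha> u v] s z u by blast
  have f: "finite \<sigma>" "\<sigma> \<noteq> {}" using cellD s by auto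
  have m: "min (min_coord \<sigma> \<alpha>) (u / 8) = min_coord \<sigma> \<alpha>" using le by auto
  obtain v where v: "v \<in> \<sigma>" "\<alpha> v = min_coord \<sigma> \<alpha>" using min_coord_attained[OF f] by blast
  then have "shave u \<alpha> v = 0" unfolding cs m by simp
  then have v': "v \<notin> supp (shave u \<alpha>)" by (simp add: supp_def)
  note S = simplex_points_supp[OF shave_in_simplex[OF s a u z] f(1)]
  have k: "supp (shave u \<alpha>) \<in> K" using simplicial_complexD(3)[OF complex _ S(2,3)] s CK by blast
  have "supp (shave u \<alpha>) \<notin> C"
    using maximal[of "supp (shave u \<alpha>)" \<sigma>] S(2) s CK v' v(1) by blast
  then show ?thesis using k S(1) mem_geom[OF complex_M, of "shave u \<alpha>"] by blast
qed

lemma continuous_on_shave: "continuous_on ({0..1} \<times> geom K) (\<lambda>z. shave (fst z) (snd z))"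
proof (rule continuous_on_coordinatewise_then_product)
  fix v
  let ?S = "{0..1::real} \<times> geom K"
  have cm: "continuous_on ?S (\<lambda>z. min_coord \<sigma> (snd z))" if "\<sigma> \<in> C" for \<sigma>
    using cellD[OF that] by (intro continuous_on_compose2[OF continuous_on_min_coord[of \<sigma> UNIV]] continuous_intros) auto
  have cv: "continuous_on ?S (\<lambda>z. snd z v)"
    by (rule continuous_on_compose2[OF continuous_on_apply[of UNIV]]) (auto intro: continuous_intros)
  have nz: "1 - (\<Sum>\<sigma>\<in>C. 4 * min (min_coord \<sigma> (snd z)) (fst z / 8)) \<noteq> 0" if "z \<in> ?S" for z
  proof -
    from that have "snd z \<in> geom K" by auto
    then show ?thesis
    proof (cases rule: point_cases)
      case base
      then show ?thesis using base_simps(3)[of "snd z" "fst z"] that by auto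
    next
      case (cell \<sigma>)
      then show ?thesis using cell_simps(3)[OF cell(1,6), of "fst z"] that by auto
    qed
  qed
  have c1: "continuous_on ?S (\<lambda>z. if v \<in> \<sigma> then min (min_coord \<sigma> (snd z)) (fst z / 8) else 0)"
    if "\<sigma> \<in> C" for \<sigma>
    by (cases "v \<in> \<sigma>") (auto intro!: continuous_on_min cm[OF that] continuous_intros)
  have c2: "continuous_on ?S (\<lambda>z. 4 * min (min_coord \<sigma> (snd z)) (fst z / 8))"
    if "\<sigma> \<in> C" for \<sigma>
    by (intro continuous_on_mult continuous_on_const continuous_on_min cm[OF that] continuous_intros) auto
  show "continuous_on ?S (\<lambda>z. shave (fst z) (snd z) v)"
    unfolding shave_def
    by (intro continuous_on_divide continuous_on_diff cv continuous_on_const continuous_on_sum c1 c2 ballI nz)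
qed

lemma continuous_on_depth: "continuous_on ({0..1::real} \<times> geom K) (\<lambda>z. depth (snd z))"
  unfolding depth_def
proof (intro continuous_on_sum continuous_on_mult continuous_on_const)
  fix \<sigma> assume "\<sigma> \<in> C"
  then show "continuous_on ({0..1} \<times> geom K) (\<lambda>z::real \<times> _. min_coord \<sigma> (snd z))"
    using cellD by (intro continuous_on_compose2[OF continuous_on_min_coord[of \<sigma> UNIV]] continuous_intros) auto
qed

text \<open>A contraction of the base extends over the cells: a collar of each cell, of width growing
  with time, is pushed to the boundary and then moved along with the base.\<close>
lemma extend_contraction:
  assumes h: "continuous_on ({0..1} \<times> geom (K - C)) h" "h ` ({0..1} \<times> geom (K - C)) \<subseteq> geom (K - C)"
    and h0: "\<And>\<alpha>. \<alpha> \<in> geom (K - C) \<Longrightarrow> h (0::real, \<alpha>) = \<alpha>"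
  obtains H where "continuous_on ({0..1::real} \<times> geom K) H" "H ` ({0..1} \<times> geom K) \<subseteq> geom K"
    "\<And>\<alpha>. \<alpha> \<in> geom K \<Longrightarrow> H (0, \<alpha>) = \<alpha>"
    "\<And>u \<alpha>. u \<in> {0..1} \<Longrightarrow> \<alpha> \<in> geom (K - C) \<Longrightarrow> H (u, \<alpha>) = h (u, \<alpha>)"
proof
  let ?S = "{0..1::real} \<times> geom K"
  \<comment> \<open>At time \<open>u\<close> the collar consists of the points of depth
    \<open>d\<close> with \<open>d <= u / 2\<close>. A point of depth \<open>d\<close> reaches the
    boundary at time \<open>2 * d\<close> and from then on follows the base homotopy with this
    delay, hence the time \<open>u - 2 * d\<close>. On the inner edge of the collar the delayed time
    is \<open>0\<close>, where \<open>h\<close> is the identity, so the two branches agree.\<close>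
  let ?H = "\<lambda>z. if depth (snd z) - fst z / 2 \<le> 0 then h (fst z - 2 * depth (snd z), shave (fst z) (snd z))
       else shave (fst z) (snd z)"
  have MK: "geom (K - C) \<subseteq> geom K" by (auto simp: geom_def)
  have inner: "fst z - 2 * depth (snd z) \<in> {0..1} \<and> shave (fst z) (snd z) \<in> geom (K - C)"
    if z: "z \<in> ?S" and le: "depth (snd z) - fst z / 2 \<le> 0" for z
  proof -
    from z have u: "0 \<le> fst z" "fst z \<le> 1" and k: "snd z \<in> geom K" by auto
    from k show ?thesis
    proof (cases rule: point_cases)
      case base
      then show ?thesis using base_simps[of "snd z" "fst z"] u by auto
    next
      case (cell \<sigma>)
      note d = cell_simps(2)[OF cell(1,6) u(1)]
      show ?thesis using shave_in_base[OF cell(1,3) u cell(6)] d cell(4) u le by auto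
    qed
  qed
  have outer: "shave (fst z) (snd z) \<in> geom K" if z: "z \<in> ?S" for z
  proof -
    from z have u: "0 \<le> fst z" "fst z \<le> 1" and k: "snd z \<in> geom K" by auto
    from k show ?thesis
    proof (cases rule: point_cases)
      case base
      then show ?thesis using base_simps[of "snd z" "fst z"] u k by auto
    next
      case (cell \<sigma>)
      then have "shave (fst z) (snd z) \<in> simplex_points \<sigma>" using shave_in_simplex u by blast
      then show ?thesis using cell(1) CK by (auto simp: geom_def)
    qed
  qed
  show "continuous_on ?S ?H"
  proof (rule continuous_on_cases_le)
    show "continuous_on {z \<in> ?S. depth (snd z) - fst z / 2 \<le> 0}
        (\<lambda>z. h (fst z - 2 * depth (snd z), shave (fst z) (snd z)))"
    proof (rule continuous_on_compose2[OF h(1)])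
      show "continuous_on {z \<in> ?S. depth (snd z) - fst z / 2 \<le> 0}
          (\<lambda>z. (fst z - 2 * depth (snd z), shave (fst z) (snd z)))"
        by (rule continuous_on_subset[where s = ?S])
           (auto intro!: continuous_intros continuous_on_shave continuous_on_depth)
      show "(\<lambda>z. (fst z - 2 * depth (snd z), shave (fst z) (snd z))) `
          {z \<in> ?S. depth (snd z) - fst z / 2 \<le> 0} \<subseteq> {0..1} \<times> geom (K - C)"
        using inner by (auto simp: mem_Times_iff)
    qed
    show "continuous_on {z \<in> ?S. 0 \<le> depth (snd z) - fst z / 2} (\<lambda>z. shave (fst z) (snd z))"
      by (rule continuous_on_subset[OF continuous_on_shave]) auto
    show "continuous_on ?S (\<lambda>z. depth (snd z) - fst z / 2)"
      by (intro continuous_on_diff continuous_on_divide continuous_on_depth continuous_on_fst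
          continuous_on_id continuous_on_const) auto
    fix z assume z: "z \<in> ?S" and e: "depth (snd z) - fst z / 2 = 0"
    show "h (fst z - 2 * depth (snd z), shave (fst z) (snd z)) = shave (fst z) (snd z)"
    proof -
      have "fst z - 2 * depth (snd z) = 0" using e by simp
      moreover have "shave (fst z) (snd z) \<in> geom (K - C)" using inner[OF z] e by simp
      ultimately show ?thesis using h0 by metis
    qed
  qed
  show "?H ` ?S \<subseteq> geom K"
  proof (rule image_subsetI)
    fix z assume z: "z \<in> ?S"
    show "?H z \<in> geom K"
    proof (cases "depth (snd z) - fst z / 2 \<le> 0")
      case True
      then have "?H z \<in> geom (K - C)" using inner[OF z True] h(2) by (auto simp: image_subset_iff)
      then show ?thesis using MK by blast
    qed (use outer[OF z] in simp)
  qed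
  show "?H (0, \<alpha>) = \<alpha>" if "\<alpha> \<in> geom K" for \<alpha>
    using that
  proof (cases rule: point_cases)
    case base
    then show ?thesis using base_simps[of \<alpha> 0] h0 by simp
  next
    case (cell \<sigma>)
    then show ?thesis using cell_simps[OF cell(1,6), of 0] by (auto simp: fun_eq_iff)
  qed
  show "?H (u, \<alpha>) = h (u, \<alpha>)" if u: "u \<in> {0..1}" and "\<alpha> \<in> geom (K - C)" for u \<alpha>
  proof -
    have k: "\<alpha> \<in> geom K" using that MK by blast
    have "min_coord \<sigma> \<alpha> = 0" if s: "\<sigma> \<in> C" for \<sigma>
      using k
    proof (cases rule: point_cases)
      case base
      then show ?thesis using s by blast
    next
      case (cell \<tau>)
      then show ?thesis using \<open>\<alpha> \<in> geom (K - C)\<close> mem_geom[OF complex_M, of \<alpha>] by auto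
    qed
    then show ?thesis using base_simps[of \<alpha> u] u by simp
  qed
qed

end

text \<open>Inverse stereographic projection of \<open>w / t\<close>, where \<open>t\<close> is the smallest coordinate of
  \<open>\<alpha>\<close> on the tetrahedron and \<open>w\<close> collects the coordinate differences: the boundary, where
  \<open>t = 0\<close>, is sent to the pole. The square of \<open>r\<close> keeps the denominator positive.\<close>
definition cell_map :: "(nat \<Rightarrow> 'a) \<Rightarrow> ('a \<Rightarrow> real) \<Rightarrow> nat \<Rightarrow> real" where
  "cell_map v \<alpha> =
    (let t = min_coord (v ` {..<4}) \<alpha>; r = 1 - (\<Sum>i<4. \<alpha> (v i));
         D = (\<Sum>i<4. (\<alpha> (v i) - \<alpha> (v 0)) ^ 2) + t ^ 2 + r ^ 2
     in (\<lambda>k. if k = 0 then 1 - 2 * t ^ 2 / D else if k \<le> 3 then 2 * t * (\<alpha> (v k) - \<alpha> (v 0)) / D else 0))"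

lemma sum_less_4: "(\<Sum>i<4. f i) = f 0 + f 1 + f 2 + (f 3 :: real)" for f :: "nat \<Rightarrow> real"
  by (simp add: numeral_eq_Suc lessThan_Suc)

lemma lessThan_4_nonempty: "{..<4::nat} \<noteq> {}" by (simp add: lessThan_empty_iff)

definition cell_denom :: "(nat \<Rightarrow> 'a) \<Rightarrow> ('a \<Rightarrow> real) \<Rightarrow> real" where
  "cell_denom v \<alpha> = (\<Sum>i<4. (\<alpha> (v i) - \<alpha> (v 0)) ^ 2) + (min_coord (v ` {..<4}) \<alpha>) ^ 2
     + (1 - (\<Sum>i<4. \<alpha> (v i))) ^ 2"

lemma cell_map_alt:
  "cell_map v \<alpha> k = (if k = 0 then 1 - 2 * (min_coord (v ` {..<4}) \<alpha>) ^ 2 / cell_denom v \<alpha>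
     else if k \<le> 3 then 2 * min_coord (v ` {..<4}) \<alpha> * (\<alpha> (v k) - \<alpha> (v 0)) / cell_denom v \<alpha> else 0)"
  by (simp add: cell_map_def cell_denom_def Let_def)

text \<open>All summands are squares. If they all vanished, the four coordinates would agree with
  their minimum \<open>0\<close>, while the last square would force their sum to be
  \<open>1\<close>.\<close>

lemma cell_denom_pos: "0 < cell_denom v \<alpha>"
proof (rule ccontr)
  assume n: "\<not> 0 < cell_denom v \<alpha>"
  let ?t = "min_coord (v ` {..<4}) \<alpha>"
  have s: "0 \<le> (\<Sum>i<4. (\<alpha> (v i) - \<alpha> (v 0)) ^ 2)" by (intro sum_nonneg) auto
  have z: "?t ^ 2 = 0" "(1 - (\<Sum>i<4. \<alpha> (v i))) ^ 2 = 0" "(\<Sum>i<4. (\<alpha> (v i) - \<alpha> (v 0)) ^ 2) = 0"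
    using n s zero_le_power2[of ?t] zero_le_power2[of "1 - (\<Sum>i<4. \<alpha> (v i))"]
    unfolding cell_denom_def by linarith+
  have eq0: "\<forall>i\<in>{..<4}. (\<alpha> (v i) - \<alpha> (v 0)) ^ 2 = 0"
    by (rule iffD1[OF sum_nonneg_eq_0_iff z(3)]) simp_all
  have eq: "\<alpha> (v i) = \<alpha> (v 0)" if "i < 4" for i
    using bspec[OF eq0, of i] that by simp
  have "\<exists>w\<in>v ` {..<4}. \<alpha> w = ?t" by (rule min_coord_attained) (simp_all add: lessThan_4_nonempty)
  then obtain k where "k < 4" "\<alpha> (v k) = ?t" by (metis imageE lessThan_iff)
  then have "\<alpha> (v 0) = 0" using eq[of k] z(1) by (simp only: power_eq_0_iff)
  then have "(\<Sum>i<4. \<alpha> (v i)) = 0" using eq by (metis (no_types, lifting) lessThan_iff sum.neutral)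
  then show False using z(2) by simp
qed

lemma continuous_on_cell_map: "continuous_on S (cell_map v)"
proof (rule continuous_on_coordinatewise_then_product)
  fix k
  have t: "continuous_on S (min_coord (v ` {..<4}))" by (rule continuous_on_min_coord) (simp_all add: lessThan_4_nonempty)
  have D: "continuous_on S (cell_denom v)" unfolding cell_denom_def[abs_def]
    by (intro continuous_on_add continuous_on_sum continuous_on_power continuous_on_diff
        continuous_on_apply continuous_on_const t)
  have nz: "\<forall>\<alpha>\<in>S. cell_denom v \<alpha> \<noteq> 0" using cell_denom_pos by (metis less_irrefl)
  show "continuous_on S (\<lambda>\<alpha>. cell_map v \<alpha> k)"
    unfolding cell_map_alt
    by (cases "k = 0"; cases "k \<le> 3"; simp; intro continuous_on_diff continuous_on_divide
        continuous_on_mult continuous_on_power continuous_on_const continuous_on_apply t D nz)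
qed

lemma cell_map_pole_iff: "cell_map v \<alpha> = pole \<longleftrightarrow> min_coord (v ` {..<4}) \<alpha> = 0"
proof
  assume "cell_map v \<alpha> = pole"
  then have "cell_map v \<alpha> 0 = 1" by (simp add: pole_def)
  then show "min_coord (v ` {..<4}) \<alpha> = 0" using cell_denom_pos[of v \<alpha>] by (simp add: cell_map_alt)
next
  assume "min_coord (v ` {..<4}) \<alpha> = 0"
  then show "cell_map v \<alpha> = pole" by (auto simp: cell_map_alt pole_def)
qed

text \<open>The two alternatives cover the points off the open cell, which go to the pole, and the
  points of the closed cell, where the auxiliary square in the denominator is zero and the usual
  identity for stereographic projection holds.\<close>

lemma cell_map_in_sphere:
  assumes "min_coord (v ` {..<4}) \<alpha> = 0 \<or> (\<Sum>i<4. \<alpha> (v i)) = 1"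
  shows "cell_map v \<alpha> \<in> three_sphere"
proof (cases "min_coord (v ` {..<4}) \<alpha> = 0")
  case True
  then show ?thesis using cell_map_pole_iff[of v \<alpha>] pole_in_three_sphere by simp
next
  case False
  define t where "t = min_coord (v ` {..<4}) \<alpha>"
  define D where "D = cell_denom v \<alpha>"
  define w where "w i = \<alpha> (v i) - \<alpha> (v 0)" for i
  have D0: "D > 0" unfolding D_def by (rule cell_denom_pos)
  have "D = w 1 ^ 2 + w 2 ^ 2 + w 3 ^ 2 + t ^ 2"
    using False assms unfolding D_def cell_denom_def w_def t_def by (simp add: sum_less_4)
  then have W: "w 1 ^ 2 + w 2 ^ 2 + w 3 ^ 2 = D - t ^ 2" by simp
  have "(\<Sum>i\<le>3. cell_map v \<alpha> i ^ 2) = (1 - 2 * t^2 / D)^2 + (2 * t * w 1 / D)^2 + (2 * t * w 2 / D)^2 + (2 * t * w 3 / D)^2"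
    unfolding sum_le_3 cell_map_alt t_def D_def w_def by simp
  also have "\<dots> = (1 - 2 * t^2 / D)^2 + 4 * t^2 * (w 1 ^ 2 + w 2 ^ 2 + w 3 ^ 2) / D^2"
    by (simp add: power_divide power_mult_distrib algebra_simps add_divide_distrib)
  also have "\<dots> = 1" unfolding W using D0 by (simp add: field_simps power2_eq_square)
  finally show ?thesis unfolding three_sphere_def by (simp add: cell_map_alt)
qed

text \<open>Coordinate \<open>0\<close> determines \<open>t ^ 2 / D\<close>, and the other
  coordinates then determine the differences divided by \<open>t\<close>. Hence \<alpha> divided by
  its minimum and \<beta> divided by its minimum differ by a constant \<open>c\<close> on the four
  vertices. Both have minimum \<open>1\<close>, so \<open>c = 0\<close>, and the coordinate sums
  give equality of the minima.\<close>

lemma cell_map_inj: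
  assumes a: "\<alpha> \<in> simplex_points (v ` {..<4})" and b: "\<beta> \<in> simplex_points (v ` {..<4})"
    and i: "inj_on v {..<4}"
    and ta: "0 < min_coord (v ` {..<4}) \<alpha>" and tb: "0 < min_coord (v ` {..<4}) \<beta>"
    and eq: "cell_map v \<alpha> = cell_map v \<beta>"
  shows "\<alpha> = \<beta>"
proof -
  let ?S = "v ` {..<4::nat}"
  define t where "t = min_coord ?S \<alpha>"
  define t' where "t' = min_coord ?S \<beta>"
  define D where "D = cell_denom v \<alpha>"
  define D' where "D' = cell_denom v \<beta>"
  have pos: "t > 0" "t' > 0" "D > 0" "D' > 0"
    using ta tb cell_denom_pos unfolding t_def t'_def D_def D'_def by blast+
  have e: "cell_map v \<alpha> k = cell_map v \<beta> k" for k using eq by simp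
  have e0: "t ^ 2 / D = t' ^ 2 / D'" using e[of 0] unfolding cell_map_alt t_def t'_def D_def D'_def by simp
  have diff: "(\<alpha> (v k) - \<alpha> (v 0)) / t = (\<beta> (v k) - \<beta> (v 0)) / t'" if "k < 4" for k
  proof (cases "k = 0")
    case False
    then have "2 * t * (\<alpha> (v k) - \<alpha> (v 0)) / D = 2 * t' * (\<beta> (v k) - \<beta> (v 0)) / D'"
      using e[of k] that unfolding cell_map_alt t_def t'_def D_def D'_def by simp
    then have "(t ^ 2 / D) * ((\<alpha> (v k) - \<alpha> (v 0)) / t) = (t' ^ 2 / D') * ((\<beta> (v k) - \<beta> (v 0)) / t')"
      using pos by (simp add: power2_eq_square)
    then have "(t' ^ 2 / D') * ((\<alpha> (v k) - \<alpha> (v 0)) / t) = (t' ^ 2 / D') * ((\<beta> (v k) - \<beta> (v 0)) / t')"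
      unfolding e0 .
    moreover have "t' ^ 2 / D' \<noteq> 0" using pos by simp
    ultimately show ?thesis by (metis mult_left_cancel)
  qed simp
  define c where "c = \<alpha> (v 0) / t - \<beta> (v 0) / t'"
  have shift: "\<alpha> x / t = \<beta> x / t' + c" if "x \<in> ?S" for x
  proof -
    obtain k where k: "x = v k" "k < 4" using \<open>x \<in> ?S\<close> by auto
    show ?thesis using diff[OF k(2)] k unfolding c_def diff_divide_distrib by simp
  qed
  have fS: "finite ?S" "?S \<noteq> {}" by (simp_all add: lessThan_4_nonempty)
  obtain x where x: "x \<in> ?S" "\<alpha> x = t" using min_coord_attained[OF fS] unfolding t_def by blast
  obtain y where y: "y \<in> ?S" "\<beta> y = t'" using min_coord_attained[OF fS] unfolding t'_def by blast
  have "t' \<le> \<beta> x" "t \<le> \<alpha> y" unfolding t_def t'_def using x y fS by (auto intro!: min_coord_le)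
  then have le: "1 \<le> \<beta> x / t'" "1 \<le> \<alpha> y / t" using pos by auto
  have "1 = \<beta> x / t' + c" "\<alpha> y / t = 1 + c" using shift[OF x(1)] shift[OF y(1)] x y pos by simp_all
  then have c0: "c = 0" using le by linarith
  have "(\<Sum>x\<in>?S. \<alpha> x / t) = (\<Sum>x\<in>?S. \<beta> x / t')" using shift c0 by (intro sum.cong) auto
  then have "1 / t = 1 / t'" using a b by (simp add: simplex_points_def flip: sum_divide_distrib)
  then have "t = t'" by simp
  then have "\<alpha> x = \<beta> x" for x
    using shift[of x] c0 pos a b by (cases "x \<in> ?S") (auto simp: simplex_points_def)
  then show ?thesis by blast
qed

lemma cell_map_surj:
  assumes i: "inj_on v {..<4}" and x: "x \<in> three_sphere" "x \<noteq> pole"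
  shows "\<exists>\<alpha>. \<alpha> \<in> simplex_points (v ` {..<4}) \<and> 0 < min_coord (v ` {..<4}) \<alpha> \<and> cell_map v \<alpha> = x"
proof -
  let ?S = "v ` {..<4::nat}"
  have sx: "x 0 ^ 2 + x 1 ^ 2 + x 2 ^ 2 + x 3 ^ 2 = 1" and xz: "\<And>k. k > 3 \<Longrightarrow> x k = 0"
    using x(1) by (auto simp: three_sphere_def sum_le_3)
  have x0: "x 0 < 1"
  proof (rule ccontr)
    assume "\<not> x 0 < 1"
    then have "1 \<le> x 0 ^ 2" by simp
    then have "x 1 ^ 2 + x 2 ^ 2 + x 3 ^ 2 \<le> 0" using sx by linarith
    then have z: "x 1 ^ 2 = 0" "x 2 ^ 2 = 0" "x 3 ^ 2 = 0"
      using zero_le_power2[of "x 1"] zero_le_power2[of "x 2"] zero_le_power2[of "x 3"] by linarith+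
    then have "x 0 ^ 2 = 1" using sx by linarith
    then have "x 0 = 1" using \<open>\<not> x 0 < 1\<close> by (simp add: power2_eq_1_iff)
    moreover have "x k = 0" if "k > 0" for k
    proof -
      have "k = 1 \<or> k = 2 \<or> k = 3 \<or> k > 3" using that by linarith
      then show ?thesis using z xz by auto
    qed
    ultimately have "x = pole" by (auto simp: pole_def)
    then show False using x(2) by simp
  qed
  \<comment> \<open>\<open>y\<close> is the stereographic projection of \<open>x\<close> from the
    pole. Any preimage must, after division by its minimum, have these differences of coordinates
    and minimum \<open>1\<close>; this gives \<open>y k - \<mu> + 1\<close>, and dividing by
    \<open>B\<close> makes the sum \<open>1\<close> and the minimum \<open>1 / B\<close>.\<close>
  define y where "y k = (if k = 0 then 0 else x k / (1 - x 0))" for k :: nat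
  define \<mu> where "\<mu> = Min (y ` {..<4})"
  define B where "B = (\<Sum>k<4. y k - \<mu> + 1)"
  have ge: "y k - \<mu> + 1 \<ge> 1" if "k < 4" for k unfolding \<mu>_def using that by simp
  have "B \<ge> (\<Sum>k<(4::nat). 1)" unfolding B_def using ge by (intro sum_mono) auto
  then have B: "B > 0" by simp
  define \<alpha> where "\<alpha> a = (if a \<in> ?S then (y (inv_into {..<4} v a) - \<mu> + 1) / B else 0)" for a
  have av: "\<alpha> (v k) = (y k - \<mu> + 1) / B" if "k < 4" for k
    using that i by (auto simp: \<alpha>_def inv_into_f_f)
  have "(\<Sum>a\<in>?S. \<alpha> a) = (\<Sum>k<4. \<alpha> (v k))" by (simp add: sum.reindex[OF i])
  also have "\<dots> = (\<Sum>k<4. (y k - \<mu> + 1) / B)" by (intro sum.cong) (auto simp: av)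
  also have "\<dots> = 1" using B by (simp add: B_def flip: sum_divide_distrib)
  finally have s1: "(\<Sum>a\<in>?S. \<alpha> a) = 1" .
  have "0 \<le> \<alpha> a" for a
  proof (cases "a \<in> ?S")
    case True
    then obtain k where "k < 4" "a = v k" by auto
    then show ?thesis using av[of k] ge[of k] B by simp
  qed (simp add: \<alpha>_def)
  then have a: "\<alpha> \<in> simplex_points ?S" using s1 by (simp add: simplex_points_def \<alpha>_def)
  have "\<mu> \<in> y ` {..<4}" unfolding \<mu>_def by (intro Min_in) (simp_all add: lessThan_4_nonempty)
  then obtain k0 where k0: "k0 < 4" "y k0 = \<mu>" by auto
  have t: "min_coord ?S \<alpha> = 1 / B" unfolding min_coord_def
  proof (rule Min_eqI)
    show "1 / B \<in> \<alpha> ` ?S" using av[OF k0(1)] k0 by (intro image_eqI[of _ _ "v k0"]) auto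
    fix z assume "z \<in> \<alpha> ` ?S"
    then obtain k where "k < 4" "z = \<alpha> (v k)" by auto
    then show "1 / B \<le> z" using av[of k] ge[of k] B by (simp add: divide_right_mono)
  qed simp
  have w: "\<alpha> (v k) - \<alpha> (v 0) = y k / B" if "k < 4" for k
    using av[OF that] av[of 0] by (simp add: y_def flip: diff_divide_distrib)
  have r: "(\<Sum>k<4. \<alpha> (v k)) = 1" using s1 by (simp add: sum.reindex[OF i])
  have yy: "y 1 ^ 2 + y 2 ^ 2 + y 3 ^ 2 + 1 = 2 / (1 - x 0)"
  proof -
    have "y 1 ^ 2 + y 2 ^ 2 + y 3 ^ 2 = (x 1 ^ 2 + x 2 ^ 2 + x 3 ^ 2) / (1 - x 0) ^ 2"
      by (simp add: y_def power_divide add_divide_distrib)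
    also have "x 1 ^ 2 + x 2 ^ 2 + x 3 ^ 2 = (1 - x 0) * (1 + x 0)" using sx by (simp add: power2_eq_square algebra_simps)
    also have "(1 - x 0) * (1 + x 0) / (1 - x 0) ^ 2 = (1 + x 0) / (1 - x 0)"
      using x0 by (simp add: power2_eq_square)
    finally have "y 1 ^ 2 + y 2 ^ 2 + y 3 ^ 2 = (1 + x 0) / (1 - x 0)" .
    moreover have "(1 + x 0) / (1 - x 0) + 1 = 2 / (1 - x 0)" using x0 by (simp add: field_simps)
    ultimately show ?thesis by (simp only:)
  qed
  have D: "cell_denom v \<alpha> = 2 / (1 - x 0) / B ^ 2"
  proof -
    have "cell_denom v \<alpha> = (y 1 ^ 2 + y 2 ^ 2 + y 3 ^ 2 + 1) / B ^ 2"
      unfolding cell_denom_def r t sum_less_4 using w[of 0] w[of 1] w[of 2] w[of 3]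
      by (simp add: power_divide add_divide_distrib)
    then show ?thesis unfolding yy .
  qed
  have "cell_map v \<alpha> k = x k" for k
  proof -
    consider "k = 0" | "k > 0" "k \<le> 3" | "k > 3" by linarith
    then show ?thesis
    proof cases
      case 1
      then show ?thesis using B x0 by (simp add: cell_map_alt t D power_divide field_simps)
    next
      case 2
      then have "k < 4" "y k = x k / (1 - x 0)" by (auto simp: y_def)
      then show ?thesis using 2 B x0 w[of k] by (simp add: cell_map_alt t D power2_eq_square)
    qed (simp add: cell_map_alt xz)
  qed
  then have "cell_map v \<alpha> = x" by blast
  moreover have "0 < min_coord ?S \<alpha>" using t B by simp
  ultimately show ?thesis using a by blast
qed

section \<open>The quotient by the base\<close>

context three_cells
begin

text \<open>The quotient by the base is realised by an explicit map \<open>q\<close> onto the axes,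
  injective off the base. The contraction of the base, extended over the cells, is the deformation
  that \<open>collapse_contractible_homotopy_equivalent\<close> asks for; it need not keep its end
  point \<open>a\<close> fixed.\<close>

theorem attach_cells_homotopy_eqv:
  assumes contr: "hequiv (K - C) {{p}}"
  shows "geom K homotopy_eqv sphere_axes (card C)"
proof -
  let ?M = "geom (K - C)" and ?N = "card C"
  have MK: "?M \<subseteq> geom K" by (auto simp: geom_def)
  have sing: "geom {{p}} = {\<lambda>v. if v = p then 1 else 0}"
    by (auto simp: geom_def simplex_points_def fun_eq_iff)
  have contr': "top_of_set ?M homotopy_equivalent_space top_of_set (geom {{p}})"
    using contr by (simp add: hequiv_def)
  have "contractible_space (top_of_set ?M)"
    using homotopy_equivalent_space_contractibility[OF contr'] unfolding sing by simp
  then obtain a h where hc: "continuous_map (prod_topology (top_of_set {0..1::real}) (top_of_set ?M)) (top_of_set ?M) h"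
      and h0: "\<And>x. h (0, x) = x" and h1: "\<And>x. h (1, x) = a"
    unfolding contractible_space_def homotopic_with_def id_def by blast
  have hh: "continuous_on ({0..1} \<times> ?M) h" "h ` ({0..1} \<times> ?M) \<subseteq> ?M"
    using hc by (auto simp: image_subset_iff Pi_iff)
  \<comment> \<open>The equivalence with a one-point complex shows that the base is nonempty;
    contractibility alone does not exclude the empty space.\<close>
  obtain f where "continuous_map (top_of_set (geom {{p}})) (top_of_set ?M) f"
    using contr' unfolding homotopy_equivalent_space_def by blast
  then have "f (\<lambda>v. if v = p then 1 else 0) \<in> ?M" unfolding sing by simp
  then obtain b where b: "b \<in> ?M" by blast
  obtain H where H: "continuous_on ({0..1::real} \<times> geom K) H" "H ` ({0..1} \<times> geom K) \<subseteq> geom K"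
    "\<And>\<alpha>. \<alpha> \<in> geom K \<Longrightarrow> H (0, \<alpha>) = \<alpha>"
    "\<And>u \<alpha>. u \<in> {0..1} \<Longrightarrow> \<alpha> \<in> ?M \<Longrightarrow> H (u, \<alpha>) = h (u, \<alpha>)"
    using extend_contraction[OF hh] h0 by metis
  obtain e where e: "bij_betw e {..<?N} C"
    using ex_bij_betw_nat_finite[OF finC] by (auto simp: atLeast0LessThan)
  have "\<exists>w. bij_betw w {..<4::nat} \<sigma>" if "\<sigma> \<in> C" for \<sigma>
    using ex_bij_betw_nat_finite[of \<sigma>] cellD[OF that] card4[OF that] by (auto simp: atLeast0LessThan)
  then obtain w where w: "\<And>\<sigma>. \<sigma> \<in> C \<Longrightarrow> bij_betw (w \<sigma>) {..<4::nat} \<sigma>" by metis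
  have wS: "w \<sigma> ` {..<4} = \<sigma>" "inj_on (w \<sigma>) {..<4}" if "\<sigma> \<in> C" for \<sigma>
    using w[OF that] by (auto simp: bij_betw_def)
  have eC: "e i \<in> C" if "i < ?N" for i using e that by (auto simp: bij_betw_def)
  have ei: "i = j" if "i < ?N" "j < ?N" "e i = e j" for i j
    using e that by (auto simp: bij_betw_def inj_on_def)
  \<comment> \<open>Each coordinate applies its cell map to every point of the complex. Off the cell
    in question the smallest coordinate is \<open>0\<close> and the value is the pole, so no case
    distinction between cells threatens continuity.\<close>
  define q where "q \<alpha> i = (if i < ?N then cell_map (w (e i)) \<alpha> else pole)" for \<alpha> i
  have cont: "continuous_on (geom K) q"
  proof (rule continuous_on_coordinatewise_then_product)
    show "continuous_on (geom K) (\<lambda>\<alpha>. q \<alpha> i)" for i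
      unfolding q_def by (cases "i < ?N") (simp_all add: continuous_on_cell_map)
  qed
  have q_iff: "q \<alpha> i = pole \<longleftrightarrow> \<not> i < ?N \<or> min_coord (e i) \<alpha> = 0" for \<alpha> i
    using cell_map_pole_iff[of "w (e i)" \<alpha>] wS[OF eC] by (auto simp: q_def)
  have qM: "q \<alpha> = (\<lambda>_. pole)" if "\<alpha> \<in> ?M" for \<alpha>
  proof
    fix i
    have "\<alpha> \<in> geom K" using that MK by blast
    then show "q \<alpha> i = pole"
    proof (cases rule: point_cases)
      case base
      then show ?thesis using q_iff eC by blast
    next
      case (cell \<sigma>)
      then show ?thesis using that mem_geom[OF complex_M, of \<alpha>] by auto
    qed
  qed
  have sphere: "q \<alpha> \<in> sphere_axes ?N" if "\<alpha> \<in> geom K" for \<alpha>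
    using that
  proof (cases rule: point_cases)
    case base
    then show ?thesis using qM[of \<alpha>] by (simp add: sphere_axes_def pole_in_three_sphere)
  next
    case (cell \<sigma>)
    have "q \<alpha> i \<in> three_sphere" for i
    proof (cases "i < ?N \<and> e i = \<sigma>")
      case True
      then have "(\<Sum>k<4. \<alpha> (w (e i) k)) = 1"
        using cell(3) wS[of \<sigma>] sum.reindex[of "w \<sigma>" "{..<4}" \<alpha>] cell(1) by (simp add: simplex_points_def)
      then show ?thesis using True by (simp add: q_def cell_map_in_sphere)
    next
      case False
      then have "q \<alpha> i = pole" using q_iff cell(6) eC by metis
      then show ?thesis by (simp add: pole_in_three_sphere)
    qed
    moreover have "q \<alpha> i = pole \<or> q \<alpha> j = pole" if "i \<noteq> j" for i j
      using q_iff cell(6) eC ei that by metis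
    ultimately show ?thesis unfolding sphere_axes_def by (auto simp: q_def)
  qed
  show ?thesis
  proof (rule collapse_contractible_homotopy_equivalent[where q = q and M = ?M and H = H and p = a])
    show "compact_space (top_of_set (geom K))"
      using compact_geom[OF fin] simplicial_complexD(1)[OF complex] by (simp add: compact_space_subtopology)
    show "Hausdorff_space (top_of_set (sphere_axes ?N))" by (rule Hausdorff_sphere_axes)
    show "continuous_map (top_of_set (geom K)) (top_of_set (sphere_axes ?N)) q"
      using cont sphere by auto
    show "?M \<subseteq> topspace (top_of_set (geom K))" using MK by simp
    show "?M \<noteq> {}" using b by blast
    show "q x = q y" if "x \<in> ?M" "y \<in> ?M" for x y using qM that by simp
    show "continuous_map (prod_topology (top_of_set {0..1}) (top_of_set (geom K))) (top_of_set (geom K)) H"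
      using H(1,2) by (auto simp: image_subset_iff Pi_iff)
    show "H (0, x) = x" if "x \<in> topspace (top_of_set (geom K))" for x using H(3) that by simp
    show "H (t, x) \<in> ?M" if "t \<in> {0..1}" "x \<in> ?M" for t x
      using H(4)[OF that] hh(2) that by auto
    show "H (1, x) = a" if "x \<in> ?M" for x using H(4)[of 1 x] h1 that by simp
    show "x \<in> ?M \<and> y \<in> ?M" if xy: "x \<in> topspace (top_of_set (geom K))" "y \<in> topspace (top_of_set (geom K))"
      "q x = q y" "x \<noteq> y" for x y
    proof -
      have k: "x \<in> geom K" "y \<in> geom K" using xy by auto
      have eqi: "q x i = q y i" for i using xy(3) by simp
      have cellx: False if z: "\<alpha> \<in> geom K" "\<beta> \<in> geom K" "q \<alpha> = q \<beta>" "\<alpha> \<noteq> \<beta>" and s: "\<sigma> \<in> C" "\<alpha> \<in> simplex_points \<sigma>" 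
        "0 < min_coord \<sigma> \<alpha>" for \<alpha> \<beta> \<sigma>
      proof -
        have "\<sigma> \<in> e ` {..<?N}" using e s(1) unfolding bij_betw_def by blast
        then obtain i where i: "i < ?N" "e i = \<sigma>" by blast
        have "q \<alpha> i \<noteq> pole" using q_iff i s(3) by auto
        then have "q \<beta> i \<noteq> pole" using z(3) by simp
        then have m: "min_coord \<sigma> \<beta> \<noteq> 0" using q_iff i by auto
        from z(2) show False
        proof (cases rule: point_cases)
          case base
          then show ?thesis using m s(1) by blast
        next
          case (cell \<tau>)
          then have "\<tau> = \<sigma>" using m s(1) by blast
          have "cell_map (w \<sigma>) \<alpha> = cell_map (w \<sigma>) \<beta>" using fun_cong[OF z(3), of i] i by (simp add: q_def)
          then have "\<alpha> = \<beta>" using cell_map_inj[of \<alpha> "w \<sigma>" \<beta>] wS[OF s(1)] s cell \<open>\<tau> = \<sigma>\<close> by simp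
          then show ?thesis using z(4) by simp
        qed
      qed
      have "\<alpha> \<in> ?M" if z: "\<alpha> \<in> geom K" "\<beta> \<in> geom K" "q \<alpha> = q \<beta>" "\<alpha> \<noteq> \<beta>" for \<alpha> \<beta>
        using z(1)
      proof (cases rule: point_cases)
        case (cell \<sigma>)
        then show ?thesis using cellx[OF z] by blast
      qed
      then show ?thesis using k xy(3,4) by metis
    qed
    show "q ` topspace (top_of_set (geom K)) = topspace (top_of_set (sphere_axes ?N))"
    proof
      show "q ` topspace (top_of_set (geom K)) \<subseteq> topspace (top_of_set (sphere_axes ?N))" using sphere by auto
      show "topspace (top_of_set (sphere_axes ?N)) \<subseteq> q ` topspace (top_of_set (geom K))"
      proof
        fix F assume "F \<in> topspace (top_of_set (sphere_axes ?N))"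
        then have F: "\<And>i. F i \<in> three_sphere" "\<And>i. i \<ge> ?N \<Longrightarrow> F i = pole"
          "\<And>i j. i \<noteq> j \<Longrightarrow> F i = pole \<or> F j = pole" by (auto simp: sphere_axes_def)
        show "F \<in> q ` topspace (top_of_set (geom K))"
        proof (cases "\<forall>i. F i = pole")
          case True
          then have "F = q b" using qM[OF b] by auto
          then show ?thesis using b MK by auto
        next
          case False
          then obtain i where i: "F i \<noteq> pole" by auto
          then have iN: "i < ?N" using F(2) not_le by blast
          note s = eC[OF iN]
          obtain \<alpha> where \<alpha>: "\<alpha> \<in> simplex_points (e i)" "0 < min_coord (e i) \<alpha>" "cell_map (w (e i)) \<alpha> = F i"
            using cell_map_surj[OF wS(2)[OF s] F(1) i] wS(1)[OF s] by auto
          have k: "\<alpha> \<in> geom K" using \<alpha>(1) s CK by (auto simp: geom_def)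
          have qi: "q \<alpha> i = F i" using \<alpha>(3) iN by (simp add: q_def)
          have "q \<alpha> j = F j" if "j \<noteq> i" for j
          proof -
            have "q \<alpha> i = pole \<or> q \<alpha> j = pole"
              using sphere[OF k] that unfolding sphere_axes_def by blast
            then show ?thesis using F(3)[OF that] i qi by auto
          qed
          then have "q \<alpha> = F" using qi by (metis ext)
          then show ?thesis using k by auto
        qed
      qed
    qed
  qed
qed

end

section \<open>Wedge sums and pointed homotopy equivalences\<close>

lemma continuous_map_case_le:
  assumes p: "continuous_map X euclideanreal p"
    and f: "continuous_map (subtopology X {x \<in> topspace X. p x \<le> 0}) Y f"
    and g: "continuous_map (subtopology X {x \<in> topspace X. 0 \<le> p x}) Y g"
    and fg: "\<And>x. x \<in> topspace X \<Longrightarrow> p x = 0 \<Longrightarrow> f x = g x"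
  shows "continuous_map X Y (\<lambda>x. if p x \<le> (0::real) then f x else g x)"
  by (rule continuous_map_cases_le[OF p _ f g]) (auto intro: fg)

text \<open>A function \<open>u\<close> and a deformation \<open>s\<close> as for a neighbourhood deformation retract, except
  that \<open>u\<close> decreases away from the base point, where it is \<open>1\<close>, and may become negative.\<close>
definition nondegenerate :: "'a topology \<Rightarrow> 'a \<Rightarrow> ('a \<Rightarrow> real) \<Rightarrow> (real \<times> 'a \<Rightarrow> 'a) \<Rightarrow> bool" where
  "nondegenerate X x u s \<longleftrightarrow> x \<in> topspace X \<and> continuous_map X euclideanreal u \<and>
     continuous_map (prod_topology (top_of_set {0..1::real}) X) X s \<and>
     (\<forall>y\<in>topspace X. u y \<le> 1) \<and> u x = 1 \<and> (\<forall>y\<in>topspace X. s (0, y) = y) \<and>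
     (\<forall>t\<in>{0..1}. s (t, x) = x) \<and> (\<forall>y\<in>topspace X. 0 \<le> u y \<longrightarrow> s (1, y) = x)"

abbreviation unit_interval :: "real topology" where "unit_interval \<equiv> top_of_set {0..1}"

lemma nondegenerateD:
  assumes "nondegenerate X x u s"
  shows "x \<in> topspace X" "continuous_map X euclideanreal u"
    "continuous_map (prod_topology unit_interval X) X s"
    "\<And>y. y \<in> topspace X \<Longrightarrow> u y \<le> 1" "u x = 1" "\<And>y. y \<in> topspace X \<Longrightarrow> s (0, y) = y"
    "\<And>t. t \<in> {0..1} \<Longrightarrow> s (t, x) = x" "\<And>y. y \<in> topspace X \<Longrightarrow> 0 \<le> u y \<Longrightarrow> s (1, y) = x"
  using assms unfolding nondegenerate_def by blast+

lemma nondegenerate_s: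
  assumes "nondegenerate X x u s" "t \<in> {0..1}"
  shows "continuous_map X X (\<lambda>y. s (t, y))"
  using continuous_map_o_Pair[OF nondegenerateD(3)[OF assms(1)], of t] assms(2) by (simp add: o_def)

lemma continuous_map_snd_comp:
  "continuous_map X Y f \<Longrightarrow> continuous_map (prod_topology A X) Y (\<lambda>z. f (snd z))"
  using continuous_map_compose[OF continuous_map_snd] by (simp add: o_def)

lemma continuous_map_fst_comp:
  "continuous_map A Y f \<Longrightarrow> continuous_map (prod_topology A X) Y (\<lambda>z. f (fst z))"
  using continuous_map_compose[OF continuous_map_fst] by (simp add: o_def)

lemma continuous_map_comp2:
  "continuous_map X Y f \<Longrightarrow> continuous_map Y Z g \<Longrightarrow> continuous_map X Z (\<lambda>x. g (f x))"
  using continuous_map_compose by (simp add: continuous_map_compose[unfolded o_def])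

lemma continuous_map_pair_comp:
  assumes "continuous_map X A f" "continuous_map X B g" "continuous_map (prod_topology A B) Y h"
  shows "continuous_map X Y (\<lambda>x. h (f x, g x))"
  by (rule continuous_map_comp2[OF continuous_map_pairedI[OF assms(1,2)] assms(3)])

lemma continuous_map_fst_real: "continuous_map (prod_topology unit_interval X) euclideanreal fst"
  by (rule continuous_map_into_fulltopology[OF continuous_map_fst])

text \<open>Homotopies whose track at the base point \<open>x\<close> runs along the path \<open>\<gamma>\<close> are encoded as homotopies
  of maps into \<open>Y \<times> [0,1]\<close> whose second component is the current position on \<open>\<gamma>\<close>.\<close>
definition tracked :: "'a topology \<Rightarrow> 'a \<Rightarrow> (real \<Rightarrow> 'b) \<Rightarrow> ('a \<Rightarrow> 'b \<times> real) \<Rightarrow> bool" where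
  "tracked X x \<gamma> h \<longleftrightarrow> (\<exists>c. (\<forall>z\<in>topspace X. snd (h z) = c) \<and> fst (h x) = \<gamma> c)"

lemma tracked_cong:
  assumes "x \<in> topspace X" "\<And>z. z \<in> topspace X \<Longrightarrow> h z = k z"
  shows "tracked X x \<gamma> h \<longleftrightarrow> tracked X x \<gamma> k"
  using assms by (simp add: tracked_def)

lemma pointed_homotopicI:
  assumes x: "x \<in> topspace X"
    and "continuous_map (prod_topology unit_interval X) Y h"
    and "\<And>z. z \<in> topspace X \<Longrightarrow> h (0, z) = f z" "\<And>z. z \<in> topspace X \<Longrightarrow> h (1, z) = g z"
    and "\<And>t. t \<in> {0..1} \<Longrightarrow> h (t, x) = y"
  shows "homotopic_with (\<lambda>k. k x = y) X Y f g"
  using assms by (subst homotopic_with) auto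

lemma homotopicI:
  assumes "continuous_map (prod_topology unit_interval X) Y h"
    and "\<And>z. z \<in> topspace X \<Longrightarrow> h (0, z) = f z" "\<And>z. z \<in> topspace X \<Longrightarrow> h (1, z) = g z"
  shows "homotopic_with (\<lambda>k. True) X Y f g"
  using assms by (subst homotopic_with) auto

lemma tracked_homotopicI:
  assumes x: "x \<in> topspace X"
    and "continuous_map (prod_topology unit_interval X) (prod_topology Y unit_interval) h"
    and "\<And>z. z \<in> topspace X \<Longrightarrow> h (0, z) = f z" "\<And>z. z \<in> topspace X \<Longrightarrow> h (1, z) = g z"
    and "\<And>t. t \<in> {0..1} \<Longrightarrow> tracked X x \<gamma> (\<lambda>z. h (t, z))"
  shows "homotopic_with (tracked X x \<gamma>) X (prod_topology Y unit_interval) f g"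
proof (subst homotopic_with)
  show "tracked X x \<gamma> h \<longleftrightarrow> tracked X x \<gamma> k" if "\<And>z. z \<in> topspace X \<Longrightarrow> h z = k z" for h k
    using tracked_cong[OF x that] .
qed (use assms(2-5) in blast)

text \<open>During the homotopy the base point runs along \<open>\<gamma> \<circ> c\<close>, where
  \<open>c\<close> is a path in the unit interval from \<open>1\<close> to \<open>1\<close>. Such a
  \<open>c\<close> can be pushed up to the constant \<open>1\<close>, and the neighbourhood of the
  base point where \<open>u\<close> is nonnegative gives the room for doing so.\<close>

lemma tracked_imp_pointed:
  assumes nd: "nondegenerate X x u s" and \<gamma>: "continuous_map unit_interval Y \<gamma>"
    and hom: "homotopic_with (tracked X x \<gamma>) X (prod_topology Y unit_interval) (\<lambda>z. (a z, 1)) (\<lambda>z. (b z, 1))"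
    and ca: "continuous_map X Y a" and cb: "continuous_map X Y b" and ax: "a x = \<gamma> 1" and bx: "b x = \<gamma> 1"
  shows "homotopic_with (\<lambda>h. h x = \<gamma> 1) X Y a b"
proof -
  let ?IX = "prod_topology unit_interval X"
  note N = nondegenerateD[OF nd]
  obtain h where h: "continuous_map ?IX (prod_topology Y unit_interval) h"
    and h0: "\<And>z. h (0, z) = (a z, 1)" and h1: "\<And>z. h (1, z) = (b z, 1)"
    and tr: "\<And>t. t \<in> {0..1} \<Longrightarrow> tracked X x \<gamma> (\<lambda>z. h (t, z))"
    using hom unfolding homotopic_with_def by blast
  have hf: "continuous_map ?IX Y (\<lambda>z. fst (h z))" and hs: "continuous_map ?IX unit_interval (\<lambda>z. snd (h z))"
    using continuous_map_compose[OF h continuous_map_fst] continuous_map_compose[OF h continuous_map_snd]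
    by (simp_all add: o_def)
  define c where "c t = snd (h (t, x))" for t
  have c: "continuous_map unit_interval unit_interval c"
    unfolding c_def using N(1) by (intro continuous_map_pair_comp[OF _ _ hs, of _ id "\<lambda>_. x", unfolded id_def]) auto
  have c01: "c t \<in> {0..1}" if "t \<in> {0..1}" for t
    using c that by (auto simp: continuous_map_def Pi_iff)
  have hx: "fst (h (t, x)) = \<gamma> (c t)" if "t \<in> {0..1}" for t
    using tr[OF that] N(1) unfolding tracked_def c_def by auto
  have s1: "continuous_map X X (\<lambda>z. s (1, z))" by (rule nondegenerate_s[OF nd]) simp
  \<comment> \<open>The deformation \<open>s\<close> at time \<open>1\<close> has squeezed the
    region \<open>0 <= u\<close> to \<open>x\<close>. There the position on \<gamma> is taken to be
    the maximum of \<open>u\<close> and \<open>c\<close>: it is \<open>c\<close> on the edge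
    \<open>u = 0\<close>, where it fits the tracked homotopy, and \<open>1\<close> at
    \<open>x\<close>.\<close>
  define \<Psi> where "\<Psi> z = (if u (snd z) \<le> 0 then fst (h (fst z, s (1, snd z))) else \<gamma> (max (u (snd z)) (c (fst z))))" for z
  have cu: "continuous_map ?IX euclideanreal (\<lambda>z. u (snd z))" by (rule continuous_map_snd_comp[OF N(2)])
  have c\<Psi>: "continuous_map ?IX Y \<Psi>"
    unfolding \<Psi>_def
  proof (rule continuous_map_case_le[OF cu])
    show "continuous_map (subtopology ?IX {z \<in> topspace ?IX. u (snd z) \<le> 0}) Y (\<lambda>z. fst (h (fst z, s (1, snd z))))"
      by (intro continuous_map_from_subtopology continuous_map_pair_comp[OF _ _ hf] continuous_map_fst
          continuous_map_snd_comp[OF s1])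
    let ?D = "subtopology ?IX {z \<in> topspace ?IX. 0 \<le> u (snd z)}"
    have m: "continuous_map ?D euclideanreal (\<lambda>z. max (u (snd z)) (c (fst z)))"
      by (intro continuous_map_from_subtopology continuous_map_real_max cu continuous_map_fst_comp
          continuous_map_into_fulltopology[OF c])
    have "continuous_map ?D unit_interval (\<lambda>z. max (u (snd z)) (c (fst z)))"
      using m N(4) c01 by (intro continuous_map_into_subtopology) (auto simp: max_def)
    then show "continuous_map ?D Y (\<lambda>z. \<gamma> (max (u (snd z)) (c (fst z))))"
      by (rule continuous_map_comp2[OF _ \<gamma>])
    fix z assume z: "z \<in> topspace ?IX" "u (snd z) = 0"
    then have "fst z \<in> {0..1}" "snd z \<in> topspace X" by auto
    then show "fst (h (fst z, s (1, snd z))) = \<gamma> (max (u (snd z)) (c (fst z)))"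
      using N(8)[of "snd z"] z(2) hx[of "fst z"] c01[of "fst z"] by (simp add: max_def)
  qed
  have c0: "c 0 = 1" and c1: "c 1 = 1" using h0 h1 by (simp_all add: c_def)
  have end0: "\<Psi> (0, z) = a (s (1, z))" if "z \<in> topspace X" for z
    using N(4,8)[OF that] h0 c0 ax by (auto simp: \<Psi>_def max_def)
  have end1: "\<Psi> (1, z) = b (s (1, z))" if "z \<in> topspace X" for z
    using N(4,8)[OF that] h1 c1 bx by (auto simp: \<Psi>_def max_def)
  have base: "\<Psi> (t, x) = \<gamma> 1" if "t \<in> {0..1}" for t
    using c01[OF that] N(5) by (simp add: \<Psi>_def max_absorb1)
  have 2: "homotopic_with (\<lambda>k. k x = \<gamma> 1) X Y (\<lambda>z. a (s (1, z))) (\<lambda>z. b (s (1, z)))"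
    by (rule pointed_homotopicI[OF N(1) c\<Psi> end0 end1 base])
  have 1: "homotopic_with (\<lambda>k. k x = \<gamma> 1) X Y a (\<lambda>z. a (s (1, z)))"
    by (rule pointed_homotopicI[OF N(1) continuous_map_comp2[OF N(3) ca]]) (auto simp: N(6,7) ax)
  have 3: "homotopic_with (\<lambda>k. k x = \<gamma> 1) X Y b (\<lambda>z. b (s (1, z)))"
    by (rule pointed_homotopicI[OF N(1) continuous_map_comp2[OF N(3) cb]]) (auto simp: N(6,7) bx)
  show ?thesis using homotopic_with_trans[OF homotopic_with_trans[OF 1 2] homotopic_with_symD[OF 3]] .
qed

text \<open>The value at the base point is moved along \<gamma>: the region \<open>0 <= v\<close> is
  squeezed to the base point and then filled with the initial part of the path, reaching
  \<open>\<gamma> \<tau>\<close> at the base point itself. The two branches fit if \<gamma> starts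
  at the old value.\<close>

definition drag :: "('b \<Rightarrow> real) \<Rightarrow> (real \<times> 'b \<Rightarrow> 'b) \<Rightarrow> (real \<Rightarrow> 'a) \<Rightarrow> ('b \<Rightarrow> 'a) \<Rightarrow> real \<Rightarrow> 'b \<Rightarrow> 'a" where
  "drag v s \<gamma> g \<tau> z = (if v z \<le> 0 then g (s (1, z)) else \<gamma> (\<tau> * v z))"

lemma continuous_map_drag:
  assumes nd: "nondegenerate Y y v s" and \<gamma>: "continuous_map unit_interval X \<gamma>"
    and g: "continuous_map Y X g" and \<gamma>0: "\<gamma> 0 = g y"
  shows "continuous_map (prod_topology unit_interval Y) X (\<lambda>z. drag v s \<gamma> g (fst z) (snd z))"
  unfolding drag_def
proof (rule continuous_map_case_le)
  let ?IY = "prod_topology unit_interval Y"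
  note N = nondegenerateD[OF nd]
  show cv: "continuous_map ?IY euclideanreal (\<lambda>z. v (snd z))" by (rule continuous_map_snd_comp[OF N(2)])
  have s1: "continuous_map Y Y (\<lambda>z. s (1, z))" by (rule nondegenerate_s[OF nd]) simp
  show "continuous_map (subtopology ?IY {z \<in> topspace ?IY. v (snd z) \<le> 0}) X (\<lambda>z. g (s (1, snd z)))"
    by (intro continuous_map_from_subtopology continuous_map_snd_comp[OF continuous_map_comp2[OF s1 g]])
  let ?D = "subtopology ?IY {z \<in> topspace ?IY. 0 \<le> v (snd z)}"
  have m: "continuous_map ?D euclideanreal (\<lambda>z. fst z * v (snd z))"
    by (intro continuous_map_from_subtopology continuous_map_real_mult cv continuous_map_fst_real)
  have "continuous_map ?D unit_interval (\<lambda>z. fst z * v (snd z))"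
    using m N(4) by (intro continuous_map_into_subtopology) (auto intro!: mult_le_one)
  then show "continuous_map ?D X (\<lambda>z. \<gamma> (fst z * v (snd z)))"
    by (rule continuous_map_comp2[OF _ \<gamma>])
  fix z assume z: "z \<in> topspace ?IY" "v (snd z) = 0"
  then show "g (s (1, snd z)) = \<gamma> (fst z * v (snd z))" using N(8)[of "snd z"] \<gamma>0 by auto
qed

lemma continuous_map_drag_at:
  assumes "nondegenerate Y y v s" "continuous_map unit_interval X \<gamma>" "continuous_map Y X g" "\<gamma> 0 = g y" "\<tau> \<in> {0..1}"
  shows "continuous_map Y X (drag v s \<gamma> g \<tau>)"
  using continuous_map_o_Pair[OF continuous_map_drag[OF assms(1-4)], of \<tau>] assms(5) by (simp add: o_def)

lemma drag_0:
  assumes "nondegenerate Y y v s" "\<gamma> 0 = g y" "z \<in> topspace Y"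
  shows "drag v s \<gamma> g 0 z = g (s (1, z))"
  using nondegenerateD(8)[OF assms(1,3)] assms(2) by (auto simp: drag_def)

lemma homotopic_drag:
  assumes nd: "nondegenerate Y y v s" and \<gamma>: "continuous_map unit_interval X \<gamma>"
    and g: "continuous_map Y X g" and \<gamma>0: "\<gamma> 0 = g y"
  shows "homotopic_with (\<lambda>k. True) Y X g (drag v s \<gamma> g 1)"
proof -
  note N = nondegenerateD[OF nd]
  have "homotopic_with (\<lambda>k. True) Y X g (\<lambda>z. g (s (1, z)))"
    by (rule homotopicI[OF continuous_map_comp2[OF N(3) g]]) (simp_all add: N(6))
  moreover have "homotopic_with (\<lambda>k. True) Y X (\<lambda>z. g (s (1, z))) (drag v s \<gamma> g 1)"
    by (rule homotopicI[OF continuous_map_drag[OF assms]]) (simp_all add: drag_0[where \<gamma>=\<gamma> and g=g, OF nd \<gamma>0])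
  ultimately show ?thesis by (rule homotopic_with_trans)
qed

text \<open>The path \<gamma> is the track of \<open>x\<close> under the homotopy from
  \<open>g \<circ> f\<close> to the identity, and \<open>g'\<close> is \<open>g\<close> dragged
  along it. The homotopy from \<open>g' \<circ> f\<close> through \<open>g \<circ> f\<close> to the
  identity takes the base point backwards along \<gamma>, lets it rest, and takes it forward again.
  It never leaves \<gamma>, so \<open>tracked_imp_pointed\<close> applies.\<close>

lemma pointed_left_inverse:
  assumes ndX: "nondegenerate X x u s" and ndY: "nondegenerate Y y v s'"
    and f: "continuous_map X Y f" "f x = y" and g: "continuous_map Y X g"
    and hom: "homotopic_with (\<lambda>k. True) X X (g \<circ> f) id"
  shows "\<exists>g'. continuous_map Y X g' \<and> g' y = x \<and> homotopic_with (\<lambda>k. k x = x) X X (g' \<circ> f) id"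
proof -
  let ?IX = "prod_topology unit_interval X"
  note N = nondegenerateD[OF ndX] and N' = nondegenerateD[OF ndY]
  obtain H where H: "continuous_map ?IX X H" and H0: "\<And>z. H (0, z) = g (f z)" and H1: "\<And>z. H (1, z) = z"
    using hom unfolding homotopic_with_def by (auto simp: o_def)
  define \<gamma> where "\<gamma> t = H (t, x)" for t
  have \<gamma>: "continuous_map unit_interval X \<gamma>"
    unfolding \<gamma>_def using N(1) by (intro continuous_map_pair_comp[OF _ _ H, of _ id "\<lambda>_. x", unfolded id_def]) auto
  have \<gamma>0: "\<gamma> 0 = g y" and \<gamma>1: "\<gamma> 1 = x" using H0 H1 f(2) by (simp_all add: \<gamma>_def)
  let ?d = "drag v s' \<gamma> g"
  let ?P = "tracked X x \<gamma>" and ?T = "prod_topology X unit_interval"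
  have cg': "continuous_map Y X (?d 1)" by (rule continuous_map_drag_at[OF ndY \<gamma> g \<gamma>0]) simp
  have g'y: "?d 1 y = x" using N'(5) \<gamma>1 by (simp add: drag_def)
  have flip: "continuous_map ?IX unit_interval (\<lambda>z. 1 - fst z)"
    by (intro continuous_map_into_subtopology continuous_map_diff continuous_map_fst_real) auto
  have cf: "continuous_map ?IX Y (\<lambda>z. f (snd z))" by (rule continuous_map_snd_comp[OF f(1)])
  have 1: "homotopic_with ?P X ?T (\<lambda>z. (?d 1 (f z), 1)) (\<lambda>z. (g (s' (1, f z)), 0))"
  proof (rule tracked_homotopicI[OF N(1), where h = "\<lambda>z. (?d (1 - fst z) (f (snd z)), 1 - fst z)"])
    show "continuous_map ?IX ?T (\<lambda>z. (?d (1 - fst z) (f (snd z)), 1 - fst z))"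
      using continuous_map_pair_comp[OF flip cf continuous_map_drag[OF ndY \<gamma> g \<gamma>0]]
      by (intro continuous_map_pairedI flip) simp
    show "tracked X x \<gamma> (\<lambda>z. (?d (1 - fst (t, z)) (f (snd (t, z))), 1 - fst (t, z)))" for t
      unfolding tracked_def using f(2) N'(5) by (auto simp: drag_def)
    fix z assume "z \<in> topspace X"
    then have "f z \<in> topspace Y" using f(1) by (auto simp: continuous_map_def Pi_iff)
    then show "(?d (1 - fst (1::real, z)) (f (snd (1::real, z))), 1 - fst (1::real, z)) = (g (s' (1, f z)), 0)"
      using drag_0[where \<gamma>=\<gamma> and g=g, OF ndY \<gamma>0] by simp
  qed simp
  have 2: "homotopic_with ?P X ?T (\<lambda>z. (g (s' (1, f z)), 0)) (\<lambda>z. (g (f z), 0))"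
  proof (rule tracked_homotopicI[OF N(1), where h = "\<lambda>z. (g (s' (1 - fst z, f (snd z))), 0)"])
    show "continuous_map ?IX ?T (\<lambda>z. (g (s' (1 - fst z, f (snd z))), 0))"
      by (intro continuous_map_pairedI continuous_map_comp2[OF continuous_map_pair_comp[OF flip cf N'(3)] g]) auto
    show "tracked X x \<gamma> (\<lambda>z. (g (s' (1 - fst (t, z), f (snd (t, z)))), 0))" if "t \<in> {0..1}" for t
      unfolding tracked_def using f(2) N'(7)[of "1 - t"] that \<gamma>0 by auto
    fix z assume "z \<in> topspace X"
    then have "f z \<in> topspace Y" using f(1) by (auto simp: continuous_map_def Pi_iff)
    then show "(g (s' (1 - fst (1::real, z), f (snd (1::real, z)))), 0::real) = (g (f z), 0)" using N'(6) by simp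
  qed simp
  have 3: "homotopic_with ?P X ?T (\<lambda>z. (g (f z), 0)) (\<lambda>z. (z, 1))"
  proof (rule tracked_homotopicI[OF N(1), where h = "\<lambda>z. (H z, fst z)"])
    show "continuous_map ?IX ?T (\<lambda>z. (H z, fst z))" by (intro continuous_map_pairedI H continuous_map_fst)
    show "tracked X x \<gamma> (\<lambda>z. (H (t, z), fst (t, z)))" for t
      unfolding tracked_def by (auto simp: \<gamma>_def)
  qed (simp_all add: H0 H1)
  have "homotopic_with ?P X ?T (\<lambda>z. (?d 1 (f z), 1)) (\<lambda>z. (z, 1))"
    by (rule homotopic_with_trans[OF homotopic_with_trans[OF 1 2] 3])
  then have "homotopic_with (\<lambda>h. h x = \<gamma> 1) X X (\<lambda>z. ?d 1 (f z)) (\<lambda>z. z)"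
    by (rule tracked_imp_pointed[OF ndX \<gamma>])
       (use f(2) g'y \<gamma>1 continuous_map_comp2[OF f(1) cg'] in auto)
  then have "homotopic_with (\<lambda>k. k x = x) X X (?d 1 \<circ> f) id" by (simp add: \<gamma>1 o_def id_def)
  then show ?thesis using cg' g'y by blast
qed

definition pointed_equivalent :: "'a topology \<Rightarrow> 'a \<Rightarrow> 'b topology \<Rightarrow> 'b \<Rightarrow> bool" where
  "pointed_equivalent X x Y y \<longleftrightarrow> (\<exists>f g. continuous_map X Y f \<and> continuous_map Y X g \<and> f x = y \<and> g y = x \<and>
     homotopic_with (\<lambda>k. k x = x) X X (g \<circ> f) id \<and> homotopic_with (\<lambda>k. k y = y) Y Y (f \<circ> g) id)"

lemma homotopic_pre_comp:
  assumes "homotopic_with (\<lambda>k. True) X Y f g" "continuous_map A X h"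
  shows "homotopic_with (\<lambda>k. True) A Y (f \<circ> h) (g \<circ> h)"
  using homotopic_with_compose_continuous_map_right[OF assms] by simp

lemma homotopic_post_comp:
  assumes "homotopic_with (\<lambda>k. True) X Y f g" "continuous_map Y B h"
  shows "homotopic_with (\<lambda>k. True) X B (h \<circ> f) (h \<circ> g)"
  using homotopic_with_compose_continuous_map_left[OF assms] by simp

text \<open>The map \<open>f\<close> gets a pointed left inverse \<open>g'\<close>. Since
  \<open>g'\<close> is freely homotopic to \<open>g\<close>, it is again part of a free equivalence
  and gets a pointed left inverse \<open>f'\<close> in turn. Then \<open>f\<close> and
  \<open>f'\<close> are both pointed homotopic to \<open>f' \<circ> g' \<circ> f\<close>, so
  \<open>g'\<close> is also a right inverse of \<open>f\<close>.\<close>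

lemma pointed_equivalentI:
  assumes ndX: "nondegenerate X x u s" and ndY: "nondegenerate Y y v s'"
    and f: "continuous_map X Y f" "f x = y" and g: "continuous_map Y X g"
    and gf: "homotopic_with (\<lambda>k. True) X X (g \<circ> f) id" and fg: "homotopic_with (\<lambda>k. True) Y Y (f \<circ> g) id"
  shows "pointed_equivalent X x Y y"
proof -
  obtain g' where g': "continuous_map Y X g'" "g' y = x" and g'f: "homotopic_with (\<lambda>k. k x = x) X X (g' \<circ> f) id"
    using pointed_left_inverse[OF ndX ndY f g gf] by blast
  have g'f0: "homotopic_with (\<lambda>k. True) X X (g' \<circ> f) id"
    using g'f by (rule homotopic_with_mono) simp
  have "homotopic_with (\<lambda>k. True) Y X (g' \<circ> (f \<circ> g)) (g' \<circ> id)"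
    by (rule homotopic_post_comp[OF fg g'(1)])
  moreover have "homotopic_with (\<lambda>k. True) Y X ((g' \<circ> f) \<circ> g) (id \<circ> g)"
    by (rule homotopic_pre_comp[OF g'f0 g])
  ultimately have "homotopic_with (\<lambda>k. True) Y X g' g"
    by (metis comp_assoc comp_id id_comp homotopic_with_symD homotopic_with_trans)
  then have "homotopic_with (\<lambda>k. True) Y Y (f \<circ> g') (f \<circ> g)"
    by (rule homotopic_post_comp[OF _ f(1)])
  then have fg': "homotopic_with (\<lambda>k. True) Y Y (f \<circ> g') id" using fg homotopic_with_trans by blast
  obtain f' where f': "continuous_map X Y f'" "f' x = y" and f'g': "homotopic_with (\<lambda>k. k y = y) Y Y (f' \<circ> g') id"
    using pointed_left_inverse[OF ndY ndX g' f(1) fg'] by blast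
  have 1: "homotopic_with (\<lambda>k. k x = y) X Y (f' \<circ> (g' \<circ> f)) (f' \<circ> id)"
    using homotopic_with_compose_continuous_map_left[OF g'f f'(1), where q = "\<lambda>k. k x = y"] f'(2) by (simp add: o_def)
  have 2: "homotopic_with (\<lambda>k. k x = y) X Y ((f' \<circ> g') \<circ> f) (id \<circ> f)"
    using homotopic_with_compose_continuous_map_right[OF f'g' f(1), where q = "\<lambda>k. k x = y"] f(2) by (simp add: o_def)
  have "homotopic_with (\<lambda>k. k x = y) X Y f f'"
    using homotopic_with_trans[OF homotopic_with_symD[OF 2] 1[unfolded comp_assoc[symmetric]]] by simp
  then have "homotopic_with (\<lambda>k. k y = y) Y Y (f \<circ> g') (f' \<circ> g')"
    using homotopic_with_compose_continuous_map_right[OF _ g'(1), where q = "\<lambda>k. k y = y"] g'(2) by (simp add: o_def)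
  then have "homotopic_with (\<lambda>k. k y = y) Y Y (f \<circ> g') id" using f'g' homotopic_with_trans by blast
  then show ?thesis unfolding pointed_equivalent_def using f g' g'f by blast
qed

text \<open>The given equivalence may send \<open>x\<close> anywhere. Dragging it along a path to
  \<open>y\<close> makes it pointed and does not change its free homotopy class.\<close>

lemma pointed_equivalent_along_path:
  assumes ndX: "nondegenerate X x u s" and ndY: "nondegenerate Y y v s'"
    and eqv: "X homotopy_equivalent_space Y"
    and path: "\<And>y'. y' \<in> topspace Y \<Longrightarrow> \<exists>\<gamma>. continuous_map unit_interval Y \<gamma> \<and> \<gamma> 0 = y' \<and> \<gamma> 1 = y"
  shows "pointed_equivalent X x Y y"
proof -
  note N = nondegenerateD[OF ndX]
  obtain f g where f: "continuous_map X Y f" and g: "continuous_map Y X g"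
    and gf: "homotopic_with (\<lambda>k. True) X X (g \<circ> f) id" and fg: "homotopic_with (\<lambda>k. True) Y Y (f \<circ> g) id"
    using eqv unfolding homotopy_equivalent_space_def by blast
  have "f x \<in> topspace Y" using f N(1) by (auto simp: continuous_map_def Pi_iff)
  then obtain \<gamma> where \<gamma>: "continuous_map unit_interval Y \<gamma>" "\<gamma> 0 = f x" "\<gamma> 1 = y" using path by blast
  let ?f = "drag u s \<gamma> f 1"
  have cf: "continuous_map X Y ?f" by (rule continuous_map_drag_at[OF ndX \<gamma>(1) f \<gamma>(2)]) simp
  have fx: "?f x = y" using N(5) \<gamma>(3) by (simp add: drag_def)
  have ff: "homotopic_with (\<lambda>k. True) X Y ?f f"
    using homotopic_drag[OF ndX \<gamma>(1) f \<gamma>(2)] by (rule homotopic_with_symD)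
  show ?thesis
  proof (rule pointed_equivalentI[OF ndX ndY cf fx g])
    show "homotopic_with (\<lambda>k. True) X X (g \<circ> ?f) id"
      using homotopic_post_comp[OF ff g] gf homotopic_with_trans by blast
    show "homotopic_with (\<lambda>k. True) Y Y (?f \<circ> g) id"
      using homotopic_pre_comp[OF ff g] fg homotopic_with_trans by blast
  qed
qed

section \<open>Wedges as the two axes in a product\<close>

definition product_wedge :: "'a topology \<Rightarrow> 'a \<Rightarrow> 'b topology \<Rightarrow> 'b \<Rightarrow> ('a \<times> 'b) topology" where
  "product_wedge X x Z z = subtopology (prod_topology X Z) (topspace X \<times> {z} \<union> {x} \<times> topspace Z)"

lemma product_wedge_half:
  assumes x: "x \<in> topspace X" and z: "z \<in> topspace Z" and f: "continuous_map X Y f" "f x = y"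
  shows "continuous_map (product_wedge X x Z z) (product_wedge Y y Z z) (\<lambda>p. (f (fst p), snd p))"
proof -
  have "continuous_map (prod_topology X Z) (prod_topology Y Z) (\<lambda>p. (f (fst p), snd p))"
    by (intro continuous_map_pairedI continuous_map_fst_comp[OF f(1)] continuous_map_snd)
  then have c: "continuous_map (product_wedge X x Z z) (prod_topology Y Z) (\<lambda>p. (f (fst p), snd p))"
    unfolding product_wedge_def by (rule continuous_map_from_subtopology)
  have fX: "\<And>w. w \<in> topspace X \<Longrightarrow> f w \<in> topspace Y" using f(1) by (auto simp: continuous_map_def Pi_iff)
  have "(\<lambda>p. (f (fst p), snd p)) \<in> topspace (product_wedge X x Z z) \<rightarrow> topspace Y \<times> {z} \<union> {y} \<times> topspace Z"
    using fX f(2) by (auto simp: product_wedge_def)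
  then show ?thesis unfolding product_wedge_def[of Y]
    by (rule continuous_map_into_subtopology[OF c])
qed

lemma product_wedge_half_homotopy:
  assumes x: "x \<in> topspace X" and z: "z \<in> topspace Z" and k: "homotopic_with (\<lambda>k. k x = x) X X k id"
  shows "homotopic_with (\<lambda>k. True) (product_wedge X x Z z) (product_wedge X x Z z) (\<lambda>p. (k (fst p), snd p)) id"
proof -
  let ?W = "product_wedge X x Z z" and ?T = "topspace X \<times> {z} \<union> {x} \<times> topspace Z"
  obtain h where h: "continuous_map (prod_topology unit_interval X) X h"
    and h0: "\<And>w. h (0, w) = k w" and h1: "\<And>w. h (1, w) = w" and hx: "\<And>t. t \<in> {0..1} \<Longrightarrow> h (t, x) = x"
    using k unfolding homotopic_with_def by auto
  have hX: "h (t, w) \<in> topspace X" if "t \<in> {0..1}" "w \<in> topspace X" for t w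
    using h that by (auto simp: continuous_map_def Pi_iff)
  show ?thesis
  proof (rule homotopicI[where h = "\<lambda>p. (h (fst p, fst (snd p)), snd (snd p))"])
    have sub: "continuous_map (prod_topology unit_interval ?W) (prod_topology X Z) snd"
      unfolding product_wedge_def by (rule continuous_map_into_fulltopology[OF continuous_map_snd])
    have a: "continuous_map (prod_topology unit_interval ?W) X (\<lambda>p. fst (snd p))"
      by (rule continuous_map_comp2[OF sub continuous_map_fst])
    have b: "continuous_map (prod_topology unit_interval ?W) Z (\<lambda>p. snd (snd p))"
      by (rule continuous_map_comp2[OF sub continuous_map_snd])
    have c: "continuous_map (prod_topology unit_interval ?W) (prod_topology X Z) (\<lambda>p. (h (fst p, fst (snd p)), snd (snd p)))"
      by (intro continuous_map_pairedI b continuous_map_pair_comp[OF _ a h] continuous_map_fst)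
    show "continuous_map (prod_topology unit_interval ?W) ?W (\<lambda>p. (h (fst p, fst (snd p)), snd (snd p)))"
      unfolding product_wedge_def
    proof (rule continuous_map_into_subtopology)
      show "continuous_map (prod_topology unit_interval (subtopology (prod_topology X Z) ?T)) (prod_topology X Z)
          (\<lambda>p. (h (fst p, fst (snd p)), snd (snd p)))" using c unfolding product_wedge_def .
      show "(\<lambda>p. (h (fst p, fst (snd p)), snd (snd p))) \<in>
          topspace (prod_topology unit_interval (subtopology (prod_topology X Z) ?T)) \<rightarrow> ?T"
        using hX hx z x by auto
    qed
  qed (auto simp: h0 h1)
qed

text \<open>In the product model maps and homotopies act on the first coordinate only; they preserve
  the two axes precisely because they keep the base point fixed. This is the reason for working with
  pointed equivalences.\<close>

lemma product_wedge_equivalent: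
  assumes "pointed_equivalent X x Y y" and x: "x \<in> topspace X" and y: "y \<in> topspace Y" and z: "z \<in> topspace Z"
  shows "product_wedge X x Z z homotopy_equivalent_space product_wedge Y y Z z"
proof -
  obtain f g where f: "continuous_map X Y f" "f x = y" and g: "continuous_map Y X g" "g y = x"
    and gf: "homotopic_with (\<lambda>k. k x = x) X X (g \<circ> f) id" and fg: "homotopic_with (\<lambda>k. k y = y) Y Y (f \<circ> g) id"
    using assms(1) unfolding pointed_equivalent_def by blast
  let ?F = "\<lambda>p. (f (fst p), snd p)" and ?G = "\<lambda>p. (g (fst p), snd p)"
  show ?thesis unfolding homotopy_equivalent_space_def
  proof (intro exI[of _ ?F] exI[of _ ?G] conjI)
    show "continuous_map (product_wedge X x Z z) (product_wedge Y y Z z) ?F" by (rule product_wedge_half[OF x z f])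
    show "continuous_map (product_wedge Y y Z z) (product_wedge X x Z z) ?G" by (rule product_wedge_half[OF y z g])
    show "homotopic_with (\<lambda>x. True) (product_wedge X x Z z) (product_wedge X x Z z) (?G \<circ> ?F) id"
      using product_wedge_half_homotopy[OF x z gf] by (simp add: o_def)
    show "homotopic_with (\<lambda>x. True) (product_wedge Y y Z z) (product_wedge Y y Z z) (?F \<circ> ?G) id"
      using product_wedge_half_homotopy[OF y z fg] by (simp add: o_def)
  qed
qed

lemma compact_space_disjoint_union:
  assumes "compact_space X" "compact_space Y" shows "compact_space (disjoint_union X Y)"
proof -
  have "continuous_map X (disjoint_union X Y) Inl" "continuous_map Y (disjoint_union X Y) Inr"
    by (auto simp: continuous_map_def topspace_disjoint_union openin_disjoint_union Collect_conj_eq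
        vimage_def intro: openin_Int)
  then have "compactin (disjoint_union X Y) (Inl ` topspace X \<union> Inr ` topspace Y)"
    using assms by (intro compactin_Un image_compactin) (auto simp: compact_space_def)
  moreover have "Inl ` topspace X \<union> Inr ` topspace Y = topspace (disjoint_union X Y)"
    by (auto simp: topspace_disjoint_union)
  ultimately show ?thesis by (simp add: compact_space_def)
qed

lemma continuous_map_from_disjoint_union:
  assumes "continuous_map X Z (\<lambda>x. f (Inl x))" "continuous_map Y Z (\<lambda>y. f (Inr y))"
  shows "continuous_map (disjoint_union X Y) Z f"
  using assms by (auto simp: continuous_map_def topspace_disjoint_union openin_disjoint_union Pi_iff
      vimage_def image_iff Plus_def)

text \<open>The evident bijection onto the two axes is continuous by the universal properties of the
  quotient and of the disjoint union; it starts at a compact space and ends in a Hausdorff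
  one.\<close>

lemma wedge_homeomorphic_product_wedge:
  assumes X: "compact_space X" "Hausdorff_space X" and Z: "compact_space Z" "Hausdorff_space Z"
    and x: "x \<in> topspace X" and z: "z \<in> topspace Z"
  shows "wedge X x Z z homeomorphic_space product_wedge X x Z z"
proof -
  let ?W = "wedge X x Z z" and ?P = "product_wedge X x Z z"
  define f where "f w = (case w of None \<Rightarrow> (x, z) | Some (Inl a) \<Rightarrow> (a, z) | Some (Inr b) \<Rightarrow> (x, b))" for w
  have ts: "topspace ?W = insert None (Some ` (topspace X <+> topspace Z - {Inl x, Inr z}))"
    by (simp add: wedge_def topspace_collapse topspace_disjoint_union)
  have tP: "topspace ?P = topspace X \<times> {z} \<union> {x} \<times> topspace Z"
    using x z by (auto simp: product_wedge_def)
  have inl: "continuous_map X ?P (\<lambda>a. (a, z))" and inr: "continuous_map Z ?P (\<lambda>b. (x, b))"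
    unfolding product_wedge_def using x z
    by (auto intro!: continuous_map_into_subtopology continuous_map_pairedI)
  have "homeomorphic_map ?W ?P f"
  proof (rule T1_Spaces.continuous_imp_homeomorphic_map)
    show "continuous_map ?W ?P f" unfolding wedge_def
    proof (rule continuous_map_from_collapse)
      show "f None \<in> topspace ?P" using x z tP by (simp add: f_def)
      have 1: "continuous_map X ?P (\<lambda>a. (f \<circ> collapse_map {Inl x, Inr z}) (Inl a))"
        by (rule continuous_map_eq[OF inl]) (auto simp: f_def collapse_map_def)
      have 2: "continuous_map Z ?P (\<lambda>b. (f \<circ> collapse_map {Inl x, Inr z}) (Inr b))"
        by (rule continuous_map_eq[OF inr]) (auto simp: f_def collapse_map_def)
      show "continuous_map (disjoint_union X Z) ?P (f \<circ> collapse_map {Inl x, Inr z})"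
        by (rule continuous_map_from_disjoint_union[OF 1 2])
    qed
    show "compact_space ?W" unfolding wedge_def
      by (intro compact_space_collapse compact_space_disjoint_union X Z)
    show "Hausdorff_space ?P" unfolding product_wedge_def
      using X Z by (simp add: Hausdorff_space_subtopology Hausdorff_space_prod_topology)
    show "f ` topspace ?W = topspace ?P"
    proof
      show "f ` topspace ?W \<subseteq> topspace ?P" unfolding ts tP using x z by (auto simp: f_def)
      show "topspace ?P \<subseteq> f ` topspace ?W"
      proof
        fix p assume "p \<in> topspace ?P"
        then consider "p = (x, z)" | a where "a \<in> topspace X" "a \<noteq> x" "p = (a, z)"
          | b where "b \<in> topspace Z" "b \<noteq> z" "p = (x, b)" unfolding tP by auto
        then show "p \<in> f ` topspace ?W"
        proof cases
          case 1
          then show ?thesis unfolding ts by (intro image_eqI[of _ _ None]) (simp_all add: f_def)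
        next
          case 2
          then show ?thesis unfolding ts by (intro image_eqI[of _ _ "Some (Inl a)"]) (auto simp: f_def)
        next
          case 3
          then show ?thesis unfolding ts by (intro image_eqI[of _ _ "Some (Inr b)"]) (auto simp: f_def)
        qed
      qed
    qed
    show "inj_on f (topspace ?W)" unfolding ts inj_on_def f_def by (auto split: option.splits sum.splits)
  qed
  then show ?thesis by (rule homeomorphic_map_imp_homeomorphic_space)
qed

text \<open>The weight of a moving point against the base point it is pulled to. Nothing moves where
  \<open>l\<close> is at most \<open>0\<close>, and at time \<open>1\<close> the weight is
  \<open>0\<close> as soon as \<open>l\<close> is at least \<open>1/2\<close>. It serves spheres,
  with \<open>l\<close> the first coordinate, as well as complexes, with \<open>l\<close> a ratio of
  barycentric coordinates.\<close>

definition pull_weight :: "real \<Rightarrow> real \<Rightarrow> real" where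
  "pull_weight t l = max 0 (1 - 2 * t * max 0 l)"

lemma pull_weight: 
  "0 \<le> t \<Longrightarrow> pull_weight t l \<in> {0..1}" "pull_weight 0 l = 1" "1 \<le> 2 * l \<Longrightarrow> pull_weight 1 l = 0"
  "l \<le> 0 \<Longrightarrow> pull_weight t l = 1"
  by (auto simp: pull_weight_def max_def)

definition pull_point :: "real \<Rightarrow> (nat \<Rightarrow> real) \<Rightarrow> nat \<Rightarrow> real" where
  "pull_point t x = (\<lambda>j. (1 - pull_weight t (x 0)) * pole j + pull_weight t (x 0) * x j)"

definition pull_sphere :: "real \<Rightarrow> (nat \<Rightarrow> real) \<Rightarrow> nat \<Rightarrow> real" where
  "pull_sphere t x = (\<lambda>j. pull_point t x j / sqrt (\<Sum>i\<le>3. pull_point t x i ^ 2))"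

text \<open>A chord ending at the pole could meet the origin only if it started at the antipode.
  Points with first coordinate at most \<open>0\<close> are left alone, and for the others the first
  coordinate stays positive, so that normalising is possible.\<close>

lemma pull_point_pos:
  assumes "0 \<le> t" "x \<in> three_sphere" shows "0 < (\<Sum>i\<le>3. pull_point t x i ^ 2)"
proof (cases "x 0 \<le> 0")
  case True
  then have "pull_point t x = x" by (simp add: pull_point_def pull_weight)
  then show ?thesis using assms by (simp add: three_sphere_def)
next
  case False
  have k: "0 \<le> pull_weight t (x 0)" "pull_weight t (x 0) \<le> 1" using pull_weight(1)[OF assms(1)] by auto
  have "0 < pull_point t x 0"
  proof (cases "pull_weight t (x 0) = 1")
    case False
    then have "0 < 1 - pull_weight t (x 0)" using k by simp
    then show ?thesis using k \<open>\<not> x 0 \<le> 0\<close> by (simp add: pull_point_def pole_def add_pos_nonneg)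
  qed (use False in \<open>simp add: pull_point_def\<close>)
  then have "0 < pull_point t x 0 ^ 2" by simp
  also have "\<dots> \<le> (\<Sum>i\<le>3. pull_point t x i ^ 2)" by (rule member_le_sum) auto
  finally show ?thesis .
qed

lemma pull_sphere:
  shows "0 \<le> t \<Longrightarrow> x \<in> three_sphere \<Longrightarrow> pull_sphere t x \<in> three_sphere"
    and "x \<in> three_sphere \<Longrightarrow> pull_sphere 0 x = x"
    and "pull_sphere t pole = pole"
    and "1 \<le> 2 * x 0 \<Longrightarrow> pull_sphere 1 x = pole"
proof -
  show "pull_sphere t x \<in> three_sphere" if "0 \<le> t" "x \<in> three_sphere"
  proof -
    let ?S = "\<Sum>i\<le>3. pull_point t x i ^ 2"
    have S: "0 < ?S" using pull_point_pos[OF that] .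
    have "(\<Sum>i\<le>3. pull_sphere t x i ^ 2) = (\<Sum>i\<le>3. pull_point t x i ^ 2 / ?S)"
      unfolding pull_sphere_def using S by (intro sum.cong) (auto simp: power_divide)
    also have "\<dots> = 1" using S by (simp flip: sum_divide_distrib)
    finally show ?thesis using that(2) by (simp add: three_sphere_def pull_sphere_def pull_point_def pole_def)
  qed
  have pp: "(\<Sum>i\<le>3. pole i ^ 2) = 1" using pole_in_three_sphere by (simp add: three_sphere_def)
  show "pull_sphere 0 x = x" if "x \<in> three_sphere"
    using that by (simp add: pull_sphere_def pull_point_def pull_weight three_sphere_def)
  have "pull_point t pole = pole" by (simp add: pull_point_def algebra_simps)
  then show "pull_sphere t pole = pole" using pp by (simp add: pull_sphere_def)
  show "pull_sphere 1 x = pole" if "1 \<le> 2 * x 0"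
    using that pp by (simp add: pull_sphere_def pull_point_def pull_weight)
qed

lemma continuous_on_pull_weight:
  assumes "continuous_on S f" "continuous_on S g"
  shows "continuous_on S (\<lambda>z. pull_weight (f z) (g z))"
  unfolding pull_weight_def by (intro continuous_intros continuous_on_max assms)

lemma continuous_on_pull_sphere:
  assumes f: "continuous_on S f" and g: "continuous_on S g"
    and S: "\<And>z. z \<in> S \<Longrightarrow> 0 \<le> f z \<and> g z \<in> three_sphere"
  shows "continuous_on S (\<lambda>z. pull_sphere (f z) (g z))"
proof (rule continuous_on_coordinatewise_then_product)
  fix j
  have gj: "continuous_on S (\<lambda>z. g z i)" for i
    by (rule continuous_on_product_then_coordinatewise[OF g])
  have pt: "continuous_on S (\<lambda>z. pull_point (f z) (g z) i)" for i
    unfolding pull_point_def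
    by (intro continuous_on_add continuous_on_mult continuous_on_diff continuous_on_const continuous_on_pull_weight f gj)
  have nz: "sqrt (\<Sum>i\<le>3. pull_point (f z) (g z) i ^ 2) \<noteq> 0" if "z \<in> S" for z
    using pull_point_pos[of "f z" "g z"] S[OF that] by (metis less_irrefl real_sqrt_eq_zero_cancel_iff)
  show "continuous_on S (\<lambda>z. pull_sphere (f z) (g z) j)"
    unfolding pull_sphere_def
    by (intro continuous_on_divide continuous_on_real_sqrt continuous_on_sum continuous_on_power pt ballI nz)
qed

text \<open>All coordinates are pulled to the pole simultaneously, which moves at most one of them.
  The minimum ranges up to and including \<open>k\<close>, an index beyond all spheres: its value is
  always \<open>1\<close>, which bounds the minimum by \<open>1\<close> and keeps it meaningful for
  \<open>k = 0\<close>.\<close>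

lemma nondegenerate_sphere_axes:
  "nondegenerate (top_of_set (sphere_axes k)) (\<lambda>_. pole)
     (\<lambda>F. Min ((\<lambda>i. 2 * F i 0 - 1) ` {..k})) (\<lambda>z i. pull_sphere (fst z) (snd z i))"
  unfolding nondegenerate_def
proof (intro conjI ballI impI)
  let ?A = "sphere_axes k"
  have sph: "F i \<in> three_sphere" if "F \<in> ?A" for F i using that by (simp add: sphere_axes_def)
  show "(\<lambda>_. pole) \<in> topspace (top_of_set ?A)" by (simp add: sphere_axes_def pole_in_three_sphere)
  have "continuous_on ?A (\<lambda>F. F i)" for i by (rule continuous_on_apply)
  then have "continuous_on ?A (\<lambda>F. F i 0)" for i by (rule continuous_on_product_then_coordinatewise)
  then have "continuous_on ?A (\<lambda>F. Min ((\<lambda>i. 2 * F i 0 - 1) ` {..k}))"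
    by (intro continuous_on_Min continuous_intros) auto
  then show "continuous_map (top_of_set ?A) euclideanreal (\<lambda>F. Min ((\<lambda>i. 2 * F i 0 - 1) ` {..k}))" by simp
  have "continuous_on ({0..1} \<times> ?A) (\<lambda>z. snd z i)" for i
    by (rule continuous_on_product_then_coordinatewise) (intro continuous_intros)
  then have "continuous_on ({0..1::real} \<times> ?A) (\<lambda>z. pull_sphere (fst z) (snd z i))" for i
    by (rule continuous_on_pull_sphere[OF continuous_on_fst[OF continuous_on_id]]) (auto simp: sph)
  then have c: "continuous_on ({0..1::real} \<times> ?A) (\<lambda>z i. pull_sphere (fst z) (snd z i))"
    by (rule continuous_on_coordinatewise_then_product)
  have "(\<lambda>i. pull_sphere t (F i)) \<in> ?A" if "F \<in> ?A" "0 \<le> t" for t F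
    using that by (auto simp: sphere_axes_def pull_sphere(1,3)) (metis pull_sphere(3))
  then show "continuous_map (prod_topology unit_interval (top_of_set ?A)) (top_of_set ?A) (\<lambda>z i. pull_sphere (fst z) (snd z i))"
    using c by auto
  fix F assume F: "F \<in> topspace (top_of_set ?A)"
  then have FA: "F \<in> ?A" by simp
  have Fk: "F k = pole" using FA by (simp add: sphere_axes_def)
  have "Min ((\<lambda>i. 2 * F i 0 - 1) ` {..k}) \<le> 2 * F k 0 - 1" by (intro Min_le) auto
  then show "Min ((\<lambda>i. 2 * F i 0 - 1) ` {..k}) \<le> 1" by (simp add: Fk pole_def)
  show "(\<lambda>i. pull_sphere (fst (0, F)) (snd (0, F) i)) = F" using sph[OF FA] by (simp add: pull_sphere(2))
  assume ge: "0 \<le> Min ((\<lambda>i. 2 * F i 0 - 1) ` {..k})"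
  have "pull_sphere 1 (F i) = pole" for i
  proof (cases "i \<le> k")
    case True
    then have "1 \<le> 2 * F i 0" using ge by (auto simp: Min_ge_iff)
    then show ?thesis by (rule pull_sphere(4))
  next
    case False
    then show ?thesis using FA by (simp add: sphere_axes_def pull_sphere(3))
  qed
  then show "(\<lambda>i. pull_sphere (fst (1, F)) (snd (1, F) i)) = (\<lambda>_. pole)" by simp
next
  show "Min ((\<lambda>i. 2 * pole 0 - 1) ` {..k}) = 1" by (simp add: pole_def)
  show "(\<lambda>i. pull_sphere (fst (t, \<lambda>_. pole)) (snd (t, \<lambda>_. pole) i)) = (\<lambda>_. pole)" for t
    by (simp add: pull_sphere(3))
qed

text \<open>An arc of a great circle in the plane of the pole and a unit vector \<open>n\<close>
  orthogonal to it; the angle between the moving point and the pole shrinks linearly from \<theta>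
  to \<open>0\<close>.\<close>

lemma path_to_pole:
  assumes x: "x \<in> three_sphere"
  shows "\<exists>\<gamma>. continuous_on {0..1::real} \<gamma> \<and> \<gamma> ` {0..1} \<subseteq> three_sphere \<and> \<gamma> 0 = x \<and> \<gamma> 1 = pole"
proof -
  let ?r = "sqrt (x 1 ^ 2 + x 2 ^ 2 + x 3 ^ 2)"
  have sx: "x 0 ^ 2 + x 1 ^ 2 + x 2 ^ 2 + x 3 ^ 2 = 1" and xz: "\<And>k. k > 3 \<Longrightarrow> x k = 0"
    using x by (auto simp: three_sphere_def sum_le_3)
  have r2: "?r ^ 2 = 1 - x 0 ^ 2" using sx by simp
  have "x 0 ^ 2 \<le> 1" using sx zero_le_power2[of "x 1"] zero_le_power2[of "x 2"] zero_le_power2[of "x 3"] by linarith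
  then have x01: "-1 \<le> x 0" "x 0 \<le> 1" using abs_square_le_1[of "x 0"] by (auto simp: abs_le_iff)
  \<comment> \<open>The normalised projection of \<open>x\<close> orthogonal to the pole. It
    degenerates when \<open>x\<close> is the pole or its antipode; any unit vector orthogonal to the
    pole then works, and the one of index \<open>1\<close> is taken.\<close>
  define n where "n k = (if ?r = 0 then (if k = 1 then 1 else 0) else if k = 0 then 0 else x k / ?r)" for k :: nat
  have n0: "n 0 = 0" and n3: "\<And>k. k > 3 \<Longrightarrow> n k = 0" by (auto simp: n_def xz)
  have nn: "n 1 ^ 2 + n 2 ^ 2 + n 3 ^ 2 = 1"
  proof (cases "?r = 0")
    case False
    then have "n k ^ 2 = x k ^ 2 / ?r ^ 2" if "k > 0" for k
      using that by (simp add: n_def power_divide)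
    then have "n 1 ^ 2 + n 2 ^ 2 + n 3 ^ 2 = x 1 ^ 2 / ?r ^ 2 + x 2 ^ 2 / ?r ^ 2 + x 3 ^ 2 / ?r ^ 2" by simp
    also have "\<dots> = (x 1 ^ 2 + x 2 ^ 2 + x 3 ^ 2) / ?r ^ 2" by (simp only: add_divide_distrib)
    also have "?r ^ 2 = x 1 ^ 2 + x 2 ^ 2 + x 3 ^ 2" by simp
    also have "(x 1 ^ 2 + x 2 ^ 2 + x 3 ^ 2) / (x 1 ^ 2 + x 2 ^ 2 + x 3 ^ 2) = 1"
      by (rule divide_self) (use False in simp)
    finally show ?thesis .
  qed (simp add: n_def)
  define \<theta> where "\<theta> = arccos (x 0)"
  have sin: "sin \<theta> = ?r" unfolding \<theta>_def using x01 sin_arccos[of "x 0"] sx by (simp add: algebra_simps)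
  have cos: "cos \<theta> = x 0" unfolding \<theta>_def using x01 by (simp add: cos_arccos)
  define \<gamma> where "\<gamma> t k = (if k = 0 then cos ((1 - t) * \<theta>) else sin ((1 - t) * \<theta>) * n k)" for t :: real and k :: nat
  have "continuous_on {0..1} (\<lambda>t. \<gamma> t k)" for k unfolding \<gamma>_def by (cases "k = 0") (auto intro!: continuous_intros)
  then have "continuous_on {0..1} \<gamma>" by (rule continuous_on_coordinatewise_then_product)
  moreover have "\<gamma> t \<in> three_sphere" for t
  proof -
    have "(\<Sum>i\<le>3. \<gamma> t i ^ 2) = cos ((1 - t) * \<theta>) ^ 2 + sin ((1 - t) * \<theta>) ^ 2 * (n 1 ^ 2 + n 2 ^ 2 + n 3 ^ 2)"
      by (simp add: sum_le_3 \<gamma>_def power_mult_distrib algebra_simps)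
    also have "\<dots> = 1" unfolding nn by simp
    finally show ?thesis by (simp add: three_sphere_def \<gamma>_def n3)
  qed
  moreover have "\<gamma> 0 k = x k" for k
  proof (cases "k = 0 \<or> ?r \<noteq> 0")
    case True
    then show ?thesis using cos sin by (auto simp: \<gamma>_def n_def)
  next
    case False
    then have "x 1 ^ 2 + x 2 ^ 2 + x 3 ^ 2 = 0" by simp
    then have z: "x 1 ^ 2 = 0" "x 2 ^ 2 = 0" "x 3 ^ 2 = 0"
      using zero_le_power2[of "x 1"] zero_le_power2[of "x 2"] zero_le_power2[of "x 3"] by linarith+
    have "k = 1 \<or> k = 2 \<or> k = 3 \<or> k > 3" using False by linarith
    then have "x k = 0" using z xz by auto
    moreover have "\<gamma> 0 k = 0" using False sin by (simp add: \<gamma>_def)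
    ultimately show ?thesis by simp
  qed
  moreover have "\<gamma> 1 = pole" by (auto simp: \<gamma>_def pole_def)
  ultimately show ?thesis by (intro exI[of _ \<gamma>]) auto
qed

lemma path_in_sphere_axes:
  assumes "F \<in> sphere_axes k"
  shows "\<exists>\<gamma>. continuous_map unit_interval (top_of_set (sphere_axes k)) \<gamma> \<and> \<gamma> 0 = F \<and> \<gamma> 1 = (\<lambda>_. pole)"
proof -
  have F: "\<And>i. F i \<in> three_sphere" "\<And>i. i \<ge> k \<Longrightarrow> F i = pole"
    "\<And>i j. i \<noteq> j \<Longrightarrow> F i = pole \<or> F j = pole" using assms by (auto simp: sphere_axes_def)
  have "\<exists>i. \<forall>j. j \<noteq> i \<longrightarrow> F j = pole" using F(3) by metis
  then obtain i where i: "\<And>j. j \<noteq> i \<Longrightarrow> F j = pole" by blast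
  obtain \<gamma> where g: "continuous_on {0..1::real} \<gamma>" "\<gamma> ` {0..1} \<subseteq> three_sphere" "\<gamma> 0 = F i" "\<gamma> 1 = pole"
    using path_to_pole[OF F(1)] by blast
  show ?thesis
  proof (cases "i < k")
    case True
    let ?g = "\<lambda>t j. if j = i then \<gamma> t else pole"
    have "continuous_on {0..1} (\<lambda>t. ?g t j)" for j by (cases "j = i") (auto simp: g(1))
    then have "continuous_on {0..1} ?g" by (rule continuous_on_coordinatewise_then_product)
    moreover have "?g t \<in> sphere_axes k" if "t \<in> {0..1}" for t
      using g(2) that True by (auto simp: sphere_axes_def pole_in_three_sphere)
    moreover have "?g 0 = F" using g(3) i by (auto simp: fun_eq_iff)
    ultimately show ?thesis using g(4) by (intro exI[of _ ?g]) auto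
  next
    case False
    then have "F = (\<lambda>_. pole)" using i F(2) by (metis not_le)
    then show ?thesis using assms by (intro exI[of _ "\<lambda>_. F"]) auto
  qed
qed

text \<open>The two families of axes are concatenated, the second one shifted by \<open>a\<close>.
  Only the first factor is in axes form: it replaces a complex by equivalence, whereas
  \<open>wedge_S3 b\<close> is the factor occurring in the theorem and is translated by
  \<open>axes_map\<close>.\<close>

lemma product_wedge_axes_homeomorphic:
  "product_wedge (top_of_set (sphere_axes a)) (\<lambda>_. pole) (wedge_S3 b) None homeomorphic_space wedge_S3 (a + b)"
proof -
  let ?base = "\<lambda>_::nat. pole"
  let ?P = "product_wedge (top_of_set (sphere_axes a)) ?base (wedge_S3 b) None"
  define f where "f p = (\<lambda>i. if i < a then fst p i else axes_map (snd p) (i - a))"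
    for p :: "(nat \<Rightarrow> nat \<Rightarrow> real) \<times> (nat \<times> (nat \<Rightarrow> real)) option"
  have base: "?base \<in> sphere_axes a" for a by (simp add: sphere_axes_def pole_in_three_sphere)
  note NT = None_in_wedge_S3[of b] and cW = compact_wedge_S3[of b] and hW = Hausdorff_wedge_S3[of b]
  have aN: "axes_map None = ?base" by (simp add: axes_map_def)
  note hm = homeomorphic_map_axes[of b]
  have ca: "continuous_map (wedge_S3 b) (top_of_set (sphere_axes b)) axes_map"
    and ia: "inj_on axes_map (topspace (wedge_S3 b))" and sa: "axes_map ` topspace (wedge_S3 b) = sphere_axes b"
    using hm by (auto simp: homeomorphic_eq_everything_map)
  have am: "axes_map w \<in> sphere_axes b" if "w \<in> topspace (wedge_S3 b)" for w using that sa by blast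
  have tP: "topspace ?P = sphere_axes a \<times> {None} \<union> {?base} \<times> topspace (wedge_S3 b)"
    using base NT by (auto simp: product_wedge_def)
  have inl: "f (F, None) \<in> sphere_axes (a + b)" if F: "F \<in> sphere_axes a" for F
  proof -
    have "f (F, None) i = F i" for i using F by (auto simp: f_def aN sphere_axes_def)
    then show ?thesis using F by (auto simp: sphere_axes_def)
  qed
  have inr: "f (?base, w) \<in> sphere_axes (a + b)" if "w \<in> topspace (wedge_S3 b)" for w
  proof -
    have W: "axes_map w i \<in> three_sphere" "i \<ge> b \<longrightarrow> axes_map w i = pole"
      "i \<noteq> j \<longrightarrow> axes_map w i = pole \<or> axes_map w j = pole" for i j
      using am[OF that] by (auto simp: sphere_axes_def)
    have "f (?base, w) i = pole \<or> f (?base, w) j = pole" if "i \<noteq> j" for i j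
      using W(3)[of "i - a" "j - a"] that by (auto simp: f_def)
    moreover have "f (?base, w) i = pole" if "i \<ge> a + b" for i
      using W(2)[of "i - a"] that by (simp add: f_def)
    moreover have "f (?base, w) i \<in> three_sphere" for i using W(1) by (simp add: f_def pole_in_three_sphere)
    ultimately show ?thesis unfolding sphere_axes_def by blast
  qed
  have "homeomorphic_map ?P (top_of_set (sphere_axes (a + b))) f"
  proof (rule T1_Spaces.continuous_imp_homeomorphic_map)
    have "continuous_map ?P euclidean (\<lambda>p. f p i)" for i
    proof (cases "i < a")
      case True
      have "continuous_map (top_of_set (sphere_axes a)) euclidean (\<lambda>F. F i)"
        by (simp add: continuous_on_apply)
      then have "continuous_map (prod_topology (top_of_set (sphere_axes a)) (wedge_S3 b)) euclidean (\<lambda>p. fst p i)"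
        by (rule continuous_map_fst_comp)
      then show ?thesis unfolding product_wedge_def f_def using True
        by (simp add: continuous_map_from_subtopology)
    next
      case False
      have "continuous_map (top_of_set (sphere_axes b)) euclidean (\<lambda>F. F (i - a))"
        by (simp add: continuous_on_apply)
      from continuous_map_snd_comp[OF continuous_map_comp2[OF ca this]]
      have "continuous_map (prod_topology (top_of_set (sphere_axes a)) (wedge_S3 b)) euclidean (\<lambda>p. axes_map (snd p) (i - a))" .
      then show ?thesis unfolding product_wedge_def f_def using False
        by (simp add: continuous_map_from_subtopology)
    qed
    then have "continuous_map ?P (product_topology (\<lambda>_. euclidean) UNIV) f"
      by (simp add: continuous_map_componentwise_UNIV)
    then show "continuous_map ?P (top_of_set (sphere_axes (a + b))) f"
      using inl inr by (intro continuous_map_into_subtopology) (auto simp: euclidean_product_topology tP)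
    show "compact_space ?P"
    proof -
      have "closedin (prod_topology (top_of_set (sphere_axes a)) (wedge_S3 b))
          (sphere_axes a \<times> {None} \<union> {?base} \<times> topspace (wedge_S3 b))"
      proof (rule closedin_Un)
        have "closedin (wedge_S3 b) {None}" using closedin_Hausdorff_singleton[OF hW NT] .
        then show "closedin (prod_topology (top_of_set (sphere_axes a)) (wedge_S3 b)) (sphere_axes a \<times> {None})"
          by (simp add: closedin_prod_Times_iff)
        have "closedin (top_of_set (sphere_axes a)) {?base}"
          using closedin_Hausdorff_singleton[OF Hausdorff_sphere_axes, of ?base a] base by simp
        then show "closedin (prod_topology (top_of_set (sphere_axes a)) (wedge_S3 b)) ({?base} \<times> topspace (wedge_S3 b))"
          by (simp add: closedin_prod_Times_iff)
      qed
      moreover have "compact_space (prod_topology (top_of_set (sphere_axes a)) (wedge_S3 b))"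
        using compact_sphere_axes cW by (simp add: compact_space_prod_topology)
      ultimately have "compactin (prod_topology (top_of_set (sphere_axes a)) (wedge_S3 b))
          (sphere_axes a \<times> {None} \<union> {?base} \<times> topspace (wedge_S3 b))"
        by (rule closedin_compact_space[rotated])
      then show ?thesis by (simp add: product_wedge_def compact_space_subtopology)
    qed
    show "Hausdorff_space (top_of_set (sphere_axes (a + b)))" by (rule Hausdorff_sphere_axes)
    show "f ` topspace ?P = topspace (top_of_set (sphere_axes (a + b)))"
    proof
      show "f ` topspace ?P \<subseteq> topspace (top_of_set (sphere_axes (a + b)))" using inl inr tP by auto
      show "topspace (top_of_set (sphere_axes (a + b))) \<subseteq> f ` topspace ?P"
      proof
        fix G assume "G \<in> topspace (top_of_set (sphere_axes (a + b)))"
        then have G: "\<And>i. G i \<in> three_sphere" "\<And>i. i \<ge> a + b \<Longrightarrow> G i = pole"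
          "\<And>i j. i \<noteq> j \<Longrightarrow> G i = pole \<or> G j = pole" by (auto simp: sphere_axes_def)
        show "G \<in> f ` topspace ?P"
        proof (cases "\<forall>i\<ge>a. G i = pole")
          case True
          then have "G \<in> sphere_axes a" "f (G, None) = G" using G by (auto simp: sphere_axes_def f_def aN)
          then show ?thesis unfolding tP by (intro image_eqI[of _ _ "(G, None)"]) auto
        next
          case False
          then obtain k where k: "k \<ge> a" "G k \<noteq> pole" by blast
          have low: "G i = pole" if "i < a" for i using G(3)[of i k] k that by auto
          have "(\<lambda>i. G (i + a)) \<in> sphere_axes b" using G by (auto simp: sphere_axes_def)
          then obtain w where w: "w \<in> topspace (wedge_S3 b)" "axes_map w = (\<lambda>i. G (i + a))" using sa by (metis (no_types, lifting) imageE)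
          then have "f (?base, w) = G" using low by (auto simp: f_def)
          then show ?thesis unfolding tP using w(1) by (intro image_eqI[of _ _ "(?base, w)"]) auto
        qed
      qed
    qed
    show "inj_on f (topspace ?P)"
    proof (rule inj_onI)
      fix p q assume p: "p \<in> topspace ?P" and q: "q \<in> topspace ?P" and eq: "f p = f q"
      have fst_eq: "fst p i = fst q i" for i
      proof (cases "i < a")
        case True
        then show ?thesis using fun_cong[OF eq, of i] by (simp add: f_def)
      next
        case False
        then show ?thesis using p q unfolding tP by (auto simp: sphere_axes_def)
      qed
      have "axes_map (snd p) i = axes_map (snd q) i" for i
        using fun_cong[OF eq, of "i + a"] by (simp add: f_def)
      moreover have "snd p \<in> topspace (wedge_S3 b)" "snd q \<in> topspace (wedge_S3 b)"
        using p q NT unfolding tP by auto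
      ultimately have "snd p = snd q" using ia unfolding inj_on_def by blast
      moreover have "fst p = fst q" using fst_eq by blast
      ultimately show "p = q" by (simp add: prod_eq_iff)
    qed
  qed
  then show ?thesis
    using wedge_S3_homeomorphic_axes[of "a + b"] homeomorphic_map_imp_homeomorphic_space homeomorphic_space_sym homeomorphic_space_trans by blast
qed

text \<open>The point \<open>x\<close> may be in the interior of a simplex. Here
  \<open>lam \<alpha>\<close> is the largest factor for which the multiple of \<open>x\<close> is
  still below \<alpha> in every coordinate; comparing coordinate sums shows that it is at most
  \<open>1\<close>. Where it is positive, the support of \<alpha> contains that of \<open>x\<close>,
  so the segment towards \<open>x\<close> stays in one simplex; where it is \<open>0\<close>, the
  weight keeps \<alpha> in place.\<close>

lemma nondegenerate_geom:
  assumes K: "simplicial_complex K" and x: "x \<in> geom K"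
  defines "lam \<equiv> \<lambda>\<alpha>. Min ((\<lambda>v. \<alpha> v / x v) ` supp x)"
  shows "nondegenerate (top_of_set (geom K)) x (\<lambda>\<alpha>. 2 * lam \<alpha> - 1)
     (\<lambda>z v. (1 - pull_weight (fst z) (lam (snd z))) * x v + pull_weight (fst z) (lam (snd z)) * snd z v)"
  unfolding nondegenerate_def
proof (intro conjI ballI impI)
  let ?\<sigma> = "supp x"
  have X: "?\<sigma> \<in> K" "x \<in> simplex_points ?\<sigma>" using x mem_geom[OF K] by blast+
  have f: "finite ?\<sigma>" "?\<sigma> \<noteq> {}" using simplicial_complexD[OF K X(1)] by auto
  have xpos: "0 < x v" if "v \<in> ?\<sigma>" for v
    using that simplex_points_nonneg[OF X(2), of v] by (simp add: supp_def)
  have lam_le: "lam \<alpha> * x v \<le> \<alpha> v" if "v \<in> ?\<sigma>" for \<alpha> v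
  proof -
    have "lam \<alpha> \<le> \<alpha> v / x v" unfolding lam_def using f that by (intro Min_le) auto
    then show ?thesis using xpos[OF that] by (simp add: pos_le_divide_eq)
  qed
  have sum_x: "(\<Sum>v\<in>?\<sigma>. x v) = 1" using X(2) by (simp add: simplex_points_def)
  have lam_le_1: "lam \<alpha> \<le> 1" if "\<alpha> \<in> geom K" for \<alpha>
  proof -
    have A: "supp \<alpha> \<in> K" "\<alpha> \<in> simplex_points (supp \<alpha>)" using that mem_geom[OF K] by blast+
    have fa: "finite (supp \<alpha>)" using simplicial_complexD(1)[OF K A(1)] .
    have "lam \<alpha> = (\<Sum>v\<in>?\<sigma>. lam \<alpha> * x v)" using sum_x by (simp flip: sum_distrib_left)
    also have "\<dots> \<le> (\<Sum>v\<in>?\<sigma>. \<alpha> v)" by (intro sum_mono lam_le)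
    also have "\<dots> \<le> (\<Sum>v\<in>?\<sigma> \<union> supp \<alpha>. \<alpha> v)"
      using f fa simplex_points_nonneg[OF A(2)] by (intro sum_mono2) auto
    also have "\<dots> = (\<Sum>v\<in>supp \<alpha>. \<alpha> v)"
      using f fa by (intro sum.mono_neutral_right) (auto simp: supp_def)
    also have "\<dots> = 1" using A(2) by (simp add: simplex_points_def)
    finally show ?thesis .
  qed
  have cl: "continuous_on S lam" for S
    unfolding lam_def using f xpos
    by (intro continuous_on_Min continuous_on_divide continuous_on_apply continuous_on_const) force+
  show "x \<in> topspace (top_of_set (geom K))" using x by simp
  show "continuous_map (top_of_set (geom K)) euclideanreal (\<lambda>\<alpha>. 2 * lam \<alpha> - 1)"
    using cl by (auto intro!: continuous_intros)
  let ?S = "{0..1::real} \<times> geom K"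
  let ?s = "\<lambda>z v. (1 - pull_weight (fst z) (lam (snd z))) * x v + pull_weight (fst z) (lam (snd z)) * snd z v"
  have cw: "continuous_on ?S (\<lambda>z. pull_weight (fst z) (lam (snd z)))"
    by (intro continuous_on_pull_weight continuous_on_fst continuous_on_id
        continuous_on_compose2[OF cl[of UNIV] continuous_on_snd[OF continuous_on_id]]) auto
  have cs: "continuous_on ?S (\<lambda>z. snd z v)" for v
    by (rule continuous_on_compose2[OF continuous_on_apply[of UNIV] continuous_on_snd[OF continuous_on_id]]) auto
  have "continuous_on ?S (\<lambda>z. ?s z v)" for v
    by (intro continuous_on_add continuous_on_mult continuous_on_diff continuous_on_const cw cs)
  then have c: "continuous_on ?S ?s" by (rule continuous_on_coordinatewise_then_product)
  have mem: "?s (t, \<alpha>) \<in> geom K" if t: "0 \<le> t" and a: "\<alpha> \<in> geom K" for t \<alpha>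
  proof (cases "lam \<alpha> \<le> 0")
    case True
    then show ?thesis using a by (simp add: pull_weight)
  next
    case False
    have A: "supp \<alpha> \<in> K" "\<alpha> \<in> simplex_points (supp \<alpha>)" using a mem_geom[OF K] by blast+
    have "v \<in> supp \<alpha>" if "v \<in> ?\<sigma>" for v
    proof -
      have "0 < lam \<alpha> * x v" using False xpos[OF that] by simp
      then show ?thesis using lam_le[OF that, of \<alpha>] by (auto simp: supp_def)
    qed
    then have "x \<in> simplex_points (supp \<alpha>)"
      using simplex_points_mono[of ?\<sigma> "supp \<alpha>"] X(2) simplicial_complexD(1)[OF K A(1)] by blast
    then have "?s (t, \<alpha>) \<in> simplex_points (supp \<alpha>)"
      using simplex_points_segment[of x "supp \<alpha>" \<alpha> "pull_weight t (lam \<alpha>)"] A(2) pull_weight(1)[OF t, of "lam \<alpha>"] by simp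
    then show ?thesis using A(1) by (auto simp: geom_def)
  qed
  show "continuous_map (prod_topology unit_interval (top_of_set (geom K))) (top_of_set (geom K)) ?s"
    using c mem by auto
  show "2 * lam x - 1 = 1"
  proof -
    have "(\<lambda>v. x v / x v) ` ?\<sigma> = {1}" using f(2) xpos by force
    then show ?thesis by (simp add: lam_def)
  qed
  show "?s (t, x) = x" for t by (simp add: algebra_simps)
  fix \<alpha> assume "\<alpha> \<in> topspace (top_of_set (geom K))"
  then have a: "\<alpha> \<in> geom K" by simp
  show "2 * lam \<alpha> - 1 \<le> 1" using lam_le_1[OF a] by simp
  show "?s (0, \<alpha>) = \<alpha>" by (simp add: pull_weight)
  show "?s (1, \<alpha>) = x" if "0 \<le> 2 * lam \<alpha> - 1" using that by (simp add: pull_weight)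
qed

text \<open>The known equivalence with the axes gives no control over \<open>x\<close>.
  Nondegeneracy of both base points and the paths to the pole make it pointed, and in this form it
  passes to the wedge.\<close>

lemma wedge_with_spheres:
  assumes K: "simplicial_complex K" "finite K" and eqv: "geom K homotopy_eqv sphere_axes a" and x: "x \<in> geom K"
  shows "wedge (top_of_set (geom K)) x (wedge_S3 b) None homotopy_equivalent_space wedge_S3 (a + b)"
proof -
  let ?X = "top_of_set (geom K)" and ?Y = "top_of_set (sphere_axes a)" and ?Z = "wedge_S3 b"
  note NT = None_in_wedge_S3[of b] and cZ = compact_wedge_S3[of b] and hZ = Hausdorff_wedge_S3[of b]
  have cX: "compact_space ?X"
    using compact_geom[OF K(2)] simplicial_complexD(1)[OF K(1)] by (simp add: compact_space_subtopology)
  have hX: "Hausdorff_space ?X" by (intro Hausdorff_space_subtopology Hausdorff_fun_euclidean) simp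
  have 1: "wedge ?X x ?Z None homotopy_equivalent_space product_wedge ?X x ?Z None"
    using x NT by (intro homeomorphic_imp_homotopy_equivalent_space wedge_homeomorphic_product_wedge cX hX cZ hZ) auto
  have "pointed_equivalent ?X x ?Y (\<lambda>_. pole)"
    by (rule pointed_equivalent_along_path[OF nondegenerate_geom[OF K(1) x] nondegenerate_sphere_axes eqv])
       (use path_in_sphere_axes in simp)
  then have 2: "product_wedge ?X x ?Z None homotopy_equivalent_space product_wedge ?Y (\<lambda>_. pole) ?Z None"
    using x NT by (intro product_wedge_equivalent) (auto simp: sphere_axes_def pole_in_three_sphere)
  have 3: "product_wedge ?Y (\<lambda>_. pole) ?Z None homotopy_equivalent_space wedge_S3 (a + b)"
    by (intro homeomorphic_imp_homotopy_equivalent_space product_wedge_axes_homeomorphic)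
  show ?thesis by (rule homotopy_eqv_trans[OF 1 homotopy_eqv_trans[OF 2 3]])
qed

section \<open>The complex of two slices\<close>

text \<open>Replaces distances by sizes of unions: two sets of size \<open>q\<close> are at distance
  at most \<open>2\<close> if and only if their union has at most \<open>q + 1\<close>
  elements.\<close>

lemma card_sym_diff_Un:
  assumes "finite A" "finite B"
  shows "card (sym_diff A B) + card A + card B = 2 * card (A \<union> B)"
proof -
  have "card (sym_diff A B) = card (A - B) + card (B - A)"
    using assms by (intro card_Un_disjoint) auto
  moreover have "card (A \<union> B) = card A + card (B - A)" "card (A \<union> B) = card B + card (A - B)"
    using assms card_Un_disjoint[of A "B - A"] card_Un_disjoint[of B "A - B"] by (auto simp: Un_commute)
  ultimately show ?thesis by simp
qed

lemma card_Un_ge_Suc: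
  assumes "finite A" "finite B" "card A = q" "card B = q" "A \<noteq> B"
  shows "Suc q \<le> card (A \<union> B)"
proof -
  have "\<not> B \<subseteq> A" using assms card_subset_eq[of A B] by auto
  then have "A \<subset> A \<union> B" by auto
  then show ?thesis using psubset_card_mono[of "A \<union> B" A] assms by simp
qed

text \<open>The two kinds of cliques in the Johnson graph: sets through a common
  \<open>(q - 1)\<close>-set and sets inside a common \<open>(q + 1)\<close>-set. If
  \<open>C\<close> has an element \<open>y\<close> outside \<open>A \<union> B\<close>, closeness
  forces \<open>A \<union> C = insert y A\<close> and \<open>B \<union> C = insert y B\<close>;
  hence \<open>C\<close> lies in \<open>insert y (A \<inter> B)\<close>, and the sizes give
  equality.\<close>

lemma exchange_dichotomy:
  assumes fin: "finite A" "finite B" "finite C" and card: "card A = q" "card B = q" "card C = q"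
    and AC: "card (A \<union> C) \<le> Suc q" and BC: "card (B \<union> C) \<le> Suc q" and ne: "A \<noteq> B"
  shows "A \<inter> B \<subseteq> C \<or> C \<subseteq> A \<union> B"
proof (rule disjCI)
  assume "\<not> C \<subseteq> A \<union> B"
  then obtain y where y: "y \<in> C" "y \<notin> A" "y \<notin> B" by blast
  have "insert y A = A \<union> C"
    using AC y fin card by (intro card_seteq) auto
  moreover have "insert y B = B \<union> C"
    using BC y fin card by (intro card_seteq) auto
  ultimately have sub: "C \<subseteq> insert y (A \<inter> B)" by blast
  have "card (A \<inter> B) < q"
  proof -
    have "A \<inter> B \<subset> A" using ne fin card card_subset_eq[of B A] by auto
    then show ?thesis using psubset_card_mono[of A "A \<inter> B"] fin card by simp
  qed
  then have "card (insert y (A \<inter> B)) \<le> card C" using y fin card by simp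
  then have "C = insert y (A \<inter> B)" using sub fin by (intro card_seteq) auto
  then show "A \<inter> B \<subseteq> C" by blast
qed

lemma facet_eq_Diff:
  assumes "finite B" "T \<subseteq> B" "card B = Suc (card T)"
  obtains x where "x \<in> B" "T = B - {x}"
proof -
  have "card (B - T) = 1" using assms by (simp add: card_Diff_subset finite_subset)
  then obtain x where x: "B - T = {x}" using card_1_singletonE by blast
  then have "x \<in> B" "T = B - {x}" using assms(2) by blast+
  then show ?thesis using that by blast
qed

text \<open>Sets of size \<open>q\<close> inside \<open>B\<close> correspond to the single elements
  they omit, and an element is omitted by some member if and only if it is outside the intersection.
  A family of facets is therefore recovered from its union and its intersection.\<close>

lemma facets:
  assumes B: "finite B" "card B = Suc q" and \<sigma>: "\<And>T. T \<in> \<sigma> \<Longrightarrow> T \<subseteq> B \<and> card T = q" and ne: "\<sigma> \<noteq> {}"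
  shows "\<Inter>\<sigma> \<subseteq> B" "\<sigma> = (\<lambda>x. B - {x}) ` (B - \<Inter>\<sigma>)" "card \<sigma> + card (\<Inter>\<sigma>) = Suc q"
proof -
  show sub: "\<Inter>\<sigma> \<subseteq> B" using \<sigma> ne by blast
  show eq: "\<sigma> = (\<lambda>x. B - {x}) ` (B - \<Inter>\<sigma>)"
  proof
    show "\<sigma> \<subseteq> (\<lambda>x. B - {x}) ` (B - \<Inter>\<sigma>)"
    proof
      fix T assume T: "T \<in> \<sigma>"
      have "T \<subseteq> B" "card B = Suc (card T)" using \<sigma>[OF T] B by auto
      then obtain x where "x \<in> B" "T = B - {x}" using facet_eq_Diff[OF B(1)] by metis
      then show "T \<in> (\<lambda>x. B - {x}) ` (B - \<Inter>\<sigma>)" using T by blast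
    qed
    show "(\<lambda>x. B - {x}) ` (B - \<Inter>\<sigma>) \<subseteq> \<sigma>"
    proof (rule image_subsetI)
      fix x assume x: "x \<in> B - \<Inter>\<sigma>"
      then obtain T where T: "T \<in> \<sigma>" "x \<notin> T" by blast
      have "T \<subseteq> B" "card B = Suc (card T)" using \<sigma>[OF T(1)] B by auto
      then obtain y where "y \<in> B" "T = B - {y}" using facet_eq_Diff[OF B(1)] by metis
      then have "T = B - {x}" using T(2) x by blast
      then show "B - {x} \<in> \<sigma>" using T(1) by simp
    qed
  qed
  have "inj_on (\<lambda>x. B - {x}) (B - \<Inter>\<sigma>)" by (auto simp: inj_on_def)
  then have "card \<sigma> = card (B - \<Inter>\<sigma>)" using eq card_image by metis
  then show "card \<sigma> + card (\<Inter>\<sigma>) = Suc q"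
    using sub B card_mono[OF B(1) sub] by (simp add: card_Diff_subset finite_subset)
qed

lemma Union_facets:
  assumes "T \<in> \<sigma>" "T' \<in> \<sigma>" "T \<noteq> T'" and B: "finite B" "card B = Suc q"
    and \<sigma>: "\<And>T. T \<in> \<sigma> \<Longrightarrow> T \<subseteq> B \<and> card T = q"
  shows "\<Union>\<sigma> = B"
proof -
  have "finite T" "finite T'" using \<sigma>[OF assms(1)] \<sigma>[OF assms(2)] B(1) finite_subset by blast+
  then have "Suc q \<le> card (T \<union> T')"
    using \<sigma>[OF assms(1)] \<sigma>[OF assms(2)] assms(3) by (intro card_Un_ge_Suc) auto
  then have "T \<union> T' = B" using \<sigma>[OF assms(1)] \<sigma>[OF assms(2)] B by (intro card_seteq) auto
  then show ?thesis using assms(1,2) \<sigma> by blast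
qed

lemma card_3E:
  assumes "card S \<ge> 3"
  obtains a b c where "a \<in> S" "b \<in> S" "c \<in> S" "a \<noteq> b" "a \<noteq> c" "b \<noteq> c"
proof -
  obtain T where "T \<subseteq> S" "card T = 3" using assms obtain_subset_with_card_n by metis
  then obtain a b c where "T = {a, b, c}" "a \<noteq> b" "a \<noteq> c" "b \<noteq> c" using card_3_iff[of T] by auto
  then show ?thesis using that \<open>T \<subseteq> S\<close> by blast
qed

section \<open>Simplices of the complex and their combinatorics\<close>

locale two_slices =
  fixes m n :: nat
  assumes n_pos: "1 \<le> n" and n_less: "n + 1 < m"
begin

abbreviation Lo where "Lo \<equiv> slice m n"
abbreviation Hi where "Hi \<equiv> slice m (n + 2)"

lemma LoD: "N \<in> Lo \<Longrightarrow> N \<subseteq> {1..m} \<and> card N = n \<and> finite N"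
  by (auto simp: slice_def intro: finite_subset)

lemma HiD: "T \<in> Hi \<Longrightarrow> T \<subseteq> {1..m} \<and> card T = Suc (Suc n) \<and> finite T"
  by (auto simp: slice_def intro: finite_subset)

lemma LoI: "N \<subseteq> {1..m} \<Longrightarrow> card N = n \<Longrightarrow> N \<in> Lo" by (simp add: slice_def)

lemma HiI: "T \<subseteq> {1..m} \<Longrightarrow> card T = Suc (Suc n) \<Longrightarrow> T \<in> Hi" by (simp add: slice_def)

lemma Lo_Hi: "N \<in> Lo \<Longrightarrow> N \<notin> Hi" by (simp add: slice_def)

definition vr :: "nat set set set" where
  "vr = vietoris_rips (symdiff_metric (Lo \<union> Hi)) 2"

text \<open>A low and a high set are always at distance at least \<open>2\<close>, with equality
  exactly for inclusion. Within one slice, distance at most \<open>2\<close> means that the union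
  exceeds each of the sets by at most one element.\<close>

lemma mem_vr:
  "\<rho> \<in> vr \<longleftrightarrow> finite \<rho> \<and> \<rho> \<noteq> {} \<and> \<rho> \<subseteq> Lo \<union> Hi \<and>
     (\<forall>A\<in>\<rho>. \<forall>B\<in>\<rho>. A \<in> Lo \<longrightarrow> B \<in> Lo \<longrightarrow> card (A \<union> B) \<le> Suc n) \<and>
     (\<forall>A\<in>\<rho>. \<forall>B\<in>\<rho>. A \<in> Hi \<longrightarrow> B \<in> Hi \<longrightarrow> card (A \<union> B) \<le> Suc (Suc (Suc n))) \<and>
     (\<forall>A\<in>\<rho>. \<forall>B\<in>\<rho>. A \<in> Lo \<longrightarrow> B \<in> Hi \<longrightarrow> A \<subseteq> B)"
proof -
  have fin: "finite A" if "A \<in> Lo \<union> Hi" for A using that LoD HiD by blast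
  have LL: "card (sym_diff A B) \<le> 2 \<longleftrightarrow> card (A \<union> B) \<le> Suc n" if "A \<in> Lo" "B \<in> Lo" for A B
    using card_sym_diff_Un[of A B] LoD[OF that(1)] LoD[OF that(2)] by auto
  have HH: "card (sym_diff A B) \<le> 2 \<longleftrightarrow> card (A \<union> B) \<le> Suc (Suc (Suc n))" if "A \<in> Hi" "B \<in> Hi" for A B
    using card_sym_diff_Un[of A B] HiD[OF that(1)] HiD[OF that(2)] by auto
  have LH: "card (sym_diff A B) \<le> 2 \<longleftrightarrow> A \<subseteq> B" if "A \<in> Lo" "B \<in> Hi" for A B
  proof -
    have D: "finite A" "card A = n" "finite B" "card B = Suc (Suc n)" using LoD[OF that(1)] HiD[OF that(2)] by auto
    have "card (sym_diff A B) \<le> 2 \<longleftrightarrow> card (A \<union> B) \<le> card B"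
      using card_sym_diff_Un[OF D(1,3)] D by auto
    also have "\<dots> \<longleftrightarrow> A \<union> B = B" using card_seteq[of "A \<union> B" B] D by auto
    finally show ?thesis by blast
  qed
  have sym: "sym_diff A B = sym_diff B A" for A B :: "nat set" by blast
  have dist: "(mdist (symdiff_metric (Lo \<union> Hi)) A B \<le> 2) \<longleftrightarrow> card (sym_diff A B) \<le> 2" for A B
    using mdist_symdiff_metric[of "Lo \<union> Hi" A B, OF fin] by simp
  have space: "mspace (symdiff_metric (Lo \<union> Hi)) = Lo \<union> Hi"
    using mspace_symdiff_metric[of "Lo \<union> Hi", OF fin] by simp
  have pair: "(\<forall>A\<in>\<rho>. \<forall>B\<in>\<rho>. card (sym_diff A B) \<le> 2) \<longleftrightarrow>
     (\<forall>A\<in>\<rho>. \<forall>B\<in>\<rho>. A \<in> Lo \<longrightarrow> B \<in> Lo \<longrightarrow> card (A \<union> B) \<le> Suc n) \<and>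
     (\<forall>A\<in>\<rho>. \<forall>B\<in>\<rho>. A \<in> Hi \<longrightarrow> B \<in> Hi \<longrightarrow> card (A \<union> B) \<le> Suc (Suc (Suc n))) \<and>
     (\<forall>A\<in>\<rho>. \<forall>B\<in>\<rho>. A \<in> Lo \<longrightarrow> B \<in> Hi \<longrightarrow> A \<subseteq> B)" (is "?L \<longleftrightarrow> ?R") if sub: "\<rho> \<subseteq> Lo \<union> Hi"
  proof
    assume L: ?L
    show ?R
    proof (intro conjI ballI impI)
      fix A B assume AB: "A \<in> \<rho>" "B \<in> \<rho>"
      have d: "card (sym_diff A B) \<le> 2" using L AB by blast
      show "card (A \<union> B) \<le> Suc n" if "A \<in> Lo" "B \<in> Lo" using LL[OF that] d by simp
      show "card (A \<union> B) \<le> Suc (Suc (Suc n))" if "A \<in> Hi" "B \<in> Hi" using HH[OF that] d by simp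
      show "A \<subseteq> B" if "A \<in> Lo" "B \<in> Hi" using LH[OF that] d by simp
    qed
  next
    assume R: ?R
    have R1: "A \<in> \<rho> \<Longrightarrow> B \<in> \<rho> \<Longrightarrow> A \<in> Lo \<Longrightarrow> B \<in> Lo \<Longrightarrow> card (A \<union> B) \<le> Suc n" for A B
      using conjunct1[OF R] by blast
    have R2: "A \<in> \<rho> \<Longrightarrow> B \<in> \<rho> \<Longrightarrow> A \<in> Hi \<Longrightarrow> B \<in> Hi \<Longrightarrow> card (A \<union> B) \<le> Suc (Suc (Suc n))" for A B
      using conjunct1[OF conjunct2[OF R]] by blast
    have R3: "A \<in> \<rho> \<Longrightarrow> B \<in> \<rho> \<Longrightarrow> A \<in> Lo \<Longrightarrow> B \<in> Hi \<Longrightarrow> A \<subseteq> B" for A B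
      using conjunct2[OF conjunct2[OF R]] by blast
    show ?L
    proof (intro ballI)
      fix A B assume AB: "A \<in> \<rho>" "B \<in> \<rho>"
      then consider "A \<in> Lo" "B \<in> Lo" | "A \<in> Hi" "B \<in> Hi" | "A \<in> Lo" "B \<in> Hi" | "A \<in> Hi" "B \<in> Lo"
        using sub by blast
      then show "card (sym_diff A B) \<le> 2"
      proof cases
        case 1
        then show ?thesis using R1[OF AB] LL[of A B] by simp
      next
        case 2
        then show ?thesis using R2[OF AB] HH[of A B] by simp
      next
        case 3
        then show ?thesis using R3[OF AB] LH[of A B] by simp
      next
        case 4
        then have "card (sym_diff B A) \<le> 2" using R3[OF AB(2,1)] LH[of B A] by simp
        then show ?thesis by (simp only: sym)
      qed
    qed
  qed
  show ?thesis
  proof (cases "\<rho> \<subseteq> Lo \<union> Hi")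
    case True
    show ?thesis unfolding vr_def vietoris_rips_def mem_Collect_eq space dist pair[OF True]
      by (intro iffI; elim conjE; intro conjI; assumption)
  next
    case False
    then show ?thesis unfolding vr_def vietoris_rips_def mem_Collect_eq space by (simp only: simp_thms)
  qed
qed

lemma vrI:
  assumes "finite \<rho>" "\<rho> \<noteq> {}" "\<rho> \<subseteq> Lo \<union> Hi"
    "\<And>A B. A \<in> \<rho> \<Longrightarrow> B \<in> \<rho> \<Longrightarrow> A \<in> Lo \<Longrightarrow> B \<in> Lo \<Longrightarrow> card (A \<union> B) \<le> Suc n"
    "\<And>A B. A \<in> \<rho> \<Longrightarrow> B \<in> \<rho> \<Longrightarrow> A \<in> Hi \<Longrightarrow> B \<in> Hi \<Longrightarrow> card (A \<union> B) \<le> Suc (Suc (Suc n))"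
    "\<And>A B. A \<in> \<rho> \<Longrightarrow> B \<in> \<rho> \<Longrightarrow> A \<in> Lo \<Longrightarrow> B \<in> Hi \<Longrightarrow> A \<subseteq> B"
  shows "\<rho> \<in> vr"
  unfolding mem_vr by (intro conjI ballI impI assms)

lemma vrD:
  assumes "\<rho> \<in> vr"
  shows "finite \<rho>" "\<rho> \<noteq> {}" "\<rho> \<subseteq> Lo \<union> Hi"
    "\<And>A B. A \<in> \<rho> \<Longrightarrow> B \<in> \<rho> \<Longrightarrow> A \<in> Lo \<Longrightarrow> B \<in> Lo \<Longrightarrow> card (A \<union> B) \<le> Suc n"
    "\<And>A B. A \<in> \<rho> \<Longrightarrow> B \<in> \<rho> \<Longrightarrow> A \<in> Hi \<Longrightarrow> B \<in> Hi \<Longrightarrow> card (A \<union> B) \<le> Suc (Suc (Suc n))"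
    "\<And>A B. A \<in> \<rho> \<Longrightarrow> B \<in> \<rho> \<Longrightarrow> A \<in> Lo \<Longrightarrow> B \<in> Hi \<Longrightarrow> A \<subseteq> B"
proof -
  note * = assms[unfolded mem_vr]
  note c1 = conjunct2[OF *] note c2 = conjunct2[OF c1] note c3 = conjunct2[OF c2] note c4 = conjunct2[OF c3]
  show "finite \<rho>" by (rule conjunct1[OF *])
  show "\<rho> \<noteq> {}" by (rule conjunct1[OF c1])
  show "\<rho> \<subseteq> Lo \<union> Hi" by (rule conjunct1[OF c2])
  show "card (A \<union> B) \<le> Suc n" if "A \<in> \<rho>" "B \<in> \<rho>" "A \<in> Lo" "B \<in> Lo" for A B
    using conjunct1[OF c3, rule_format, OF that] .
  show "card (A \<union> B) \<le> Suc (Suc (Suc n))" if "A \<in> \<rho>" "B \<in> \<rho>" "A \<in> Hi" "B \<in> Hi" for A B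
    using conjunct1[OF c4, rule_format, OF that] .
  show "A \<subseteq> B" if "A \<in> \<rho>" "B \<in> \<rho>" "A \<in> Lo" "B \<in> Hi" for A B
    using conjunct2[OF c4, rule_format, OF that] .
qed

lemma vr_subset:
  assumes s: "\<sigma> \<in> vr" and r: "\<rho> \<subseteq> \<sigma>" "\<rho> \<noteq> {}" shows "\<rho> \<in> vr"
proof (rule vrI)
  show "finite \<rho>" "\<rho> \<noteq> {}" "\<rho> \<subseteq> Lo \<union> Hi" using vrD(1-3)[OF s] r finite_subset by auto
next
  fix A B assume "A \<in> \<rho>" "B \<in> \<rho>"
  then have AB: "A \<in> \<sigma>" "B \<in> \<sigma>" using r by auto
  show "card (A \<union> B) \<le> Suc n" if "A \<in> Lo" "B \<in> Lo" by (rule vrD(4)[OF s AB that])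
  show "card (A \<union> B) \<le> Suc (Suc (Suc n))" if "A \<in> Hi" "B \<in> Hi" by (rule vrD(5)[OF s AB that])
  show "A \<subseteq> B" if "A \<in> Lo" "B \<in> Hi" by (rule vrD(6)[OF s AB that])
qed

lemma complex_vr: "simplicial_complex vr"
  unfolding simplicial_complex_def
proof (intro ballI conjI allI impI)
  fix \<sigma> assume s: "\<sigma> \<in> vr"
  show "finite \<sigma>" "\<sigma> \<noteq> {}" using vrD[OF s] by auto
  fix \<rho> assume "\<rho> \<subseteq> \<sigma> \<and> \<rho> \<noteq> {}"
  then show "\<rho> \<in> vr" using vr_subset[OF s] by blast
qed

lemma finite_vr: "finite vr"
proof -
  have "vr \<subseteq> Pow (Lo \<union> Hi)" by (intro subsetI PowI vrD(3))
  then show ?thesis by (rule finite_subset) (simp add: finite_slice)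
qed

lemma insert_Hi_vr:
  assumes \<rho>: "\<rho> \<in> vr" and T: "T \<in> Hi" and NT: "\<And>N. N \<in> \<rho> \<Longrightarrow> N \<in> Lo \<Longrightarrow> N \<subseteq> T"
    and TT: "\<And>T'. T' \<in> \<rho> \<Longrightarrow> T' \<in> Hi \<Longrightarrow> card (T \<union> T') \<le> Suc (Suc (Suc n))"
  shows "insert T \<rho> \<in> vr"
proof (rule vrI)
  note D = vrD[OF \<rho>]
  have nL: "T \<notin> Lo" using Lo_Hi T by blast
  show "finite (insert T \<rho>)" "insert T \<rho> \<noteq> {}" "insert T \<rho> \<subseteq> Lo \<union> Hi" using D(1,3) T by auto
  show "card (A \<union> B) \<le> Suc n" if "A \<in> insert T \<rho>" "B \<in> insert T \<rho>" "A \<in> Lo" "B \<in> Lo" for A B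
  proof -
    have "A \<in> \<rho>" "B \<in> \<rho>" using that nL by auto
    then show ?thesis using D(4) that(3,4) by simp
  qed
  show "card (A \<union> B) \<le> Suc (Suc (Suc n))" if "A \<in> insert T \<rho>" "B \<in> insert T \<rho>" "A \<in> Hi" "B \<in> Hi" for A B
  proof (cases "A = T"; cases "B = T")
    assume "A = T" "B = T" then show ?thesis using HiD[OF T] by simp
  next
    assume "A = T" "B \<noteq> T" then show ?thesis using TT that by simp
  next
    assume "A \<noteq> T" "B = T" then show ?thesis using TT[of A] that by (simp add: Un_commute)
  next
    assume "A \<noteq> T" "B \<noteq> T" then show ?thesis using D(5) that by simp
  qed
  show "A \<subseteq> B" if "A \<in> insert T \<rho>" "B \<in> insert T \<rho>" "A \<in> Lo" "B \<in> Hi" for A B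
  proof -
    have A: "A \<in> \<rho>" using that nL by auto
    show ?thesis using NT[OF A that(3)] D(6)[OF A _ that(3,4)] that(2) by auto
  qed
qed

lemma insert_Lo_vr:
  assumes \<rho>: "\<rho> \<in> vr" and N: "N \<in> Lo" and NT: "\<And>T. T \<in> \<rho> \<Longrightarrow> T \<in> Hi \<Longrightarrow> N \<subseteq> T"
    and NN: "\<And>N'. N' \<in> \<rho> \<Longrightarrow> N' \<in> Lo \<Longrightarrow> card (N \<union> N') \<le> Suc n"
  shows "insert N \<rho> \<in> vr"
proof (rule vrI)
  note D = vrD[OF \<rho>]
  have nH: "N \<notin> Hi" using Lo_Hi N by blast
  show "finite (insert N \<rho>)" "insert N \<rho> \<noteq> {}" "insert N \<rho> \<subseteq> Lo \<union> Hi" using D(1,3) N by auto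
  show "card (A \<union> B) \<le> Suc (Suc (Suc n))" if "A \<in> insert N \<rho>" "B \<in> insert N \<rho>" "A \<in> Hi" "B \<in> Hi" for A B
  proof -
    have "A \<in> \<rho>" "B \<in> \<rho>" using that nH by auto
    then show ?thesis using D(5) that(3,4) by simp
  qed
  show "card (A \<union> B) \<le> Suc n" if "A \<in> insert N \<rho>" "B \<in> insert N \<rho>" "A \<in> Lo" "B \<in> Lo" for A B
  proof (cases "A = N"; cases "B = N")
    assume "A = N" "B = N" then show ?thesis using LoD[OF N] by simp
  next
    assume "A = N" "B \<noteq> N" then show ?thesis using NN that by simp
  next
    assume "A \<noteq> N" "B = N" then show ?thesis using NN[of A] that by (simp add: Un_commute)
  next
    assume "A \<noteq> N" "B \<noteq> N" then show ?thesis using D(4) that by simp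
  qed
  show "A \<subseteq> B" if "A \<in> insert N \<rho>" "B \<in> insert N \<rho>" "A \<in> Lo" "B \<in> Hi" for A B
  proof -
    have B: "B \<in> \<rho>" using that nH by auto
    show ?thesis using NT[OF B that(4)] D(6)[OF _ B that(3,4)] that(1) by auto
  qed
qed

lemma Hi_facets:
  assumes "\<sigma> \<subseteq> Hi" "card (\<Union>\<sigma>) = n + 3" "\<sigma> \<noteq> {}"
  shows "finite (\<Union>\<sigma>)" "\<And>T. T \<in> \<sigma> \<Longrightarrow> T \<subseteq> \<Union>\<sigma> \<and> card T = Suc (Suc n)"
    "\<Inter>\<sigma> \<subseteq> \<Union>\<sigma>" "\<sigma> = (\<lambda>x. \<Union>\<sigma> - {x}) ` (\<Union>\<sigma> - \<Inter>\<sigma>)" "card \<sigma> + card (\<Inter>\<sigma>) = n + 3"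
proof -
  show f: "finite (\<Union>\<sigma>)" using assms(2) card.infinite by fastforce
  show s: "\<And>T. T \<in> \<sigma> \<Longrightarrow> T \<subseteq> \<Union>\<sigma> \<and> card T = Suc (Suc n)" using assms(1) HiD by blast
  have c: "card (\<Union>\<sigma>) = Suc (Suc (Suc n))" using assms(2) by simp
  show "\<Inter>\<sigma> \<subseteq> \<Union>\<sigma>" "\<sigma> = (\<lambda>x. \<Union>\<sigma> - {x}) ` (\<Union>\<sigma> - \<Inter>\<sigma>)"
    using facets[OF f c s assms(3)] by blast+
  show "card \<sigma> + card (\<Inter>\<sigma>) = n + 3" using facets(3)[OF f c s assms(3)] by simp
qed

text \<open>If \<open>T\<close> were not inside the union, the dichotomy would put the pairwise
  intersections of three members of \<sigma> into \<open>T\<close>. Three facets omit three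
  different elements, so these intersections cover the union, which is larger than
  \<open>T\<close>.\<close>

lemma Hi_in_Union:
  assumes \<rho>: "\<rho> \<in> vr" and \<sigma>: "\<sigma> \<subseteq> Hi" "\<sigma> \<subseteq> \<rho>" "card \<sigma> \<ge> 3" "card (\<Union>\<sigma>) = n + 3"
    and T: "T \<in> \<rho>" "T \<in> Hi"
  shows "T \<subseteq> \<Union>\<sigma>"
proof (rule ccontr)
  assume n: "\<not> T \<subseteq> \<Union>\<sigma>"
  have ne: "\<sigma> \<noteq> {}" using \<sigma>(3) by auto
  note F = Hi_facets[OF \<sigma>(1,4) ne]
  obtain a b c where abc: "a \<in> \<sigma>" "b \<in> \<sigma>" "c \<in> \<sigma>" "a \<noteq> b" "a \<noteq> c" "b \<noteq> c"
    using card_3E[OF \<sigma>(3)] by metis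
  have d: "P \<inter> Q \<subseteq> T" if "P \<in> \<sigma>" "Q \<in> \<sigma>" "P \<noteq> Q" for P Q
  proof -
    have PQ: "P \<in> \<rho>" "P \<in> Hi" "Q \<in> \<rho>" "Q \<in> Hi" using that \<sigma> by auto
    have "P \<inter> Q \<subseteq> T \<or> T \<subseteq> P \<union> Q"
      using HiD[OF PQ(2)] HiD[OF PQ(4)] HiD[OF T(2)] vrD(5)[OF \<rho> PQ(1) T(1) PQ(2) T(2)]
        vrD(5)[OF \<rho> PQ(3) T(1) PQ(4) T(2)] that(3)
      by (intro exchange_dichotomy[where q = "Suc (Suc n)"]) simp_all
    then show ?thesis using n that(1,2) by blast
  qed
  obtain x where x: "a = \<Union>\<sigma> - {x}" using abc(1) F(4) by blast
  obtain y where y: "b = \<Union>\<sigma> - {y}" using abc(2) F(4) by blast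
  obtain z where z: "c = \<Union>\<sigma> - {z}" using abc(3) F(4) by blast
  have "x \<noteq> y" "x \<noteq> z" "y \<noteq> z" using abc(4-6) x y z by auto
  then have "\<Union>\<sigma> \<subseteq> (a \<inter> b) \<union> (a \<inter> c) \<union> (b \<inter> c)" using x y z by blast
  then have "\<Union>\<sigma> \<subseteq> T" using d abc by blast
  then have "card (\<Union>\<sigma>) \<le> card T" using HiD[OF T(2)] by (intro card_mono) auto
  then show False using \<sigma>(4) HiD[OF T(2)] by simp
qed

lemma Lo_in_Inter:
  assumes "\<rho> \<in> vr" "\<sigma> \<subseteq> Hi" "\<sigma> \<subseteq> \<rho>" "N \<in> \<rho>" "N \<in> Lo" shows "N \<subseteq> \<Inter>\<sigma>"
proof (rule Inter_greatest)
  fix T assume "T \<in> \<sigma>"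
  then have "T \<in> \<rho>" "T \<in> Hi" using assms(2,3) by auto
  then show "N \<subseteq> T" by (intro vrD(6)[OF assms(1,4) _ assms(5)])
qed

text \<open>As the union is too large for a common \<open>(n + 1)\<close>-set, the dichotomy leaves
  only the other kind of clique: a core of size \<open>n - 1\<close> with one of three further
  elements added. A low set not containing the core would lie in all three pairwise unions, and the
  intersection of these is the core, which is too small.\<close>

lemma Lo_triple:
  assumes \<rho>: "\<rho> \<in> vr" and \<sigma>: "\<sigma> \<subseteq> Lo" "\<sigma> \<subseteq> \<rho>" "card \<sigma> = 3" "card (\<Union>\<sigma>) = n + 2"
  shows "card (\<Inter>\<sigma>) = n - 1" "\<And>N. N \<in> \<rho> \<Longrightarrow> N \<in> Lo \<Longrightarrow> \<Inter>\<sigma> \<subseteq> N"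
    "\<And>N. N \<in> Lo \<Longrightarrow> \<Inter>\<sigma> \<subseteq> N \<Longrightarrow> N \<subseteq> \<Union>\<sigma> \<Longrightarrow> N \<in> \<sigma>" "\<Inter>\<sigma> \<subseteq> \<Union>\<sigma>"
    "\<sigma> = (\<lambda>x. insert x (\<Inter>\<sigma>)) ` (\<Union>\<sigma> - \<Inter>\<sigma>)"
proof -
  obtain a b c where abc: "\<sigma> = {a, b, c}" "a \<noteq> b" "a \<noteq> c" "b \<noteq> c" using \<sigma>(3) card_3_iff[of \<sigma>] by auto
  have mem: "a \<in> Lo" "b \<in> Lo" "c \<in> Lo" "a \<in> \<rho>" "b \<in> \<rho>" "c \<in> \<rho>" using abc \<sigma> by auto
  note D = LoD[OF mem(1)] LoD[OF mem(2)] LoD[OF mem(3)]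
  have dich: "P \<inter> Q \<subseteq> N \<or> N \<subseteq> P \<union> Q"
    if "P \<in> \<sigma>" "Q \<in> \<sigma>" "P \<noteq> Q" "N \<in> \<rho>" "N \<in> Lo" for P Q N
  proof -
    have PQ: "P \<in> \<rho>" "P \<in> Lo" "Q \<in> \<rho>" "Q \<in> Lo" using that \<sigma> by auto
    show ?thesis using LoD[OF PQ(2)] LoD[OF PQ(4)] LoD[OF that(5)] that(3)
        vrD(4)[OF \<rho> PQ(1) that(4) PQ(2) that(5)] vrD(4)[OF \<rho> PQ(3) that(4) PQ(4) that(5)]
      by (intro exchange_dichotomy[where q = n]) simp_all
  qed
  have U: "\<Union>\<sigma> = a \<union> b \<union> c" "\<Inter>\<sigma> = a \<inter> b \<inter> c" using abc by auto
  have big: "\<not> R \<subseteq> P \<union> Q" if "{P, Q, R} = \<sigma>" "P \<in> \<sigma>" "Q \<in> \<sigma>" for P Q R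
  proof
    assume "R \<subseteq> P \<union> Q"
    then have "\<Union>\<sigma> = P \<union> Q" using that by blast
    moreover have "P \<in> \<rho>" "Q \<in> \<rho>" "P \<in> Lo" "Q \<in> Lo" using that \<sigma> by auto
    then have "card (P \<union> Q) \<le> Suc n" by (rule vrD(4)[OF \<rho>])
    ultimately show False using \<sigma>(4) by simp
  qed
  have m: "a \<in> \<sigma>" "b \<in> \<sigma>" "c \<in> \<sigma>" using abc(1) by simp_all
  have perm: "{a, b, c} = \<sigma>" "{a, c, b} = \<sigma>" "{b, c, a} = \<sigma>" using abc(1) by auto
  have i1: "a \<inter> b \<subseteq> c" using dich[OF m(1,2) abc(2) mem(6,3)] big[OF perm(1) m(1,2)] by simp
  have i2: "a \<inter> c \<subseteq> b" using dich[OF m(1,3) abc(3) mem(5,2)] big[OF perm(2) m(1,3)] by simp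
  have i3: "b \<inter> c \<subseteq> a" using dich[OF m(2,3) abc(4) mem(4,1)] big[OF perm(3) m(2,3)] by simp
  have Iab: "\<Inter>\<sigma> = a \<inter> b" using U i1 by blast
  have "card (a \<union> b) = Suc n"
    using vrD(4)[OF \<rho> mem(4,5,1,2)] card_Un_ge_Suc[of a b n] D abc(2) by simp
  then show cI: "card (\<Inter>\<sigma>) = n - 1" using card_Un_Int[of a b] D Iab by simp
  show sub: "\<Inter>\<sigma> \<subseteq> \<Union>\<sigma>" using U by blast
  show "\<Inter>\<sigma> \<subseteq> N" if N: "N \<in> \<rho>" "N \<in> Lo" for N
  proof (rule ccontr)
    assume n: "\<not> \<Inter>\<sigma> \<subseteq> N"
    have Iac: "\<Inter>\<sigma> = a \<inter> c" and Ibc: "\<Inter>\<sigma> = b \<inter> c" using U i1 i2 i3 by blast+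
    have "N \<subseteq> a \<union> b" using dich[OF m(1,2) abc(2) N] n Iab by simp
    moreover have "N \<subseteq> a \<union> c" using dich[OF m(1,3) abc(3) N] n Iac by simp
    moreover have "N \<subseteq> b \<union> c" using dich[OF m(2,3) abc(4) N] n Ibc by simp
    ultimately have "N \<subseteq> \<Inter>\<sigma>" unfolding U using i1 i2 i3 by blast
    then have "card N \<le> card (\<Inter>\<sigma>)" using D U by (intro card_mono) auto
    then show False using cI LoD[OF N(2)] n_pos by simp
  qed
  have fI: "finite (\<Inter>\<sigma>)" and fU: "finite (\<Union>\<sigma>)" using D U by auto
  have ins: "\<exists>x. x \<in> N \<and> x \<notin> \<Inter>\<sigma> \<and> N = insert x (\<Inter>\<sigma>)" if "N \<in> Lo" "\<Inter>\<sigma> \<subseteq> N" for N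
  proof -
    have "card (N - \<Inter>\<sigma>) = 1" using LoD[OF that(1)] cI that(2) fI n_pos by (simp add: card_Diff_subset)
    then obtain x where x: "N - \<Inter>\<sigma> = {x}" by (rule card_1_singletonE)
    have "N = (N - \<Inter>\<sigma>) \<union> \<Inter>\<sigma>" using Un_Diff_cancel2[of N "\<Inter>\<sigma>"] that(2) by (simp add: sup_absorb1)
    then have "N = insert x (\<Inter>\<sigma>)" unfolding x by simp
    moreover have "x \<in> N - \<Inter>\<sigma>" unfolding x by simp
    ultimately show ?thesis by (intro exI[of _ x]) (simp only: DiffE simp_thms Diff_iff)
  qed
  let ?f = "\<lambda>x. insert x (\<Inter>\<sigma>)"
  have s1: "\<sigma> \<subseteq> ?f ` (\<Union>\<sigma> - \<Inter>\<sigma>)"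
  proof
    fix N assume N: "N \<in> \<sigma>"
    then have "N \<in> Lo" "\<Inter>\<sigma> \<subseteq> N" using \<sigma> by auto
    then obtain x where "x \<in> N" "x \<notin> \<Inter>\<sigma>" "N = insert x (\<Inter>\<sigma>)" using ins by blast
    then show "N \<in> ?f ` (\<Union>\<sigma> - \<Inter>\<sigma>)" using N by (intro image_eqI[of _ _ x]) auto
  qed
  have "card (\<Union>\<sigma> - \<Inter>\<sigma>) = 3" using \<sigma>(4) cI sub fI n_pos by (simp add: card_Diff_subset)
  then have "card (?f ` (\<Union>\<sigma> - \<Inter>\<sigma>)) \<le> card \<sigma>" using \<sigma>(3) card_image_le[of "\<Union>\<sigma> - \<Inter>\<sigma>" ?f] fU by simp
  then show eq: "\<sigma> = ?f ` (\<Union>\<sigma> - \<Inter>\<sigma>)" using s1 fU by (intro card_seteq) auto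
  show "N \<in> \<sigma>" if N: "N \<in> Lo" "\<Inter>\<sigma> \<subseteq> N" "N \<subseteq> \<Union>\<sigma>" for N
  proof -
    obtain x where "x \<in> N" "x \<notin> \<Inter>\<sigma>" "N = insert x (\<Inter>\<sigma>)" using ins[OF N(1,2)] by blast
    then have "N \<in> ?f ` (\<Union>\<sigma> - \<Inter>\<sigma>)" using N(3) by blast
    then show ?thesis using eq by simp
  qed
qed

end

section \<open>Surviving tetrahedra and cells\<close>

context two_slices
begin

text \<open>For an \<open>(n + 3)\<close>-set \<open>B\<close> the sets \<open>B - {x}\<close> span a simplex, attached to the rest along its
  \<open>2\<close>-skeleton. Only its tetrahedra through the vertex \<open>B - {Max B}\<close> survive: the others
  are \<open>excess\<close> and can be collapsed away, using this vertex as apex.\<close>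
definition excess :: "nat set set \<Rightarrow> bool" where
  "excess \<sigma> \<longleftrightarrow> \<sigma> \<subseteq> Hi \<and> card \<sigma> = 4 \<and> card (\<Union>\<sigma>) = n + 3 \<and> Max (\<Union>\<sigma>) \<in> \<Inter>\<sigma>"

definition reduced :: "nat set set set" where
  "reduced = {\<rho> \<in> vr. \<forall>\<sigma>\<in>{\<sigma>. excess \<sigma>}. \<not> \<sigma> \<subseteq> \<rho>}"

text \<open>A surviving tetrahedron is a cell if all numbers below the least number \<open>j\<close> missing from
  its union lie in each of its vertices. It is then present in stage \<open>j\<close> of the elimination below,
  but would have no partner there.\<close>
definition initial_gap :: "nat set set \<Rightarrow> bool" where
  "initial_gap \<sigma> \<longleftrightarrow> (\<exists>j\<ge>1. j \<notin> \<Union>\<sigma> \<and> {1..<j} \<subseteq> \<Inter>\<sigma>)"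

definition Hi_cell :: "nat set set \<Rightarrow> bool" where
  "Hi_cell \<sigma> \<longleftrightarrow> \<sigma> \<subseteq> Hi \<and> card \<sigma> = 4 \<and> card (\<Union>\<sigma>) = n + 3 \<and> Max (\<Union>\<sigma>) \<notin> \<Inter>\<sigma> \<and> initial_gap \<sigma>"

text \<open>By its size, the union of the three low sets is their only common high superset; the
  tetrahedron is the cone from it over a triangle of low sets.\<close>

definition Lo_cell :: "nat set set \<Rightarrow> bool" where
  "Lo_cell \<sigma> \<longleftrightarrow> (\<exists>\<tau>. \<sigma> = insert (\<Union>\<tau>) \<tau> \<and> \<Union>\<tau> \<in> Hi \<and> \<tau> \<subseteq> Lo \<and> card \<tau> = 3) \<and> initial_gap \<sigma>"

definition cells :: "nat set set set" where
  "cells = {\<sigma> \<in> vr. Hi_cell \<sigma> \<or> Lo_cell \<sigma>}"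

lemma excessD:
  assumes "excess \<sigma>"
  shows "\<sigma> \<subseteq> Hi" "card \<sigma> = 4" "card (\<Union>\<sigma>) = n + 3" "Max (\<Union>\<sigma>) \<in> \<Inter>\<sigma>" "\<sigma> \<noteq> {}" "finite \<sigma>"
    "card (\<Inter>\<sigma>) = n - 1"
proof -
  show s: "\<sigma> \<subseteq> Hi" "card \<sigma> = 4" "card (\<Union>\<sigma>) = n + 3" "Max (\<Union>\<sigma>) \<in> \<Inter>\<sigma>"
    using assms by (simp_all add: excess_def)
  show ne: "\<sigma> \<noteq> {}" using s(2) by auto
  show "finite \<sigma>" using s(2) card.infinite by fastforce
  show "card (\<Inter>\<sigma>) = n - 1" using Hi_facets(5)[OF s(1,3) ne] s(2) by simp
qed

lemma reducedD: "\<rho> \<in> reduced \<Longrightarrow> \<rho> \<in> vr" "\<rho> \<in> reduced \<Longrightarrow> excess \<sigma> \<Longrightarrow> \<not> \<sigma> \<subseteq> \<rho>"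
  by (simp_all add: reduced_def)

lemma reducedI: "\<rho> \<in> vr \<Longrightarrow> (\<And>\<sigma>. excess \<sigma> \<Longrightarrow> \<not> \<sigma> \<subseteq> \<rho>) \<Longrightarrow> \<rho> \<in> reduced"
  by (simp add: reduced_def)

lemma complex_reduced: "simplicial_complex reduced"
  unfolding reduced_def by (rule simplicial_complex_filter[OF complex_vr]) auto

lemma finite_reduced: "finite reduced"
  unfolding reduced_def using finite_vr by simp

text \<open>Four facets of an \<open>(n + 3)\<close>-set have only \<open>n - 1\<close> elements in
  common, too few for a low set contained in all of them.\<close>

lemma no_Lo_of_four:
  assumes \<rho>: "\<rho> \<in> vr" "\<sigma> \<subseteq> \<rho>" and \<sigma>: "\<sigma> \<subseteq> Hi" "card (\<Union>\<sigma>) = n + 3" "card \<sigma> = 4" and N: "N \<in> \<rho>"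
  shows "N \<in> Hi"
proof (rule ccontr)
  assume "N \<notin> Hi"
  then have L: "N \<in> Lo" using vrD(3)[OF \<rho>(1)] N by blast
  have ne: "\<sigma> \<noteq> {}" using \<sigma>(3) by auto
  have "N \<subseteq> \<Inter>\<sigma>" by (rule Lo_in_Inter[OF \<rho>(1) \<sigma>(1) \<rho>(2) N L])
  moreover have "finite (\<Inter>\<sigma>)" using Hi_facets(1,3)[OF \<sigma>(1,2) ne] by (rule finite_subset[rotated])
  ultimately have "card N \<le> card (\<Inter>\<sigma>)" by (intro card_mono)
  then show False using LoD[OF L] Hi_facets(5)[OF \<sigma>(1,2) ne] \<sigma>(3) n_pos by simp
qed

text \<open>By \<open>no_Lo_of_four\<close> and \<open>Hi_in_Union\<close> all vertices in the star
  of an excess tetrahedron are facets of its union \<open>B\<close>, so every facet of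
  \<open>B\<close> could serve as apex. The one omitting the maximum of \<open>B\<close> is never
  part of an excess tetrahedron with union \<open>B\<close>, which gives the independence of the
  removals.\<close>

lemma hequiv_reduced: "hequiv vr reduced"
  unfolding reduced_def
proof (rule hequiv_remove_simplices[where a = "\<lambda>\<sigma>. \<Union>\<sigma> - {Max (\<Union>\<sigma>)}"])
  show "simplicial_complex vr" by (rule complex_vr)
  have "{\<sigma>. excess \<sigma>} \<subseteq> Pow Hi" using excessD(1) by blast
  then show "finite {\<sigma>. excess \<sigma>}" by (rule finite_subset) (simp add: finite_slice)
  fix \<sigma> assume s: "\<sigma> \<in> {\<sigma>. excess \<sigma>}"
  then have e: "excess \<sigma>" by simp
  note E = excessD[OF e] note F = Hi_facets[OF E(1,3,5)]
  let ?a = "\<Union>\<sigma> - {Max (\<Union>\<sigma>)}"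
  have a_notin: "?a \<notin> \<sigma>" using E(4) by blast
  then show "finite \<sigma> \<and> \<sigma> \<noteq> {} \<and> ?a \<notin> \<sigma>" using E by simp
  fix \<rho> assume r: "\<rho> \<in> vr" "\<sigma> \<subseteq> \<rho>"
  have U: "T \<subseteq> \<Union>\<sigma>" if "T \<in> \<rho>" for T
    by (rule Hi_in_Union[OF r(1) E(1) r(2) _ E(3) that no_Lo_of_four[OF r E(1,3,2) that]]) (simp add: E(2))
  have "\<Union>\<sigma> \<noteq> {}" using E(3) by (metis card.empty add_is_0 numeral_eq_iff zero_neq_numeral)
  then have M: "Max (\<Union>\<sigma>) \<in> \<Union>\<sigma>" using F(1) by (intro Max_in)
  have a: "?a \<in> Hi"
  proof (rule HiI)
    show "?a \<subseteq> {1..m}" using E(1) HiD by blast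
    show "card ?a = Suc (Suc n)" using M F(1) E(3) by simp
  qed
  show "insert ?a \<rho> \<in> vr"
  proof (rule insert_Hi_vr[OF r(1) a])
    show "N \<subseteq> ?a" if "N \<in> \<rho>" "N \<in> Lo" for N
      using no_Lo_of_four[OF r E(1,3,2) that(1)] Lo_Hi[OF that(2)] by blast
    show "card (?a \<union> T) \<le> Suc (Suc (Suc n))" if "T \<in> \<rho>" "T \<in> Hi" for T
    proof -
      have "?a \<union> T \<subseteq> \<Union>\<sigma>" using U[OF that(1)] by blast
      then have "card (?a \<union> T) \<le> card (\<Union>\<sigma>)" using F(1) by (intro card_mono)
      then show ?thesis using E(3) by simp
    qed
  qed
  fix \<tau> assume t: "\<tau> \<in> {\<sigma>. excess \<sigma>}" "\<tau> \<subseteq> insert ?a \<rho>"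
  then have e': "excess \<tau>" by simp
  note E' = excessD[OF e']
  have "?a \<notin> \<tau>"
  proof
    assume at: "?a \<in> \<tau>"
    have "\<Union>\<tau> \<subseteq> \<Union>\<sigma>" using t(2) U by blast
    then have "\<Union>\<tau> = \<Union>\<sigma>" using F(1) E(3) E'(3) by (intro card_seteq) auto
    then show False using E'(4) at by auto
  qed
  then show "\<tau> \<subseteq> \<rho>" using t(2) by blast
qed

text \<open>A further vertex would be another facet of the same \<open>(n + 3)\<close>-set.
  Exchanging it for the vertex without the maximum gives a tetrahedron all of whose vertices contain
  the maximum; it is excess and hence absent.\<close>

lemma Hi_cell_maximal:
  assumes c: "Hi_cell \<sigma>" and \<rho>: "\<rho> \<in> reduced" "\<sigma> \<subseteq> \<rho>"
  shows "\<rho> = \<sigma>"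
proof -
  have E: "\<sigma> \<subseteq> Hi" "card \<sigma> = 4" "card (\<Union>\<sigma>) = n + 3" "Max (\<Union>\<sigma>) \<notin> \<Inter>\<sigma>" using c by (auto simp: Hi_cell_def)
  have ne: "\<sigma> \<noteq> {}" and fs: "finite \<sigma>" using E(2) card.infinite by (auto, fastforce)
  note F = Hi_facets[OF E(1,3) ne]
  note r = reducedD(1)[OF \<rho>(1)]
  have "\<rho> \<subseteq> \<sigma>"
  proof (rule subsetI, rule ccontr)
    fix T assume T: "T \<in> \<rho>" "T \<notin> \<sigma>"
    have TH: "T \<in> Hi" by (rule no_Lo_of_four[OF r \<rho>(2) E(1,3,2) T(1)])
    have TU: "T \<subseteq> \<Union>\<sigma>" by (rule Hi_in_Union[OF r E(1) \<rho>(2) _ E(3) T(1) TH]) (simp add: E(2))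
    let ?a = "\<Union>\<sigma> - {Max (\<Union>\<sigma>)}"
    have "\<Union>\<sigma> \<noteq> {}" using E(3) by (metis card.empty add_is_0 zero_neq_numeral)
    then have "Max (\<Union>\<sigma>) \<in> \<Union>\<sigma>" by (rule Max_in[OF F(1)])
    then have mU: "Max (\<Union>\<sigma>) \<in> \<Union>\<sigma> - \<Inter>\<sigma>" using E(4) by (rule DiffI)
    have "?a \<in> (\<lambda>x. \<Union>\<sigma> - {x}) ` (\<Union>\<sigma> - \<Inter>\<sigma>)" using mU by (rule imageI)
    then have a: "?a \<in> \<sigma>" by (subst F(4))
    let ?\<tau> = "insert T (\<sigma> - {?a})"
    have facet: "S \<subseteq> \<Union>\<sigma> \<and> card S = Suc (Suc n)" if "S \<in> insert T \<sigma>" for S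
      using that F(2) TU HiD[OF TH] by auto
    have cB: "card (\<Union>\<sigma>) = Suc (Suc (Suc n))" using E(3) by simp
    have mx: "Max (\<Union>\<sigma>) \<in> S" if "S \<in> ?\<tau>" for S
    proof (rule ccontr)
      assume n: "Max (\<Union>\<sigma>) \<notin> S"
      have S: "S \<subseteq> \<Union>\<sigma>" "card S = Suc (Suc n)" using facet[of S] that by auto
      then obtain x where "x \<in> \<Union>\<sigma>" "S = \<Union>\<sigma> - {x}" using facet_eq_Diff[OF F(1) S(1)] cB by metis
      then have "S = ?a" using n mU by blast
      then show False using that T(2) a by blast
    qed
    have ct: "card ?\<tau> = 4" using T(2) a fs E(2) by simp
    have "card ?\<tau> \<ge> 3" using ct by linarith
    then obtain S S' where SS: "S \<in> ?\<tau>" "S' \<in> ?\<tau>" "S \<noteq> S'" by (rule card_3E)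
    have U: "\<Union>?\<tau> = \<Union>\<sigma>"
      by (rule Union_facets[OF SS F(1) cB]) (rule facet, blast)
    have "excess ?\<tau>" unfolding excess_def U
      using ct E(1,3) TH mx by blast
    moreover have "?\<tau> \<subseteq> \<rho>" using T(1) \<rho>(2) by blast
    ultimately show False using reducedD(2)[OF \<rho>(1)] by blast
  qed
  then show ?thesis using \<rho>(2) by (rule subset_antisym)
qed

text \<open>A further low vertex contains the core and lies in the high vertex, so it is one of the
  three; a further high vertex contains all three low sets and so equals their union.\<close>

lemma Lo_cell_maximal:
  assumes c: "Lo_cell \<sigma>" and \<rho>: "\<rho> \<in> vr" "\<sigma> \<subseteq> \<rho>"
  shows "\<rho> = \<sigma>"
proof -
  obtain \<tau> where t: "\<sigma> = insert (\<Union>\<tau>) \<tau>" "\<Union>\<tau> \<in> Hi" "\<tau> \<subseteq> Lo" "card \<tau> = 3"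
    using c by (auto simp: Lo_cell_def)
  have tr: "\<tau> \<subseteq> \<rho>" "\<Union>\<tau> \<in> \<rho>" using t(1) \<rho>(2) by auto
  have cU: "card (\<Union>\<tau>) = n + 2" using HiD[OF t(2)] by simp
  note L = Lo_triple[OF \<rho>(1) t(3) tr(1) t(4) cU]
  have "\<rho> \<subseteq> \<sigma>"
  proof
    fix A assume A: "A \<in> \<rho>"
    then have "A \<in> Lo \<or> A \<in> Hi" using vrD(3)[OF \<rho>(1)] by blast
    then show "A \<in> \<sigma>"
    proof
      assume AL: "A \<in> Lo"
      have "A \<subseteq> \<Union>\<tau>" by (rule vrD(6)[OF \<rho>(1) A tr(2) AL t(2)])
      then have "A \<in> \<tau>" by (rule L(3)[OF AL L(2)[OF A AL]])
      then show ?thesis using t(1) by simp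
    next
      assume AH: "A \<in> Hi"
      have "N \<subseteq> A" if "N \<in> \<tau>" for N
      proof (rule vrD(6)[OF \<rho>(1) _ A _ AH])
        show "N \<in> \<rho>" "N \<in> Lo" using that tr(1) t(3) by auto
      qed
      then have "\<Union>\<tau> \<subseteq> A" by blast
      then have "\<Union>\<tau> = A" using HiD[OF AH] cU by (intro card_seteq) auto
      then show ?thesis using t(1) by simp
    qed
  qed
  then show ?thesis using \<rho>(2) by (rule subset_antisym)
qed

lemma card_Lo_cell:
  assumes "Lo_cell \<sigma>" shows "card \<sigma> = 4"
proof -
  obtain \<tau> where t: "\<sigma> = insert (\<Union>\<tau>) \<tau>" "\<Union>\<tau> \<in> Hi" "\<tau> \<subseteq> Lo" "card \<tau> = 3"
    using assms by (auto simp: Lo_cell_def)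
  have "\<Union>\<tau> \<notin> \<tau>" using Lo_Hi t(2,3) by blast
  moreover have "finite \<tau>" using t(4) card.infinite by fastforce
  ultimately show ?thesis using t(1,4) by simp
qed

lemma cells_reduced: "cells \<subseteq> reduced"
proof
  fix \<sigma> assume s: "\<sigma> \<in> cells"
  then have v: "\<sigma> \<in> vr" and c: "Hi_cell \<sigma> \<or> Lo_cell \<sigma>" by (auto simp: cells_def)
  have c4: "card \<sigma> = 4" using c card_Lo_cell by (auto simp: Hi_cell_def)
  show "\<sigma> \<in> reduced"
  proof (rule reducedI[OF v], rule notI)
    fix \<tau> assume e: "excess \<tau>" "\<tau> \<subseteq> \<sigma>"
    note E = excessD[OF e(1)]
    have "finite \<sigma>" using vrD(1)[OF v] .
    then have eq: "\<tau> = \<sigma>" using e(2) E(2) c4 by (intro card_seteq) auto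
    show False using c
    proof
      assume "Hi_cell \<sigma>" then show False using E(4) eq by (simp add: Hi_cell_def)
    next
      assume "Lo_cell \<sigma>"
      then obtain \<tau>' where t: "\<sigma> = insert (\<Union>\<tau>') \<tau>'" "\<tau>' \<subseteq> Lo" "card \<tau>' = 3" by (auto simp: Lo_cell_def)
      have "\<tau>' \<noteq> {}" using t(3) by auto
      then obtain N where "N \<in> \<tau>'" by blast
      then have "N \<in> Lo" "N \<in> Hi" using t E(1) eq by auto
      then show False using Lo_Hi by blast
    qed
  qed
qed

lemma three_cells_reduced: "three_cells reduced cells"
proof
  show "simplicial_complex reduced" by (rule complex_reduced)
  show "finite reduced" by (rule finite_reduced)
  show "cells \<subseteq> reduced" by (rule cells_reduced)
  show "card \<sigma> = 4" if "\<sigma> \<in> cells" for \<sigma> using that card_Lo_cell by (auto simp: cells_def Hi_cell_def)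
  show "\<rho> = \<sigma>" if "\<sigma> \<in> cells" "\<rho> \<in> reduced" "\<sigma> \<subseteq> \<rho>" for \<sigma> \<rho>
  proof -
    have "Hi_cell \<sigma> \<or> Lo_cell \<sigma>" using that(1) by (simp add: cells_def)
    then show ?thesis
      using Hi_cell_maximal[OF _ that(2,3)] Lo_cell_maximal[OF _ reducedD(1)[OF that(2)] that(3)] by (rule disjE)
  qed
qed

text \<open>Around a set \<open>C\<close> of the intermediate size \<open>n + 1\<close>, low sets
  inside \<open>C\<close> and high sets containing \<open>C\<close> are automatically close. No
  excess tetrahedron occurs among them, since its vertices would all contain \<open>C\<close> but
  share only \<open>n - 1\<close> elements. Several of the apexes below are justified by exhibiting
  such a \<open>C\<close>.\<close>

lemma star_reduced:
  assumes C: "card C = Suc n" "finite C" and \<rho>: "finite \<rho>" "\<rho> \<noteq> {}" "\<rho> \<subseteq> Lo \<union> Hi"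
    and lo: "\<And>N. N \<in> \<rho> \<Longrightarrow> N \<in> Lo \<Longrightarrow> N \<subseteq> C" and hi: "\<And>T. T \<in> \<rho> \<Longrightarrow> T \<in> Hi \<Longrightarrow> C \<subseteq> T"
  shows "\<rho> \<in> reduced"
proof (rule reducedI)
  show "\<rho> \<in> vr"
  proof (rule vrI[OF \<rho>])
    fix A B assume AB: "A \<in> \<rho>" "B \<in> \<rho>"
    show "card (A \<union> B) \<le> Suc n" if "A \<in> Lo" "B \<in> Lo"
      using card_mono[OF C(2), of "A \<union> B"] lo[OF AB(1) that(1)] lo[OF AB(2) that(2)] C(1) by simp
    show "A \<subseteq> B" if "A \<in> Lo" "B \<in> Hi" using lo[OF AB(1) that(1)] hi[OF AB(2) that(2)] by (rule subset_trans)
    show "card (A \<union> B) \<le> Suc (Suc (Suc n))" if H: "A \<in> Hi" "B \<in> Hi"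
    proof -
      have "C \<subseteq> A \<inter> B" using hi[OF AB(1) H(1)] hi[OF AB(2) H(2)] by blast
      then have "Suc n \<le> card (A \<inter> B)" using HiD[OF H(1)] C(1) card_mono[of "A \<inter> B" C] by simp
      then show ?thesis using card_Un_Int[of A B] HiD[OF H(1)] HiD[OF H(2)] by simp
    qed
  qed
  fix \<sigma> assume e: "excess \<sigma>"
  note E = excessD[OF e]
  show "\<not> \<sigma> \<subseteq> \<rho>"
  proof
    assume "\<sigma> \<subseteq> \<rho>"
    then have "C \<subseteq> \<Inter>\<sigma>" using hi E(1) by (intro Inter_greatest) auto
    moreover have "finite (\<Inter>\<sigma>)" using Hi_facets(1,3)[OF E(1,3,5)] by (rule finite_subset[rotated])
    ultimately have "card C \<le> card (\<Inter>\<sigma>)" by (intro card_mono)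
    then show False using C(1) E(7) by simp
  qed
qed

end

lemma card_three: "a \<noteq> b \<Longrightarrow> a \<noteq> c \<Longrightarrow> b \<noteq> c \<Longrightarrow> card {a, b, c} = 3"
  by simp

section \<open>The stages of the elimination\<close>

context two_slices
begin

text \<open>The part of the complement of the cells with which stage \<open>i\<close> begins; for
  \<open>i = 1\<close> the interval is empty and nothing is excluded.\<close>

definition base :: "nat \<Rightarrow> nat set set set" where
  "base i = {\<rho> \<in> reduced - cells. \<forall>A\<in>\<rho>. {1..<i} \<subseteq> A}"

lemma baseD:
  assumes "\<rho> \<in> base i"
  shows "\<rho> \<in> reduced" "\<rho> \<in> vr" "\<rho> \<notin> cells" "\<And>A. A \<in> \<rho> \<Longrightarrow> {1..<i} \<subseteq> A" "finite \<rho>" "\<rho> \<noteq> {}" "\<rho> \<subseteq> Lo \<union> Hi"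
proof -
  show r: "\<rho> \<in> reduced" "\<rho> \<notin> cells" using assms by (auto simp: base_def)
  show "{1..<i} \<subseteq> A" if "A \<in> \<rho>" for A using assms that by (simp add: base_def)
  show v: "\<rho> \<in> vr" using reducedD(1)[OF r(1)] .
  show "finite \<rho>" "\<rho> \<noteq> {}" "\<rho> \<subseteq> Lo \<union> Hi" using vrD(1-3)[OF v] by auto
qed

lemma complex_base: "simplicial_complex (base i)"
  unfolding base_def
  by (rule simplicial_complex_filter[OF three_cells.complex_M[OF three_cells_reduced]]) blast

end

locale stage = two_slices +
  fixes j :: nat
  assumes j_pos: "1 \<le> j" and j_le: "j \<le> n"
begin

definition avoiding :: "nat set set set \<Rightarrow> nat set set set" where
  "avoiding F = {\<rho> \<in> base j. \<forall>\<tau>\<in>F. \<not> \<tau> \<subseteq> \<rho>}"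

lemma avoidingD: "\<rho> \<in> avoiding F \<Longrightarrow> \<rho> \<in> base j" "\<rho> \<in> avoiding F \<Longrightarrow> \<tau> \<in> F \<Longrightarrow> \<not> \<tau> \<subseteq> \<rho>"
  by (auto simp: avoiding_def)

text \<open>A number witnessing \<open>initial_gap\<close> cannot be less than \<open>j\<close>,
  since such numbers lie in all vertices; not \<open>j\<close>, which lies in \<open>a\<close>; and
  not greater than \<open>j\<close>, since \<open>A\<close> misses \<open>j\<close>. So adding a
  vertex through \<open>j\<close> to a simplex with a vertex avoiding \<open>j\<close> never
  produces a cell.\<close>

lemma not_cell:
  assumes "\<And>A. A \<in> \<rho> \<Longrightarrow> {1..<j} \<subseteq> A" and a: "a \<in> \<rho>" "j \<in> a" and A: "A \<in> \<rho>" "j \<notin> A"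
  shows "\<rho> \<notin> cells"
proof
  assume "\<rho> \<in> cells"
  then have "initial_gap \<rho>" by (auto simp: cells_def Hi_cell_def Lo_cell_def)
  then obtain i where i: "1 \<le> i" "i \<notin> \<Union>\<rho>" "{1..<i} \<subseteq> \<Inter>\<rho>" unfolding initial_gap_def by blast
  have "\<not> i < j" using i(1,2) assms(1)[OF A(1)] A(1) by (metis UnionI atLeastLessThan_iff subsetD)
  moreover have "i \<noteq> j" using i(2) a by blast
  moreover have "\<not> j < i" using i(3) j_pos A by (metis InterD atLeastLessThan_iff subsetD)
  ultimately show False by linarith
qed

lemma initial_gapI:
  assumes "\<And>A. A \<in> \<sigma> \<Longrightarrow> {1..<j} \<subseteq> A" "\<And>A. A \<in> \<sigma> \<Longrightarrow> j \<notin> A"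
  shows "initial_gap \<sigma>"
  unfolding initial_gap_def using assms j_pos by (intro exI[of _ j]) auto

text \<open>No vertex of a member of \<open>F\<close> or \<open>T\<close> contains \<open>j\<close>,
  but the apex does. Inserting the apex therefore completes neither a simplex removed before nor
  another member of \<open>T\<close>, and by \<open>not_cell\<close> it does not produce a cell.
  What remains for each family is the initial interval and membership in
  \<open>reduced\<close>.\<close>

lemma remove_family:
  assumes F: "\<And>\<tau> A. \<tau> \<in> F \<Longrightarrow> A \<in> \<tau> \<Longrightarrow> j \<notin> A"
    and T: "\<And>\<sigma>. \<sigma> \<in> T \<Longrightarrow> \<sigma> \<subseteq> Lo \<union> Hi \<and> \<sigma> \<noteq> {}" and Tj: "\<And>\<sigma> A. \<sigma> \<in> T \<Longrightarrow> A \<in> \<sigma> \<Longrightarrow> j \<notin> A"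
    and aj: "\<And>\<sigma>. \<sigma> \<in> T \<Longrightarrow> j \<in> a \<sigma>"
    and apex: "\<And>\<sigma> \<rho>. \<sigma> \<in> T \<Longrightarrow> \<rho> \<in> avoiding F \<Longrightarrow> \<sigma> \<subseteq> \<rho> \<Longrightarrow> {1..<j} \<subseteq> a \<sigma> \<and> insert (a \<sigma>) \<rho> \<in> reduced"
  shows "hequiv (avoiding F) (avoiding (F \<union> T))"
proof -
  have "hequiv (avoiding F) {\<rho> \<in> avoiding F. \<forall>\<sigma>\<in>T. \<not> \<sigma> \<subseteq> \<rho>}"
  proof (rule hequiv_remove_simplices[where a = a])
    show "simplicial_complex (avoiding F)"
      unfolding avoiding_def by (rule simplicial_complex_filter[OF complex_base]) blast
    have "T \<subseteq> Pow (Lo \<union> Hi)" using T by auto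
    then show "finite T" by (rule finite_subset) (simp add: finite_slice)
    fix \<sigma> assume s: "\<sigma> \<in> T"
    have "finite \<sigma>" using T[OF s] finite_slice by (meson finite_UnI finite_subset)
    then show "finite \<sigma> \<and> \<sigma> \<noteq> {} \<and> a \<sigma> \<notin> \<sigma>" using T[OF s] Tj[OF s] aj[OF s] by auto
    fix \<rho> assume r: "\<rho> \<in> avoiding F" "\<sigma> \<subseteq> \<rho>"
    note B = baseD[OF avoidingD(1)[OF r(1)]]
    have ap: "{1..<j} \<subseteq> a \<sigma>" "insert (a \<sigma>) \<rho> \<in> reduced" using apex[OF s r] by auto
    obtain A where A: "A \<in> \<sigma>" using T[OF s] by blast
    have mem: "{1..<j} \<subseteq> A" if "A \<in> insert (a \<sigma>) \<rho>" for A using that ap(1) B(4) by auto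
    have "insert (a \<sigma>) \<rho> \<notin> cells"
      by (rule not_cell[OF mem, where a = "a \<sigma>" and A = A]) (use A r(2) aj[OF s] Tj[OF s] in auto)
    then have ib: "insert (a \<sigma>) \<rho> \<in> base j" using ap(2) mem by (simp add: base_def)
    have sub: "\<tau> \<subseteq> \<rho>" if "\<tau> \<subseteq> insert (a \<sigma>) \<rho>" "\<And>A. A \<in> \<tau> \<Longrightarrow> j \<notin> A" for \<tau>
      using that aj[OF s] by blast
    have "\<not> \<tau> \<subseteq> insert (a \<sigma>) \<rho>" if "\<tau> \<in> F" for \<tau>
      using sub[of \<tau>] F[OF that] avoidingD(2)[OF r(1) that] by blast
    then show "insert (a \<sigma>) \<rho> \<in> avoiding F" using ib by (simp add: avoiding_def)
    fix \<tau> assume t: "\<tau> \<in> T" "\<tau> \<subseteq> insert (a \<sigma>) \<rho>"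
    show "\<tau> \<subseteq> \<rho>" by (rule sub[OF t(2) Tj[OF t(1)]])
  qed
  also have "{\<rho> \<in> avoiding F. \<forall>\<sigma>\<in>T. \<not> \<sigma> \<subseteq> \<rho>} = avoiding (F \<union> T)" by (auto simp: avoiding_def)
  finally show ?thesis .
qed

text \<open>The families of simplices whose open stars are removed in the given order; each is a family
  of simplices all of whose vertices avoid \<open>j\<close>, and the apex of the cone that makes the removal
  possible is (except for the first family) a vertex containing \<open>j\<close>.\<close>
definition Hi_triples where
  "Hi_triples = {\<sigma>. \<sigma> \<subseteq> Hi \<and> card \<sigma> = 3 \<and> card (\<Union>\<sigma>) = n + 3 \<and> j \<notin> \<Union>\<sigma>}"
definition Hi_pairs where
  "Hi_pairs = {\<sigma>. \<sigma> \<subseteq> Hi \<and> card \<sigma> = 2 \<and> j \<notin> \<Union>\<sigma>}"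
definition Hi_Lo_Lo where
  "Hi_Lo_Lo = {{A, N, N'} |A N N'. A \<in> Hi \<and> N \<in> Lo \<and> N' \<in> Lo \<and> N \<noteq> N' \<and> N \<subseteq> A \<and> N' \<subseteq> A \<and> j \<notin> A}"
definition Hi_Lo where
  "Hi_Lo = {{A, N} |A N. A \<in> Hi \<and> N \<in> Lo \<and> N \<subseteq> A \<and> j \<notin> A}"
definition Hi_single where
  "Hi_single = {{A} |A. A \<in> Hi \<and> j \<notin> A}"
definition Lo_triples where
  "Lo_triples = {\<sigma>. \<sigma> \<subseteq> Lo \<and> card \<sigma> = 3 \<and> card (\<Union>\<sigma>) = n + 2 \<and> j \<notin> \<Union>\<sigma>}"
definition Lo_pairs where
  "Lo_pairs = {\<sigma>. \<sigma> \<subseteq> Lo \<and> card \<sigma> = 2 \<and> j \<notin> \<Union>\<sigma>}"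
definition Lo_single where
  "Lo_single = {{N} |N. N \<in> Lo \<and> j \<notin> N}"

lemma j_m: "j \<in> {1..m}" using j_pos j_le n_less by auto

text \<open>The star of such a triple consists of the triple and its cone from the low set
  \<open>\<Inter>\<sigma>\<close>, so this is an elementary collapse. A further high vertex would
  complete a tetrahedron avoiding \<open>j\<close>, which is either excess or a cell and thereby
  absent; a low vertex lies in \<open>\<Inter>\<sigma>\<close> and has the same size. As the apex
  avoids \<open>j\<close>, this family cannot be handled by \<open>remove_family\<close>.\<close>

lemma remove_Hi_triples: "hequiv (avoiding {}) (avoiding Hi_triples)"
proof -
  have eq: "avoiding {} = base j" "avoiding Hi_triples = {\<rho> \<in> base j. \<forall>\<sigma>\<in>Hi_triples. \<not> \<sigma> \<subseteq> \<rho>}"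
    by (auto simp: avoiding_def)
  have D: "\<sigma> \<subseteq> Hi" "card \<sigma> = 3" "card (\<Union>\<sigma>) = n + 3" "j \<notin> \<Union>\<sigma>" "\<sigma> \<noteq> {}" if "\<sigma> \<in> Hi_triples" for \<sigma>
    using that by (auto simp: Hi_triples_def)
  show ?thesis unfolding eq
  proof (rule hequiv_remove_simplices[where a = Inter])
    show "simplicial_complex (base j)" by (rule complex_base)
    have "Hi_triples \<subseteq> Pow Hi" using D(1) by blast
    then show "finite Hi_triples" by (rule finite_subset) (simp add: finite_slice)
    fix \<sigma> assume s: "\<sigma> \<in> Hi_triples"
    note d = D[OF s] note F = Hi_facets[OF d(1,3,5)]
    have cI: "card (\<Inter>\<sigma>) = n" using F(5) d(2) by simp
    have notHi: "\<Inter>\<sigma> \<notin> Hi" using cI HiD[of "\<Inter>\<sigma>"] by auto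
    have fs: "finite \<sigma>" using d(2) card.infinite by fastforce
    show "finite \<sigma> \<and> \<sigma> \<noteq> {} \<and> \<Inter>\<sigma> \<notin> \<sigma>" using fs d(5) d(1) notHi by blast
    fix \<rho> assume r: "\<rho> \<in> base j" "\<sigma> \<subseteq> \<rho>"
    note B = baseD[OF r(1)]
    have "\<Inter>\<sigma> \<subseteq> {1..m}" using d(1,5) HiD by blast
    then have Lo: "\<Inter>\<sigma> \<in> Lo" using cI by (rule LoI)
    have sI: "{1..<j} \<subseteq> \<Inter>\<sigma>" using B(4) r(2) by blast
    have cU: "card (\<Union>\<sigma>) = Suc (Suc (Suc n))" using d(3) by simp
    have hi: "T \<in> \<sigma>" if T: "T \<in> \<rho>" "T \<in> Hi" for T
    proof (rule ccontr)
      assume nT: "T \<notin> \<sigma>"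
      have TU: "T \<subseteq> \<Union>\<sigma>" by (rule Hi_in_Union[OF B(2) d(1) r(2) _ d(3) T]) (simp add: d(2))
      let ?\<tau> = "insert T \<sigma>"
      have U: "\<Union>?\<tau> = \<Union>\<sigma>" using TU by blast
      have tH: "?\<tau> \<subseteq> Hi" "card ?\<tau> = 4" "card (\<Union>?\<tau>) = n + 3" "?\<tau> \<subseteq> \<rho>"
        using T d nT fs U r(2) by auto
      show False
      proof (cases "Max (\<Union>?\<tau>) \<in> \<Inter>?\<tau>")
        case True
        then have "excess ?\<tau>" using tH unfolding excess_def by blast
        then show False using reducedD(2)[OF B(1)] tH(4) by blast
      next
        case False
        have "initial_gap ?\<tau>"
        proof (rule initial_gapI)
          fix A assume A: "A \<in> ?\<tau>"
          then show "{1..<j} \<subseteq> A" using B(4) tH(4) by blast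
          have "A \<subseteq> \<Union>\<sigma>" using A TU by blast
          then show "j \<notin> A" using d(4) by blast
        qed
        then have c: "Hi_cell ?\<tau>" using False tH unfolding Hi_cell_def by blast
        have "\<rho> = ?\<tau>" by (rule Hi_cell_maximal[OF c B(1) tH(4)])
        then have "\<rho> \<in> cells" using c B(2) by (simp add: cells_def)
        then show False using B(3) by blast
      qed
    qed
    have lo: "N = \<Inter>\<sigma>" if N: "N \<in> \<rho>" "N \<in> Lo" for N
    proof -
      have "N \<subseteq> \<Inter>\<sigma>" by (rule Lo_in_Inter[OF B(2) d(1) r(2) N])
      then show ?thesis using LoD[OF Lo] LoD[OF N(2)] by (intro card_seteq) auto
    qed
    have sub: "A \<in> \<sigma> \<or> A = \<Inter>\<sigma>" if "A \<in> insert (\<Inter>\<sigma>) \<rho>" for A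
      using that hi[of A] lo[of A] B(7) by blast
    have v: "insert (\<Inter>\<sigma>) \<rho> \<in> vr"
    proof (rule insert_Lo_vr[OF B(2) Lo])
      show "\<Inter>\<sigma> \<subseteq> T" if "T \<in> \<rho>" "T \<in> Hi" for T using hi[OF that] by blast
      show "card (\<Inter>\<sigma> \<union> N') \<le> Suc n" if "N' \<in> \<rho>" "N' \<in> Lo" for N' using lo[OF that] cI by simp
    qed
    have small: "\<tau> \<subseteq> \<sigma>" if "\<tau> \<subseteq> insert (\<Inter>\<sigma>) \<rho>" "\<tau> \<subseteq> Hi" for \<tau>
      using that sub notHi by blast
    have red: "insert (\<Inter>\<sigma>) \<rho> \<in> reduced"
    proof (rule reducedI[OF v], rule notI)
      fix \<tau> assume e: "excess \<tau>" "\<tau> \<subseteq> insert (\<Inter>\<sigma>) \<rho>"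
      have "card \<tau> \<le> card \<sigma>" using small[OF e(2) excessD(1)[OF e(1)]] fs by (rule card_mono[rotated])
      then show False using excessD(2)[OF e(1)] d(2) by simp
    qed
    have "insert (\<Inter>\<sigma>) \<rho> \<notin> cells"
    proof
      assume "insert (\<Inter>\<sigma>) \<rho> \<in> cells"
      then have "Hi_cell (insert (\<Inter>\<sigma>) \<rho>) \<or> Lo_cell (insert (\<Inter>\<sigma>) \<rho>)" by (simp add: cells_def)
      then show False
      proof
        assume "Hi_cell (insert (\<Inter>\<sigma>) \<rho>)"
        then show False using notHi by (simp add: Hi_cell_def)
      next
        assume "Lo_cell (insert (\<Inter>\<sigma>) \<rho>)"
        then obtain \<tau> where t: "insert (\<Inter>\<sigma>) \<rho> = insert (\<Union>\<tau>) \<tau>" "\<tau> \<subseteq> Lo" "card \<tau> = 3" by (auto simp: Lo_cell_def)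
        have "\<tau> \<subseteq> {\<Inter>\<sigma>}"
        proof
          fix N assume N: "N \<in> \<tau>"
          then have "N \<in> insert (\<Inter>\<sigma>) \<rho>" "N \<in> Lo" using t by auto
          then show "N \<in> {\<Inter>\<sigma>}" using sub[of N] d(1) Lo_Hi[of N] by blast
        qed
        then have "card \<tau> \<le> 1" using card_mono[of "{\<Inter>\<sigma>}" \<tau>] by simp
        then show False using t(3) by simp
      qed
    qed
    then show "insert (\<Inter>\<sigma>) \<rho> \<in> base j" using red sI B(4) by (simp add: base_def)
    fix \<tau> assume "\<tau> \<in> Hi_triples" "\<tau> \<subseteq> insert (\<Inter>\<sigma>) \<rho>"
    then show "\<tau> \<subseteq> \<rho>" using D(1)[of \<tau>] notHi by blast
  qed
qed

lemma star_insert: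
  assumes C: "card C = Suc n" "C \<subseteq> {1..m}" and \<rho>: "\<rho> \<in> base j" and T: "C \<subseteq> T" "T \<in> Hi"
    and "\<And>N. N \<in> \<rho> \<Longrightarrow> N \<in> Lo \<Longrightarrow> N \<subseteq> C" "\<And>T. T \<in> \<rho> \<Longrightarrow> T \<in> Hi \<Longrightarrow> C \<subseteq> T"
  shows "insert T \<rho> \<in> reduced"
proof (rule star_reduced[OF C(1)])
  note B = baseD[OF \<rho>]
  show "finite C" using C(2) finite_subset by blast
  show "finite (insert T \<rho>)" "insert T \<rho> \<noteq> {}" "insert T \<rho> \<subseteq> Lo \<union> Hi" using B(5,7) T(2) by auto
  show "N \<subseteq> C" if "N \<in> insert T \<rho>" "N \<in> Lo" for N
  proof -
    have "N \<noteq> T" using that(2) T(2) Lo_Hi by blast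
    then show ?thesis using that assms(6) by blast
  qed
  show "C \<subseteq> T'" if "T' \<in> insert T \<rho>" "T' \<in> Hi" for T'
    using that T(1) assms(7) by blast
qed

text \<open>Take \<open>C = A \<inter> A'\<close>, of size \<open>n + 1\<close>. Low vertices lie in
  both sets, hence in \<open>C\<close>. A high vertex not containing \<open>C\<close> would by the
  dichotomy lie in \<open>A \<union> A'\<close>, avoid \<open>j\<close>, and complete one of the
  triples already removed.\<close>

lemma remove_Hi_pairs: "hequiv (avoiding Hi_triples) (avoiding (Hi_triples \<union> Hi_pairs))"
proof (rule remove_family[where a = "\<lambda>\<sigma>. insert j (\<Inter>\<sigma>)"])
  show "j \<notin> A" if "\<tau> \<in> Hi_triples" "A \<in> \<tau>" for \<tau> A using that by (auto simp: Hi_triples_def)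
  show "\<sigma> \<subseteq> Lo \<union> Hi \<and> \<sigma> \<noteq> {}" if "\<sigma> \<in> Hi_pairs" for \<sigma> using that by (auto simp: Hi_pairs_def)
  show "j \<notin> A" if "\<sigma> \<in> Hi_pairs" "A \<in> \<sigma>" for \<sigma> A using that by (auto simp: Hi_pairs_def)
  fix \<sigma> \<rho> assume s: "\<sigma> \<in> Hi_pairs" and r: "\<rho> \<in> avoiding Hi_triples" "\<sigma> \<subseteq> \<rho>"
  note B = baseD[OF avoidingD(1)[OF r(1)]]
  have d: "\<sigma> \<subseteq> Hi" "card \<sigma> = 2" "j \<notin> \<Union>\<sigma>" using s by (auto simp: Hi_pairs_def)
  obtain A A' where AA: "\<sigma> = {A, A'}" "A \<noteq> A'" using d(2) by (auto simp: card_2_iff)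
  have H: "A \<in> Hi" "A' \<in> Hi" "A \<in> \<rho>" "A' \<in> \<rho>" "j \<notin> A" "j \<notin> A'" using AA d r(2) by auto
  let ?C = "A \<inter> A'"
  have I: "\<Inter>\<sigma> = ?C" using AA by simp
  have cU: "card (A \<union> A') = Suc (Suc (Suc n))"
    using vrD(5)[OF B(2) H(3,4,1,2)] card_Un_ge_Suc[of A A' "Suc (Suc n)"] HiD[OF H(1)] HiD[OF H(2)] AA(2) by simp
  have cC: "card ?C = Suc n" using card_Un_Int[of A A'] HiD[OF H(1)] HiD[OF H(2)] cU by simp
  have Cm: "?C \<subseteq> {1..m}" using HiD[OF H(1)] by blast
  have top: "insert j ?C \<in> Hi"
  proof (rule HiI)
    show "insert j ?C \<subseteq> {1..m}" using Cm j_m by blast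
    show "card (insert j ?C) = Suc (Suc n)" using cC H(5) HiD[OF H(1)] by simp
  qed
  have "insert (insert j ?C) \<rho> \<in> reduced"
  proof (rule star_insert[OF cC Cm avoidingD(1)[OF r(1)] _ top])
    show "?C \<subseteq> insert j ?C" by blast
    show "N \<subseteq> ?C" if "N \<in> \<rho>" "N \<in> Lo" for N
      using vrD(6)[OF B(2) that(1) H(3) that(2) H(1)] vrD(6)[OF B(2) that(1) H(4) that(2) H(2)] by blast
    show "?C \<subseteq> T" if T: "T \<in> \<rho>" "T \<in> Hi" for T
    proof (cases "T \<in> {A, A'}")
      case False
      have "?C \<subseteq> T \<or> T \<subseteq> A \<union> A'"
        using HiD[OF H(1)] HiD[OF H(2)] HiD[OF T(2)] vrD(5)[OF B(2) H(3) T(1) H(1) T(2)]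
          vrD(5)[OF B(2) H(4) T(1) H(2) T(2)] AA(2)
        by (intro exchange_dichotomy[where q = "Suc (Suc n)"]) simp_all
      moreover have "\<not> T \<subseteq> A \<union> A'"
      proof
        assume t: "T \<subseteq> A \<union> A'"
        let ?\<tau> = "{A, A', T}"
        have "T \<noteq> A" "T \<noteq> A'" using False by simp_all
        then have "card ?\<tau> = 3" using AA(2) by (intro card_three) simp_all
        moreover have "\<Union>?\<tau> = A \<union> A'" using t by blast
        moreover have "j \<notin> T" using t H(5,6) by blast
        ultimately have "?\<tau> \<in> Hi_triples" using H T(2) cU unfolding Hi_triples_def by simp
        then show False using avoidingD(2)[OF r(1)] H(3,4) T(1) by blast
      qed
      ultimately show ?thesis by blast
    qed auto
  qed
  moreover have "{1..<j} \<subseteq> insert j (\<Inter>\<sigma>)" using B(4)[OF H(3)] B(4)[OF H(4)] I by blast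
  ultimately show "{1..<j} \<subseteq> insert j (\<Inter>\<sigma>) \<and> insert (insert j (\<Inter>\<sigma>)) \<rho> \<in> reduced" unfolding I by blast
qed simp

text \<open>The dual situation, with \<open>C = N \<union> N'\<close>. High vertices contain
  \<open>C\<close>. A low vertex outside \<open>C\<close> would, together with \<open>N\<close> and
  \<open>N'\<close>, have union \<open>A\<close>, and the four sets would be a cell; this is the
  place where the low cells obstruct the elimination.\<close>

lemma remove_Hi_Lo_Lo:
  "hequiv (avoiding (Hi_triples \<union> Hi_pairs)) (avoiding (Hi_triples \<union> Hi_pairs \<union> Hi_Lo_Lo))"
proof (rule remove_family[where a = "\<lambda>\<sigma>. insert j (\<Union>(\<sigma> \<inter> Lo))"])
  show "j \<notin> A" if "\<tau> \<in> Hi_triples \<union> Hi_pairs" "A \<in> \<tau>" for \<tau> A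
    using that by (auto simp: Hi_triples_def Hi_pairs_def)
  show "\<sigma> \<subseteq> Lo \<union> Hi \<and> \<sigma> \<noteq> {}" if "\<sigma> \<in> Hi_Lo_Lo" for \<sigma> using that by (auto simp: Hi_Lo_Lo_def)
  show "j \<notin> A" if "\<sigma> \<in> Hi_Lo_Lo" "A \<in> \<sigma>" for \<sigma> A using that by (auto simp: Hi_Lo_Lo_def)
  fix \<sigma> \<rho> assume s: "\<sigma> \<in> Hi_Lo_Lo" and r: "\<rho> \<in> avoiding (Hi_triples \<union> Hi_pairs)" "\<sigma> \<subseteq> \<rho>"
  note B = baseD[OF avoidingD(1)[OF r(1)]]
  obtain A N N' where d: "\<sigma> = {A, N, N'}" "A \<in> Hi" "N \<in> Lo" "N' \<in> Lo" "N \<noteq> N'" "N \<subseteq> A" "N' \<subseteq> A" "j \<notin> A"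
    using s unfolding Hi_Lo_Lo_def by blast
  have H: "A \<in> \<rho>" "N \<in> \<rho>" "N' \<in> \<rho>" using d(1) r(2) by auto
  let ?C = "N \<union> N'"
  have "\<sigma> \<inter> Lo = {N, N'}" using d Lo_Hi by auto
  then have I: "\<Union>(\<sigma> \<inter> Lo) = ?C" by simp
  note nd = LoD[OF d(3)] LoD[OF d(4)] HiD[OF d(2)]
  have cC: "card ?C = Suc n" using vrD(4)[OF B(2) H(2,3) d(3,4)] card_Un_ge_Suc[of N N' n] nd d(5) by simp
  have CA: "?C \<subseteq> A" using d by blast
  have Cm: "?C \<subseteq> {1..m}" using nd by blast
  have top: "insert j ?C \<in> Hi"
  proof (rule HiI)
    show "insert j ?C \<subseteq> {1..m}" using Cm j_m by blast
    have "j \<notin> ?C" using CA d(8) by blast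
    then show "card (insert j ?C) = Suc (Suc n)" using cC nd by simp
  qed
  have "insert (insert j ?C) \<rho> \<in> reduced"
  proof (rule star_insert[OF cC Cm avoidingD(1)[OF r(1)] _ top])
    show "?C \<subseteq> insert j ?C" by blast
    show "?C \<subseteq> T" if "T \<in> \<rho>" "T \<in> Hi" for T
      using vrD(6)[OF B(2) H(2) that(1) d(3) that(2)] vrD(6)[OF B(2) H(3) that(1) d(4) that(2)] by blast
    show "M \<subseteq> ?C" if M: "M \<in> \<rho>" "M \<in> Lo" for M
    proof (rule ccontr)
      assume n: "\<not> M \<subseteq> ?C"
      let ?\<tau> = "{N, N', M}"
      have MA: "M \<subseteq> A" by (rule vrD(6)[OF B(2) M(1) H(1) M(2) d(2)])
      have UA: "\<Union>?\<tau> = A"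
      proof (rule card_seteq)
        show "finite A" "\<Union>?\<tau> \<subseteq> A" using nd MA CA by auto
        have "?C \<subset> \<Union>?\<tau>" using n by blast
        then have "card ?C < card (\<Union>?\<tau>)" using nd LoD[OF M(2)] by (intro psubset_card_mono) auto
        then show "card A \<le> card (\<Union>?\<tau>)" using cC nd by simp
      qed
      have "N \<noteq> M" "N' \<noteq> M" using n by blast+
      then have ct: "card ?\<tau> = 3" using d(5) by (intro card_three)
      have t: "?\<tau> \<subseteq> Lo" "insert (\<Union>?\<tau>) ?\<tau> \<subseteq> \<rho>" using d M H UA by auto
      have "initial_gap (insert (\<Union>?\<tau>) ?\<tau>)"
      proof (rule initial_gapI)
        fix P assume P: "P \<in> insert (\<Union>?\<tau>) ?\<tau>"
        then show "{1..<j} \<subseteq> P" using B(4) t(2) by blast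
        have "P \<subseteq> A" using P UA by blast
        then show "j \<notin> P" using d(8) by blast
      qed
      then have c: "Lo_cell (insert (\<Union>?\<tau>) ?\<tau>)"
        unfolding Lo_cell_def using ct t(1) UA d(2) by (intro conjI exI[of _ ?\<tau>]) simp_all
      have "\<rho> = insert (\<Union>?\<tau>) ?\<tau>" by (rule Lo_cell_maximal[OF c B(2) t(2)])
      then have "\<rho> \<in> cells" using c B(2) by (simp add: cells_def)
      then show False using B(3) by blast
    qed
  qed
  moreover have "{1..<j} \<subseteq> insert j ?C" using B(4)[OF H(2)] by blast
  ultimately show "{1..<j} \<subseteq> insert j (\<Union>(\<sigma> \<inter> Lo)) \<and> insert (insert j (\<Union>(\<sigma> \<inter> Lo))) \<rho> \<in> reduced" unfolding I by blast
qed simp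

end

section \<open>Families with one high vertex, and families of low vertices\<close>

context stage
begin

definition Hi_families where
  "Hi_families = Hi_triples \<union> Hi_pairs \<union> Hi_Lo_Lo"

lemma Hi_families_j: "\<tau> \<in> Hi_families \<Longrightarrow> A \<in> \<tau> \<Longrightarrow> j \<notin> A"
  by (auto simp: Hi_families_def Hi_triples_def Hi_pairs_def Hi_Lo_Lo_def)

lemma only_Hi:
  assumes r: "\<rho> \<in> avoiding F" "Hi_pairs \<subseteq> F" and A: "A \<in> \<rho>" "A \<in> Hi" "j \<notin> A" and T: "T \<in> \<rho>" "T \<in> Hi" "T \<noteq> A"
  shows "j \<in> T"
proof (rule ccontr)
  assume "j \<notin> T"
  then have "{A, T} \<in> Hi_pairs" using A T by (simp add: Hi_pairs_def)
  then show False using avoidingD(2)[OF r(1)] r(2) A(1) T(1) by blast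
qed

lemma Hi_in_insert_j:
  assumes r: "\<rho> \<in> vr" and A: "A \<in> \<rho>" "A \<in> Hi" "j \<notin> A" and T: "T \<in> \<rho>" "T \<in> Hi" "j \<in> T"
  shows "T \<subseteq> insert j A"
proof -
  have "card (A \<union> T) \<le> Suc (Suc (Suc n))" by (rule vrD(5)[OF r A(1) T(1) A(2) T(2)])
  then have "insert j A = A \<union> T" using HiD[OF A(2)] HiD[OF T(2)] A(3) T(3) by (intro card_seteq) auto
  then show ?thesis by blast
qed

lemma card_Hi_Un_in_insert_j:
  assumes "A \<in> Hi" "j \<notin> A" "S \<subseteq> insert j A" "T \<subseteq> insert j A"
  shows "card (S \<union> T) \<le> Suc (Suc (Suc n))"
proof -
  have "card (S \<union> T) \<le> card (insert j A)" using assms HiD[OF assms(1)] by (intro card_mono) auto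
  then show ?thesis using HiD[OF assms(1)] assms(2) by simp
qed

text \<open>After the previous removals \<open>N\<close> is the only low vertex in the star, and
  every other high vertex is a facet of \<open>insert j A\<close>. A facet omitting an element of
  \<open>A - N\<close> is close to all of them; \<open>Min\<close> merely makes the choice definite.
  No excess tetrahedron arises, because its four vertices would all contain the \<open>n\<close>-set
  \<open>N\<close>.\<close>

lemma remove_Hi_Lo: "hequiv (avoiding Hi_families) (avoiding (Hi_families \<union> Hi_Lo))"
proof (rule remove_family[where a = "\<lambda>\<sigma>. insert j (\<Union>\<sigma> - {Min (\<Union>\<sigma> - \<Inter>\<sigma>)})"])
  show "j \<notin> A" if "\<tau> \<in> Hi_families" "A \<in> \<tau>" for \<tau> A by (rule Hi_families_j[OF that])
  show "\<sigma> \<subseteq> Lo \<union> Hi \<and> \<sigma> \<noteq> {}" if "\<sigma> \<in> Hi_Lo" for \<sigma> using that by (auto simp: Hi_Lo_def)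
  show "j \<notin> A" if "\<sigma> \<in> Hi_Lo" "A \<in> \<sigma>" for \<sigma> A using that by (auto simp: Hi_Lo_def)
  fix \<sigma> \<rho> assume s: "\<sigma> \<in> Hi_Lo" and r: "\<rho> \<in> avoiding Hi_families" "\<sigma> \<subseteq> \<rho>"
  note B = baseD[OF avoidingD(1)[OF r(1)]]
  obtain A N where d: "\<sigma> = {A, N}" "A \<in> Hi" "N \<in> Lo" "N \<subseteq> A" "j \<notin> A"
    using s unfolding Hi_Lo_def by blast
  have H: "A \<in> \<rho>" "N \<in> \<rho>" using d(1) r(2) by auto
  note nd = HiD[OF d(2)] LoD[OF d(3)]
  define x where "x = Min (A - N)"
  have U: "\<Union>\<sigma> = A" "\<Inter>\<sigma> = N" using d by auto
  have "A - N \<noteq> {}" using nd card_mono[of N A] by auto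
  then have x: "x \<in> A - N" unfolding x_def using nd by (intro Min_in) auto
  let ?a = "insert j (A - {x})"
  have a: "?a \<in> Hi"
  proof (rule HiI)
    show "?a \<subseteq> {1..m}" using nd j_m by blast
    show "card ?a = Suc (Suc n)" using nd x d(5) by simp
  qed
  have NS: "N \<subseteq> T" if "T \<in> \<rho>" "T \<in> Hi" for T by (rule vrD(6)[OF B(2) H(2) that(1) d(3) that(2)])
  have lo: "M = N" if M: "M \<in> \<rho>" "M \<in> Lo" for M
  proof (rule ccontr)
    assume "M \<noteq> N"
    moreover have "M \<subseteq> A" by (rule vrD(6)[OF B(2) M(1) H(1) M(2) d(2)])
    ultimately have "{A, N, M} \<in> Hi_families" unfolding Hi_families_def Hi_Lo_Lo_def using d M by blast
    then show False using avoidingD(2)[OF r(1)] H M(1) by blast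
  qed
  have hi: "T \<subseteq> insert j A" if T: "T \<in> \<rho>" "T \<in> Hi" for T
  proof (cases "T = A")
    case False
    have "j \<in> T" by (rule only_Hi[OF r(1) _ H(1) d(2,5) T False]) (auto simp: Hi_families_def)
    then show ?thesis by (rule Hi_in_insert_j[OF B(2) H(1) d(2,5) T])
  qed auto
  have v: "insert ?a \<rho> \<in> vr"
  proof (rule insert_Hi_vr[OF B(2) a])
    show "M \<subseteq> ?a" if "M \<in> \<rho>" "M \<in> Lo" for M using lo[OF that] x d(4) by blast
    show "card (?a \<union> T) \<le> Suc (Suc (Suc n))" if "T \<in> \<rho>" "T \<in> Hi" for T
      by (rule card_Hi_Un_in_insert_j[OF d(2,5) _ hi[OF that]]) blast
  qed
  have "insert ?a \<rho> \<in> reduced"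
  proof (rule reducedI[OF v], rule notI)
    fix \<tau> assume e: "excess \<tau>" "\<tau> \<subseteq> insert ?a \<rho>"
    note E = excessD[OF e(1)]
    have "N \<subseteq> \<Inter>\<tau>"
    proof (rule Inter_greatest)
      fix T assume "T \<in> \<tau>"
      then have "T = ?a \<or> T \<in> \<rho>" "T \<in> Hi" using e(2) E(1) by auto
      then show "N \<subseteq> T" using NS x d(4) by blast
    qed
    moreover have "finite (\<Inter>\<tau>)" using Hi_facets(1,3)[OF E(1,3,5)] by (rule finite_subset[rotated])
    ultimately have "card N \<le> card (\<Inter>\<tau>)" by (intro card_mono)
    then show False using nd E(7) n_pos by simp
  qed
  moreover have "{1..<j} \<subseteq> ?a" using B(4)[OF H(2)] x d(4) by blast
  ultimately show "{1..<j} \<subseteq> insert j (\<Union>\<sigma> - {Min (\<Union>\<sigma> - \<Inter>\<sigma>)}) \<and>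
      insert (insert j (\<Union>\<sigma> - {Min (\<Union>\<sigma> - \<Inter>\<sigma>)})) \<rho> \<in> reduced"
    unfolding U x_def by blast
qed simp

text \<open>Now the star has no low vertices and consists of facets of \<open>insert j A\<close>.
  The apex is the facet omitting the maximum, which belongs to no excess tetrahedron with this
  union; this is why the reduced complex keeps the tetrahedra through that facet.\<close>

lemma remove_Hi_single: "hequiv (avoiding (Hi_families \<union> Hi_Lo)) (avoiding (Hi_families \<union> Hi_Lo \<union> Hi_single))"
proof (rule remove_family[where a = "\<lambda>\<sigma>. insert j (\<Union>\<sigma> - {Max (\<Union>\<sigma>)})"])
  show "j \<notin> A" if "\<tau> \<in> Hi_families \<union> Hi_Lo" "A \<in> \<tau>" for \<tau> A
    using that Hi_families_j by (auto simp: Hi_Lo_def)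
  show "\<sigma> \<subseteq> Lo \<union> Hi \<and> \<sigma> \<noteq> {}" if "\<sigma> \<in> Hi_single" for \<sigma> using that by (auto simp: Hi_single_def)
  show "j \<notin> A" if "\<sigma> \<in> Hi_single" "A \<in> \<sigma>" for \<sigma> A using that by (auto simp: Hi_single_def)
  fix \<sigma> \<rho> assume s: "\<sigma> \<in> Hi_single" and r: "\<rho> \<in> avoiding (Hi_families \<union> Hi_Lo)" "\<sigma> \<subseteq> \<rho>"
  note B = baseD[OF avoidingD(1)[OF r(1)]]
  obtain A where d: "\<sigma> = {A}" "A \<in> Hi" "j \<notin> A" using s unfolding Hi_single_def by blast
  have H: "A \<in> \<rho>" using d(1) r(2) by auto
  note nd = HiD[OF d(2)]
  have U: "\<Union>\<sigma> = A" using d by simp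
  have Ane: "A \<noteq> {}" using nd by auto
  have mxA: "Max A \<in> A" using nd Ane by (intro Max_in) auto
  \<comment> \<open>Ensures that adding \<open>j\<close> does not change the maximum. Otherwise
    \<open>A\<close> would lie in \<open>{1..<j}\<close>, although it has \<open>n + 2\<close>
    elements and \<open>j\<close> is at most \<open>n\<close>.\<close>
  have jM: "j < Max A"
  proof (rule ccontr)
    assume "\<not> j < Max A"
    have "A \<subseteq> {1..<j}"
    proof
      fix y assume y: "y \<in> A"
      then have "y \<le> Max A" "y \<noteq> j" "1 \<le> y" using nd d(3) by auto
      then show "y \<in> {1..<j}" using \<open>\<not> j < Max A\<close> by simp
    qed
    then have "card A \<le> card {1..<j}" by (intro card_mono) auto
    then show False using nd j_le by simp
  qed
  let ?a = "insert j (A - {Max A})"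
  have a: "?a \<in> Hi"
  proof (rule HiI)
    show "?a \<subseteq> {1..m}" using nd j_m by blast
    show "card ?a = Suc (Suc n)" using nd mxA d(3) by simp
  qed
  have hi: "T \<in> Hi \<and> T \<subseteq> insert j A" if T: "T \<in> \<rho>" for T
  proof -
    have "T \<notin> Lo"
    proof
      assume TL: "T \<in> Lo"
      have "T \<subseteq> A" by (rule vrD(6)[OF B(2) T H TL d(2)])
      then have "{A, T} \<in> Hi_Lo" unfolding Hi_Lo_def using d TL by blast
      then show False using avoidingD(2)[OF r(1)] H T by blast
    qed
    then have TH: "T \<in> Hi" using B(7) T by blast
    have "T \<subseteq> insert j A"
    proof (cases "T = A")
      case False
      have "j \<in> T" by (rule only_Hi[OF r(1) _ H d(2,3) T TH False]) (auto simp: Hi_families_def)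
      then show ?thesis by (rule Hi_in_insert_j[OF B(2) H d(2,3) T TH])
    qed auto
    then show ?thesis using TH by blast
  qed
  have v: "insert ?a \<rho> \<in> vr"
  proof (rule insert_Hi_vr[OF B(2) a])
    show "M \<subseteq> ?a" if "M \<in> \<rho>" "M \<in> Lo" for M using hi[OF that(1)] Lo_Hi[OF that(2)] by blast
    show "card (?a \<union> T) \<le> Suc (Suc (Suc n))" if "T \<in> \<rho>" "T \<in> Hi" for T
      by (rule card_Hi_Un_in_insert_j[OF d(2,3)]) (use hi[OF that(1)] in blast)+
  qed
  have "insert ?a \<rho> \<in> reduced"
  proof (rule reducedI[OF v], rule notI)
    fix \<tau> assume e: "excess \<tau>" "\<tau> \<subseteq> insert ?a \<rho>"
    note E = excessD[OF e(1)]
    have "\<Union>\<tau> \<subseteq> insert j A"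
    proof (rule Union_least)
      fix T assume "T \<in> \<tau>"
      then have "T = ?a \<or> T \<in> \<rho>" using e(2) by auto
      then show "T \<subseteq> insert j A" using hi[of T] by blast
    qed
    then have "\<Union>\<tau> = insert j A" using nd d(3) E(3) by (intro card_seteq) auto
    then have "Max (\<Union>\<tau>) = Max A" using jM nd Ane by simp
    then have "Max A \<in> \<Inter>\<tau>" using E(4) by simp
    then have "?a \<notin> \<tau>" using jM by auto
    then have "\<tau> \<subseteq> \<rho>" using e(2) by blast
    then show False using reducedD(2)[OF B(1) e(1)] by blast
  qed
  moreover have "{1..<j} \<subseteq> ?a" using B(4)[OF H] jM by auto
  ultimately show "{1..<j} \<subseteq> insert j (\<Union>\<sigma> - {Max (\<Union>\<sigma>)}) \<and> insert (insert j (\<Union>\<sigma> - {Max (\<Union>\<sigma>)})) \<rho> \<in> reduced"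
    unfolding U by blast
qed simp

definition all_Hi where "all_Hi = Hi_families \<union> Hi_Lo \<union> Hi_single"

lemma all_Hi_j: "\<tau> \<in> all_Hi \<Longrightarrow> A \<in> \<tau> \<Longrightarrow> j \<notin> A"
  using Hi_families_j by (auto simp: all_Hi_def Hi_Lo_def Hi_single_def)

lemma Hi_contains_j:
  assumes "\<rho> \<in> avoiding F" "all_Hi \<subseteq> F" "T \<in> \<rho>" "T \<in> Hi" shows "j \<in> T"
proof (rule ccontr)
  assume "j \<notin> T"
  then have "{T} \<in> F" using assms(2,4) unfolding all_Hi_def Hi_single_def by blast
  then show False using avoidingD(2)[OF assms(1)] assms(3) by blast
qed

lemma Hi_eq_insert_j:
  assumes "card C = Suc n" "j \<notin> C" "T \<in> Hi" "C \<subseteq> T" "j \<in> T"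
  shows "T = insert j C"
proof -
  have "finite C" using assms(3,4) HiD finite_subset by blast
  then have "insert j C = T" using assms HiD[OF assms(3)] by (intro card_seteq) auto
  then show ?thesis by simp
qed

text \<open>All remaining high vertices contain \<open>j\<close>, but a high vertex over the triple
  would be its union, which avoids \<open>j\<close>. So the star consists of low sets, all of which
  contain the core, and the core with \<open>j\<close> added is close to each of them.\<close>

lemma remove_Lo_triples: "hequiv (avoiding all_Hi) (avoiding (all_Hi \<union> Lo_triples))"
proof (rule remove_family[where a = "\<lambda>\<sigma>. insert j (\<Inter>\<sigma>)"])
  show "j \<notin> A" if "\<tau> \<in> all_Hi" "A \<in> \<tau>" for \<tau> A by (rule all_Hi_j[OF that])
  show "\<sigma> \<subseteq> Lo \<union> Hi \<and> \<sigma> \<noteq> {}" if "\<sigma> \<in> Lo_triples" for \<sigma> using that by (auto simp: Lo_triples_def)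
  show "j \<notin> A" if "\<sigma> \<in> Lo_triples" "A \<in> \<sigma>" for \<sigma> A using that by (auto simp: Lo_triples_def)
  fix \<sigma> \<rho> assume s: "\<sigma> \<in> Lo_triples" and r: "\<rho> \<in> avoiding all_Hi" "\<sigma> \<subseteq> \<rho>"
  note B = baseD[OF avoidingD(1)[OF r(1)]]
  have d: "\<sigma> \<subseteq> Lo" "card \<sigma> = 3" "card (\<Union>\<sigma>) = n + 2" "j \<notin> \<Union>\<sigma>" using s by (auto simp: Lo_triples_def)
  note L = Lo_triple[OF B(2) d(1) r(2) d(2,3)]
  have ne: "\<sigma> \<noteq> {}" using d(2) by auto
  have noHi: "T \<notin> Hi" if T: "T \<in> \<rho>" for T
  proof
    assume TH: "T \<in> Hi"
    have "N \<subseteq> T" if "N \<in> \<sigma>" for N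
    proof (rule vrD(6)[OF B(2) _ T _ TH])
      show "N \<in> \<rho>" "N \<in> Lo" using that r(2) d(1) by auto
    qed
    then have "\<Union>\<sigma> \<subseteq> T" by blast
    then have "\<Union>\<sigma> = T" using HiD[OF TH] d(3) by (intro card_seteq) auto
    moreover have "j \<in> T" by (rule Hi_contains_j[OF r(1) subset_refl T TH])
    ultimately show False using d(4) by simp
  qed
  have jI: "j \<notin> \<Inter>\<sigma>" using d(4) ne by blast
  have Im: "\<Inter>\<sigma> \<subseteq> {1..m}" using L(4) d(1) LoD by blast
  have fI: "finite (\<Inter>\<sigma>)" using Im finite_subset by blast
  have a: "insert j (\<Inter>\<sigma>) \<in> Lo"
  proof (rule LoI)
    show "insert j (\<Inter>\<sigma>) \<subseteq> {1..m}" using Im j_m by blast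
    show "card (insert j (\<Inter>\<sigma>)) = n" using fI jI L(1) n_pos by simp
  qed
  have v: "insert (insert j (\<Inter>\<sigma>)) \<rho> \<in> vr"
  proof (rule insert_Lo_vr[OF B(2) a])
    show "insert j (\<Inter>\<sigma>) \<subseteq> T" if "T \<in> \<rho>" "T \<in> Hi" for T using noHi that by blast
    show "card (insert j (\<Inter>\<sigma>) \<union> N) \<le> Suc n" if N: "N \<in> \<rho>" "N \<in> Lo" for N
    proof -
      have "insert j (\<Inter>\<sigma>) \<union> N = insert j N" using L(2)[OF N] by blast
      then show ?thesis using LoD[OF N(2)] by (simp add: card_insert_if)
    qed
  qed
  have "insert (insert j (\<Inter>\<sigma>)) \<rho> \<in> reduced"
  proof (rule reducedI[OF v], rule notI)
    fix \<tau> assume e: "excess \<tau>" "\<tau> \<subseteq> insert (insert j (\<Inter>\<sigma>)) \<rho>"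
    note E = excessD[OF e(1)]
    obtain T where "T \<in> \<tau>" using E(5) by blast
    then have "T \<in> Hi" "T = insert j (\<Inter>\<sigma>) \<or> T \<in> \<rho>" using E(1) e(2) by auto
    then show False using noHi Lo_Hi[OF a] by blast
  qed
  moreover have "{1..<j} \<subseteq> \<Inter>\<sigma>" using B(4) r(2) by blast
  ultimately show "{1..<j} \<subseteq> insert j (\<Inter>\<sigma>) \<and> insert (insert j (\<Inter>\<sigma>)) \<rho> \<in> reduced" by blast
qed simp

text \<open>The apex is the only high set that contains both low sets and \<open>j\<close>. A low
  vertex not inside \<open>N \<union> N'\<close> consists of \<open>N \<inter> N'\<close> and one
  new element \<open>y\<close>; unless \<open>y\<close> is \<open>j\<close> it would complete a
  removed triple, and with \<open>y = j\<close> it lies in the apex.\<close>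

lemma remove_Lo_pairs:
  "hequiv (avoiding (all_Hi \<union> Lo_triples)) (avoiding (all_Hi \<union> Lo_triples \<union> Lo_pairs))"
proof (rule remove_family[where a = "\<lambda>\<sigma>. insert j (\<Union>\<sigma>)"])
  show "j \<notin> A" if "\<tau> \<in> all_Hi \<union> Lo_triples" "A \<in> \<tau>" for \<tau> A
    using that all_Hi_j by (auto simp: Lo_triples_def)
  show "\<sigma> \<subseteq> Lo \<union> Hi \<and> \<sigma> \<noteq> {}" if "\<sigma> \<in> Lo_pairs" for \<sigma> using that by (auto simp: Lo_pairs_def)
  show "j \<notin> A" if "\<sigma> \<in> Lo_pairs" "A \<in> \<sigma>" for \<sigma> A using that by (auto simp: Lo_pairs_def)
  fix \<sigma> \<rho> assume s: "\<sigma> \<in> Lo_pairs" and r: "\<rho> \<in> avoiding (all_Hi \<union> Lo_triples)" "\<sigma> \<subseteq> \<rho>"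
  note B = baseD[OF avoidingD(1)[OF r(1)]]
  have d: "\<sigma> \<subseteq> Lo" "card \<sigma> = 2" "j \<notin> \<Union>\<sigma>" using s by (auto simp: Lo_pairs_def)
  obtain N N' where NN: "\<sigma> = {N, N'}" "N \<noteq> N'" using d(2) by (auto simp: card_2_iff)
  have H: "N \<in> Lo" "N' \<in> Lo" "N \<in> \<rho>" "N' \<in> \<rho>" "j \<notin> N" "j \<notin> N'" using NN d r(2) by auto
  note nd = LoD[OF H(1)] LoD[OF H(2)]
  let ?C = "N \<union> N'"
  have U: "\<Union>\<sigma> = ?C" using NN by simp
  have cC: "card ?C = Suc n" using vrD(4)[OF B(2) H(3,4,1,2)] card_Un_ge_Suc[of N N' n] nd NN(2) by simp
  have jC: "j \<notin> ?C" using H by blast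
  let ?a = "insert j ?C"
  have a: "?a \<in> Hi"
  proof (rule HiI)
    show "?a \<subseteq> {1..m}" using nd j_m by blast
    show "card ?a = Suc (Suc n)" using cC jC nd by simp
  qed
  have hi: "T = ?a" if T: "T \<in> \<rho>" "T \<in> Hi" for T
  proof (rule Hi_eq_insert_j[OF cC jC T(2)])
    show "?C \<subseteq> T" using vrD(6)[OF B(2) H(3) T(1) H(1) T(2)] vrD(6)[OF B(2) H(4) T(1) H(2) T(2)] by blast
    show "j \<in> T" by (rule Hi_contains_j[OF r(1) _ T]) blast
  qed
  have lo: "M \<subseteq> ?a" if M: "M \<in> \<rho>" "M \<in> Lo" for M
  proof (cases "M \<subseteq> ?C")
    case False
    note md = LoD[OF M(2)]
    have "N \<inter> N' \<subseteq> M \<or> M \<subseteq> N \<union> N'"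
      using nd md vrD(4)[OF B(2) H(3) M(1) H(1) M(2)] vrD(4)[OF B(2) H(4) M(1) H(2) M(2)] NN(2)
      by (intro exchange_dichotomy[where q = n]) simp_all
    then have IM: "N \<inter> N' \<subseteq> M" using False by blast
    have cI: "card (N \<inter> N') = n - 1" using card_Un_Int[of N N'] nd cC by simp
    have cMI: "card (M - N \<inter> N') = 1" using md IM cI n_pos nd by (simp add: card_Diff_subset)
    then obtain y where y: "M - N \<inter> N' = {y}" by (rule card_1_singletonE)
    have Msub: "M \<subseteq> insert y ?C" using y by blast
    have "j \<in> M"
    proof (rule ccontr)
      assume jM: "j \<notin> M"
      let ?\<tau> = "{N, N', M}"
      have "N \<noteq> M" "N' \<noteq> M" using False by blast+
      then have ct: "card ?\<tau> = 3" using NN(2) by (intro card_three)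
      have Ut: "\<Union>?\<tau> = insert y ?C" using y False by blast
      have "y \<notin> ?C" using Msub False by blast
      then have "card (\<Union>?\<tau>) = n + 2" unfolding Ut using cC nd by simp
      then have "?\<tau> \<in> Lo_triples" unfolding Lo_triples_def using ct H M(2) jM by simp
      then show False using avoidingD(2)[OF r(1)] H(3,4) M(1) by blast
    qed
    then have "j \<in> M - N \<inter> N'" using H(5) by simp
    then have "y = j" unfolding y by simp
    then show ?thesis using Msub by blast
  qed blast
  have v: "insert ?a \<rho> \<in> vr"
  proof (rule insert_Hi_vr[OF B(2) a lo])
    show "card (?a \<union> T) \<le> Suc (Suc (Suc n))" if "T \<in> \<rho>" "T \<in> Hi" for T
      using hi[OF that] HiD[OF a] by simp
  qed
  have "insert ?a \<rho> \<in> reduced"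
  proof (rule reducedI[OF v], rule notI)
    fix \<tau> assume e: "excess \<tau>" "\<tau> \<subseteq> insert ?a \<rho>"
    note E = excessD[OF e(1)]
    have "\<tau> \<subseteq> {?a}"
    proof
      fix T assume "T \<in> \<tau>"
      then have "T \<in> Hi" "T = ?a \<or> T \<in> \<rho>" using E(1) e(2) by auto
      then show "T \<in> {?a}" using hi by blast
    qed
    then have "card \<tau> \<le> 1" using card_mono[of "{?a}" \<tau>] by simp
    then show False using E(2) by simp
  qed
  moreover have "{1..<j} \<subseteq> ?a" using B(4)[OF H(3)] by blast
  ultimately show "{1..<j} \<subseteq> insert j (\<Union>\<sigma>) \<and> insert (insert j (\<Union>\<sigma>)) \<rho> \<in> reduced" unfolding U by blast
qed simp

text \<open>With \<open>C = insert j N\<close> of size \<open>n + 1\<close>: another low vertex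
  contains \<open>j\<close>, since pairs avoiding \<open>j\<close> are gone, and so lies in
  \<open>C\<close>; a high vertex contains \<open>N\<close> and \<open>j\<close>, hence
  \<open>C\<close>. Any high set containing \<open>C\<close> is then an apex; the bound
  \<open>n + 1 < m\<close> leaves an element \<open>z\<close> to add.\<close>

lemma remove_Lo_single:
  "hequiv (avoiding (all_Hi \<union> Lo_triples \<union> Lo_pairs)) (avoiding (all_Hi \<union> Lo_triples \<union> Lo_pairs \<union> Lo_single))"
proof (rule remove_family[where a = "\<lambda>\<sigma>. insert (Min ({1..m} - insert j (\<Union>\<sigma>))) (insert j (\<Union>\<sigma>))"])
  show "j \<notin> A" if "\<tau> \<in> all_Hi \<union> Lo_triples \<union> Lo_pairs" "A \<in> \<tau>" for \<tau> A
    using that all_Hi_j by (auto simp: Lo_triples_def Lo_pairs_def)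
  show "\<sigma> \<subseteq> Lo \<union> Hi \<and> \<sigma> \<noteq> {}" if "\<sigma> \<in> Lo_single" for \<sigma> using that by (auto simp: Lo_single_def)
  show "j \<notin> A" if "\<sigma> \<in> Lo_single" "A \<in> \<sigma>" for \<sigma> A using that by (auto simp: Lo_single_def)
  fix \<sigma> \<rho> assume s: "\<sigma> \<in> Lo_single" and r: "\<rho> \<in> avoiding (all_Hi \<union> Lo_triples \<union> Lo_pairs)" "\<sigma> \<subseteq> \<rho>"
  note B = baseD[OF avoidingD(1)[OF r(1)]]
  obtain N where d: "\<sigma> = {N}" "N \<in> Lo" "j \<notin> N" using s unfolding Lo_single_def by blast
  have H: "N \<in> \<rho>" using d(1) r(2) by auto
  note nd = LoD[OF d(2)]
  have U: "\<Union>\<sigma> = N" using d by simp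
  let ?C = "insert j N"
  have cC: "card ?C = Suc n" using nd d(3) by simp
  have Cm: "?C \<subseteq> {1..m}" using nd j_m by blast
  define z where "z = Min ({1..m} - ?C)"
  have "card ?C < card {1..m}" using cC n_less by simp
  then have "{1..m} - ?C \<noteq> {}" using Cm card_mono[of ?C "{1..m}"] nd by (metis Diff_eq_empty_iff finite_insert leD)
  then have z: "z \<in> {1..m} - ?C" unfolding z_def by (intro Min_in) auto
  have a: "insert z ?C \<in> Hi"
  proof (rule HiI)
    show "insert z ?C \<subseteq> {1..m}" using Cm z by blast
    show "card (insert z ?C) = Suc (Suc n)" using cC z nd by simp
  qed
  have "insert (insert z ?C) \<rho> \<in> reduced"
  proof (rule star_insert[OF cC Cm avoidingD(1)[OF r(1)] _ a])
    show "?C \<subseteq> insert z ?C" by blast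
    show "?C \<subseteq> T" if T: "T \<in> \<rho>" "T \<in> Hi" for T
    proof -
      have "N \<subseteq> T" by (rule vrD(6)[OF B(2) H T(1) d(2) T(2)])
      moreover have "j \<in> T" by (rule Hi_contains_j[OF r(1) _ T]) blast
      ultimately show ?thesis by blast
    qed
    show "M \<subseteq> ?C" if M: "M \<in> \<rho>" "M \<in> Lo" for M
    proof (cases "M = N")
      case False
      have jM: "j \<in> M"
      proof (rule ccontr)
        assume "j \<notin> M"
        then have "{N, M} \<in> Lo_pairs" unfolding Lo_pairs_def using d M(2) False by simp
        then show False using avoidingD(2)[OF r(1)] H M(1) by blast
      qed
      have "?C = N \<union> M"
        using vrD(4)[OF B(2) H M(1) d(2) M(2)] cC jM nd LoD[OF M(2)] by (intro card_seteq) auto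
      then show ?thesis by blast
    qed blast
  qed
  moreover have "{1..<j} \<subseteq> insert z ?C" using B(4)[OF H] by blast
  ultimately show "{1..<j} \<subseteq> insert (Min ({1..m} - insert j (\<Union>\<sigma>))) (insert j (\<Union>\<sigma>)) \<and>
      insert (insert (Min ({1..m} - insert j (\<Union>\<sigma>))) (insert j (\<Union>\<sigma>))) \<rho> \<in> reduced"
    unfolding U z_def by blast
qed simp

lemma avoiding_all: "avoiding (all_Hi \<union> Lo_triples \<union> Lo_pairs \<union> Lo_single) = base (Suc j)"
proof
  let ?F = "all_Hi \<union> Lo_triples \<union> Lo_pairs \<union> Lo_single"
  have Fj: "j \<notin> A" if "\<tau> \<in> ?F" "A \<in> \<tau>" for \<tau> A
    using that all_Hi_j by (auto simp: Lo_triples_def Lo_pairs_def Lo_single_def)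
  have Fne: "\<tau> \<noteq> {}" if "\<tau> \<in> ?F" for \<tau>
    using that by (auto simp: all_Hi_def Hi_families_def Hi_triples_def Hi_pairs_def Hi_Lo_Lo_def Hi_Lo_def
        Hi_single_def Lo_triples_def Lo_pairs_def Lo_single_def)
  have interval: "{1..<Suc j} = insert j {1..<j}" using j_pos by auto
  show "avoiding ?F \<subseteq> base (Suc j)"
  proof
    fix \<rho> assume r: "\<rho> \<in> avoiding ?F"
    note B = baseD[OF avoidingD(1)[OF r]]
    have "j \<in> A" if A: "A \<in> \<rho>" for A
    proof (cases "A \<in> Hi")
      case True
      show ?thesis by (rule Hi_contains_j[OF r _ A True]) blast
    next
      case False
      then have L: "A \<in> Lo" using B(7) A by blast
      show ?thesis
      proof (rule ccontr)
        assume "j \<notin> A"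
        then have "{A} \<in> Lo_single" using L unfolding Lo_single_def by blast
        then show False using avoidingD(2)[OF r] A by blast
      qed
    qed
    then show "\<rho> \<in> base (Suc j)" using B(1,3,4) unfolding base_def interval by simp
  qed
  show "base (Suc j) \<subseteq> avoiding ?F"
  proof
    fix \<rho> assume r: "\<rho> \<in> base (Suc j)"
    note B = baseD[OF r]
    have m: "{1..<j} \<subseteq> A" "j \<in> A" if "A \<in> \<rho>" for A using B(4)[OF that] unfolding interval by auto
    have "\<rho> \<in> base j" using B(1,3) m(1) by (simp add: base_def)
    moreover have "\<not> \<tau> \<subseteq> \<rho>" if "\<tau> \<in> ?F" for \<tau>
      using Fj[OF that] Fne[OF that] m(2) by blast
    ultimately show "\<rho> \<in> avoiding ?F" by (simp add: avoiding_def)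
  qed
qed

lemma hequiv_base_Suc: "hequiv (base j) (base (Suc j))"
proof -
  have "avoiding {} = base j" by (simp add: avoiding_def)
  then have 1: "hequiv (base j) (avoiding Hi_triples)" using remove_Hi_triples by simp
  have 2: "hequiv (avoiding Hi_triples) (avoiding Hi_families)"
    using hequiv_trans[OF remove_Hi_pairs remove_Hi_Lo_Lo] by (simp add: Hi_families_def)
  have 3: "hequiv (avoiding Hi_families) (avoiding all_Hi)"
    using hequiv_trans[OF remove_Hi_Lo remove_Hi_single] by (simp add: all_Hi_def)
  have 4: "hequiv (avoiding all_Hi) (base (Suc j))"
    using hequiv_trans[OF hequiv_trans[OF remove_Lo_triples remove_Lo_pairs] remove_Lo_single]
    by (simp add: avoiding_all)
  show ?thesis by (rule hequiv_trans[OF hequiv_trans[OF hequiv_trans[OF 1 2] 3] 4])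
qed

end

section \<open>The final cone and the homotopy type of the complex\<close>

context two_slices
begin

lemma stageI: "1 \<le> j \<Longrightarrow> j \<le> n \<Longrightarrow> stage m n j"
  by unfold_locales

lemma hequiv_base:
  assumes "i \<le> n" shows "hequiv (base 1) (base (Suc i))"
  using assms
proof (induction i)
  case 0
  then show ?case by (simp add: hequiv_refl)
next
  case (Suc i)
  interpret s: stage m n "Suc i" by (rule stageI) (use Suc in auto)
  have "hequiv (base (Suc i)) (base (Suc (Suc i)))"
    by (rule s.hequiv_base_Suc)
  then show ?case using Suc hequiv_trans[OF Suc.IH] by simp
qed

text \<open>Every remaining set contains \<open>{1..n}\<close>, so this is the only low set left and
  it can be added to every simplex. The result has just one low vertex: too many for a high cell,
  and too few for a low cell, which has three.\<close>

lemma hequiv_cone: "hequiv (base (Suc n)) {{{1..n}}}"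
proof (rule hequiv_apex_of_cone)
  let ?I = "{1..n}"
  have mem: "\<rho> \<in> base (Suc n) \<longleftrightarrow> \<rho> \<in> reduced \<and> \<rho> \<notin> cells \<and> (\<forall>A\<in>\<rho>. ?I \<subseteq> A)" for \<rho>
    by (auto simp: base_def atLeastLessThanSuc_atLeastAtMost)
  show "simplicial_complex (base (Suc n))" by (rule complex_base)
  have I: "?I \<in> Lo" using n_less by (intro LoI) auto
  have key: "insert ?I \<rho> \<in> base (Suc n)" if r: "\<rho> \<in> reduced" "\<forall>A\<in>\<rho>. ?I \<subseteq> A" for \<rho>
  proof -
    note v = reducedD(1)[OF r(1)]
    have lo: "N = ?I" if N: "N \<in> insert ?I \<rho>" "N \<in> Lo" for N
    proof (cases "N \<in> \<rho>")
      case True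
      then have "?I \<subseteq> N" using r(2) by blast
      then have "?I = N" using LoD[OF N(2)] by (intro card_seteq) auto
      then show ?thesis by simp
    qed (use N in blast)
    have vi: "insert ?I \<rho> \<in> vr"
    proof (rule insert_Lo_vr[OF v I])
      show "?I \<subseteq> T" if "T \<in> \<rho>" "T \<in> Hi" for T using r(2) that(1) by blast
      show "card (?I \<union> N') \<le> Suc n" if "N' \<in> \<rho>" "N' \<in> Lo" for N' using lo[of N'] that by simp
    qed
    have "insert ?I \<rho> \<in> reduced"
    proof (rule reducedI[OF vi], rule notI)
      fix \<tau> assume e: "excess \<tau>" "\<tau> \<subseteq> insert ?I \<rho>"
      have "?I \<notin> \<tau>" using excessD(1)[OF e(1)] Lo_Hi[OF I] by blast
      then have "\<tau> \<subseteq> \<rho>" using e(2) by blast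
      then show False using reducedD(2)[OF r(1) e(1)] by blast
    qed
    moreover have "insert ?I \<rho> \<notin> cells"
    proof
      assume "insert ?I \<rho> \<in> cells"
      then have "Hi_cell (insert ?I \<rho>) \<or> Lo_cell (insert ?I \<rho>)" by (simp add: cells_def)
      then show False
      proof
        assume "Hi_cell (insert ?I \<rho>)"
        then show False using Lo_Hi[OF I] by (simp add: Hi_cell_def)
      next
        assume "Lo_cell (insert ?I \<rho>)"
        then obtain \<tau> where t: "insert ?I \<rho> = insert (\<Union>\<tau>) \<tau>" "\<tau> \<subseteq> Lo" "card \<tau> = 3" by (auto simp: Lo_cell_def)
        have "\<tau> \<subseteq> {?I}"
        proof
          fix N assume N: "N \<in> \<tau>"
          then have "N \<in> insert ?I \<rho>" "N \<in> Lo" using t by auto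
          then show "N \<in> {?I}" using lo by blast
        qed
        then have "card \<tau> \<le> 1" using card_mono[of "{?I}" \<tau>] by simp
        then show False using t(3) by simp
      qed
    qed
    ultimately show ?thesis using r(2) by (simp add: mem)
  qed
  show "insert ?I \<rho> \<in> base (Suc n)" if "\<rho> \<in> base (Suc n)" for \<rho>
    using key that by (simp add: mem)
  have "{?I} \<in> reduced"
  proof (rule reducedI)
    show "{?I} \<in> vr" using I LoD[OF I] Lo_Hi[OF I] by (intro vrI) auto
    show "\<not> \<sigma> \<subseteq> {?I}" if "excess \<sigma>" for \<sigma>
    proof
      assume "\<sigma> \<subseteq> {?I}"
      then have "card \<sigma> \<le> 1" using card_mono[of "{?I}" \<sigma>] by simp
      then show False using excessD(2)[OF that] by simp
    qed
  qed
  then show "{?I} \<in> base (Suc n)" using key[of "{?I}"] by simp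
qed

lemma vr_homotopy_eqv: "geom vr homotopy_eqv sphere_axes (card cells)"
proof -
  have "base 1 = reduced - cells" by (auto simp: base_def)
  then have "hequiv (reduced - cells) {{{1..n}}}"
    using hequiv_trans[OF hequiv_base[of n] hequiv_cone] by simp
  then have "geom reduced homotopy_eqv sphere_axes (card cells)"
    by (rule three_cells.attach_cells_homotopy_eqv[OF three_cells_reduced])
  then show ?thesis using hequiv_reduced homotopy_eqv_trans unfolding hequiv_def by blast
qed

end

section \<open>Counting the cells\<close>

lemma card_subsets_containing:
  assumes "finite S" "x \<in> S"
  shows "card {X. X \<subseteq> S \<and> card X = Suc k \<and> x \<in> X} = (card S - 1) choose k"
proof -
  have "{X. X \<subseteq> S \<and> card X = Suc k \<and> x \<in> X} = insert x ` {X. X \<subseteq> S - {x} \<and> card X = k}"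
  proof (intro equalityI subsetI)
    fix X assume X: "X \<in> {X. X \<subseteq> S \<and> card X = Suc k \<and> x \<in> X}"
    have "finite X" using X assms finite_subset by blast
    then have "X = insert x (X - {x})" "X - {x} \<in> {X. X \<subseteq> S - {x} \<and> card X = k}" using X by auto
    then show "X \<in> insert x ` {X. X \<subseteq> S - {x} \<and> card X = k}" by (rule image_eqI)
  next
    fix X assume "X \<in> insert x ` {X. X \<subseteq> S - {x} \<and> card X = k}"
    then obtain Y where Y: "X = insert x Y" "Y \<subseteq> S - {x}" "card Y = k" by blast
    have "finite Y" "x \<notin> Y" using Y(2) assms finite_subset by blast+
    then show "X \<in> {X. X \<subseteq> S \<and> card X = Suc k \<and> x \<in> X}" using Y assms by auto
  qed
  moreover have "inj_on (insert x) {X. X \<subseteq> S - {x} \<and> card X = k}"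
    by (rule inj_onI) (metis (no_types, lifting) Diff_insert_absorb mem_Collect_eq subset_Diff_insert)
  ultimately show ?thesis using assms by (simp add: card_image n_subsets)
qed

text \<open>Here \<open>j\<close> is the least number missing from the first component,
  \<open>T\<close> the part of it above \<open>j\<close>, and \<open>q\<close> its size, so that
  \<open>T\<close> has \<open>q - (j - 1)\<close> elements. The second component stands for the
  union of a cell minus its intersection; \<open>initial_gap\<close> puts \<open>{1..<j}\<close>
  into the intersection, which is why it is chosen from \<open>T\<close>.\<close>

definition gap_pairs :: "nat \<Rightarrow> nat \<Rightarrow> nat \<Rightarrow> (nat set \<Rightarrow> nat set set) \<Rightarrow> (nat set \<times> nat set) set" where
  "gap_pairs m n q Y = (\<Union>j\<in>{1..n}. \<Union>T\<in>{T. T \<subseteq> {j<..m} \<and> card T = q + 1 - j}. (\<lambda>X. ({1..<j} \<union> T, X)) ` Y T)"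

text \<open>The number \<open>j\<close> can be read off from \<open>{1..<j} \<union> T\<close> as
  the least positive number missing, so pairs with different \<open>j\<close> are different and the
  sizes add up.\<close>

lemma card_gap_pairs:
  assumes Y: "\<And>T. finite T \<Longrightarrow> finite (Y T) \<and> card (Y T) = y (card T)" 
  shows "card (gap_pairs m n q Y) = (\<Sum>j=1..n. ((m - j) choose (q + 1 - j)) * y (q + 1 - j))"
proof -
  let ?A = "\<lambda>j. {T. T \<subseteq> {j<..m} \<and> card T = q + 1 - j}"
  let ?S = "SIGMA j:{1..n}. SIGMA T:?A j. Y T"
  let ?f = "\<lambda>(j, T, X). ({1..<j} \<union> T, X)"
  have eq: "gap_pairs m n q Y = ?f ` ?S"
  proof (intro equalityI subsetI)
    fix p assume "p \<in> gap_pairs m n q Y"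
    then obtain j T X where j: "j \<in> {1..n}" "T \<in> ?A j" "X \<in> Y T" "p = ({1..<j} \<union> T, X)"
      unfolding gap_pairs_def by (elim UN_E imageE)
    then have "(j, T, X) \<in> ?S" by (intro SigmaI)
    moreover have "p = ?f (j, T, X)" using j(4) by simp
    ultimately show "p \<in> ?f ` ?S" by (rule rev_image_eqI)
  next
    fix p assume "p \<in> ?f ` ?S"
    then obtain j T X where "j \<in> {1..n}" "T \<in> ?A j" "X \<in> Y T" "p = ({1..<j} \<union> T, X)"
      by (elim imageE SigmaE) simp
    then show "p \<in> gap_pairs m n q Y" unfolding gap_pairs_def by (intro UN_I image_eqI[of p _ X])
  qed
  have fT: "finite T" if "T \<in> ?A j" for T j using that finite_subset[of T "{j<..m}"] by simp
  have fA: "finite (?A j)" for j by (rule finite_subset[of _ "Pow {j<..m}"]) auto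
  have fYT: "finite (Y T)" if "T \<in> ?A j" for T j using Y[OF fT[OF that]] by (rule conjunct1)
  have inj: "inj_on ?f ?S"
  proof (rule inj_onI)
    fix p p' assume p: "p \<in> ?S" and p': "p' \<in> ?S" and e: "?f p = ?f p'"
    obtain j T X where P: "p = (j, T, X)" by (cases p) auto
    obtain j' T' X' where P': "p' = (j', T', X')" by (cases p') auto
    have T: "1 \<le> j" "T \<subseteq> {j<..m}" and T': "1 \<le> j'" "T' \<subseteq> {j'<..m}" using p p' P P' by auto
    have u: "{1..<j} \<union> T = {1..<j'} \<union> T'" and X: "X = X'" using e P P' by auto
    have nj: "j \<notin> {1..<j} \<union> T" "j' \<notin> {1..<j'} \<union> T'" using T T' by auto
    have "\<not> j < j'" using nj(1) T(1) u by (metis UnI1 atLeastLessThan_iff)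
    moreover have "\<not> j' < j" using nj(2) T'(1) u by (metis UnI1 atLeastLessThan_iff)
    ultimately have jj: "j = j'" by simp
    have dis: "{1..<j} \<inter> T = {}" "{1..<j} \<inter> T' = {}" using T T' jj by auto
    have "T = ({1..<j} \<union> T) - {1..<j}" using dis by blast
    also have "\<dots> = T'" using u jj dis by blast
    finally show "p = p'" using P P' jj X by simp
  qed
  have "card (gap_pairs m n q Y) = card ?S" unfolding eq by (rule card_image[OF inj])
  also have "\<dots> = (\<Sum>j=1..n. card (SIGMA T:?A j. Y T))"
    by (intro card_SigmaI ballI finite_SigmaI fA fYT finite_atLeastAtMost)
  also have "\<dots> = (\<Sum>j=1..n. ((m - j) choose (q + 1 - j)) * y (q + 1 - j))"
  proof (rule sum.cong)
    fix j assume "j \<in> {1..n}"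
    have "card (SIGMA T:?A j. Y T) = (\<Sum>T\<in>?A j. card (Y T))"
      by (intro card_SigmaI ballI fA fYT)
    also have "\<dots> = (\<Sum>T\<in>?A j. y (q + 1 - j))"
    proof (rule sum.cong)
      fix T assume T: "T \<in> ?A j"
      have "card (Y T) = y (card T)" using Y[OF fT[OF T]] by (rule conjunct2)
      then show "card (Y T) = y (q + 1 - j)" using T by simp
    qed simp
    also have "\<dots> = ((m - j) choose (q + 1 - j)) * y (q + 1 - j)" by (simp add: n_subsets)
    finally show "card (SIGMA T:?A j. Y T) = ((m - j) choose (q + 1 - j)) * y (q + 1 - j)" .
  qed simp
  finally show ?thesis .
qed

lemma gap_pairsE:
  assumes "(T, X) \<in> gap_pairs m n q Y" "n \<le> q"
  obtains j S where "1 \<le> j" "j \<le> n" "S \<subseteq> {j<..m}" "card S = q + 1 - j" "T = {1..<j} \<union> S" "X \<in> Y S"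
    "T \<subseteq> {1..m}" "card T = q" "j \<notin> T"
proof -
  obtain j S where j: "1 \<le> j" "j \<le> n" and S: "S \<subseteq> {j<..m}" "card S = q + 1 - j" "T = {1..<j} \<union> S" "X \<in> Y S"
    using assms(1) by (auto simp: gap_pairs_def)
  have fS: "finite S" using S(1) finite_subset by blast
  have "S \<noteq> {}" using S(2) j assms(2) by auto
  then have "j < m" using S(1) by fastforce
  then have "T \<subseteq> {1..m}" unfolding S(3) using S(1) by fastforce
  moreover have "{1..<j} \<inter> S = {}" using S(1) by auto
  then have "card T = q" unfolding S(3) using fS S(2) j assms(2) by (subst card_Un_disjoint) auto
  moreover have "j \<notin> T" unfolding S(3) using S(1) by auto
  ultimately show thesis using that[OF j S] by blast
qed

lemma gap_pairsI:
  assumes "1 \<le> j" "j \<le> n" "T \<subseteq> {1..m}" "card T = q" "n \<le> q" "j \<notin> T" "{1..<j} \<subseteq> T" "X \<in> Y (T - {1..<j})"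
  shows "(T, X) \<in> gap_pairs m n q Y"
proof -
  have fT: "finite T" using assms(3) finite_subset by blast
  have "T - {1..<j} \<subseteq> {j<..m}"
  proof
    fix x assume x: "x \<in> T - {1..<j}"
    then have "1 \<le> x" "x \<le> m" "x \<noteq> j" using assms(3,6) by auto
    then show "x \<in> {j<..m}" using x by auto
  qed
  moreover have "card (T - {1..<j}) = q + 1 - j" using assms fT by (simp add: card_Diff_subset)
  moreover have "T = {1..<j} \<union> (T - {1..<j})" using assms(7) by blast
  ultimately show ?thesis unfolding gap_pairs_def using assms(1,2,8) by (intro UN_I[of j] UN_I[of "T - {1..<j}"]) auto
qed

section \<open>The numbers of low and of high cells\<close>

context two_slices
begin

text \<open>A low cell consists of its union \<open>T\<close> and of the three sets obtained from
  the core by adding an element of \<open>X\<close>. The part of \<open>T\<close> above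
  \<open>j\<close> has \<open>n + 3 - j\<close> elements, and \<open>X\<close> is an arbitrary
  triple in it. The core has \<open>n - 1\<close> elements and contains \<open>{1..<j}\<close>, so
  \<open>j\<close> is at most \<open>n\<close>.\<close>

lemma card_Lo_cells:
  "card {\<sigma> \<in> vr. Lo_cell \<sigma>} = (\<Sum>j=1..n. ((m - j) choose (n + 3 - j)) * ((n + 3 - j) choose 3))"
proof -
  let ?Y = "\<lambda>S. {X. X \<subseteq> S \<and> card X = 3}"
  let ?Q = "gap_pairs m n (n + 2) ?Y"
  define g where "g p = insert (fst p) ((\<lambda>x. insert x (fst p - snd p)) ` snd p)" for p :: "nat set \<times> nat set"
  have Q: "X \<subseteq> T \<and> card X = 3 \<and> finite X \<and> T \<in> Hi \<and> (\<exists>j. 1 \<le> j \<and> j \<notin> T \<and> {1..<j} \<subseteq> T - X)"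
    if p: "(T, X) \<in> ?Q" for T X
  proof -
    obtain j S where e: "1 \<le> j" "j \<le> n" "S \<subseteq> {j<..m}" "card S = n + 2 + 1 - j" "T = {1..<j} \<union> S" "X \<in> ?Y S"
      "T \<subseteq> {1..m}" "card T = n + 2" "j \<notin> T"
      using p by (rule gap_pairsE) simp
    have X: "X \<subseteq> S" "card X = 3" using e(6) by auto
    have "finite X" using X(2) card.infinite by fastforce
    moreover have "T \<in> Hi" using e(7,8) by (simp add: slice_def)
    moreover have "X \<inter> {1..<j} = {}" using X(1) e(3) by auto
    then have "{1..<j} \<subseteq> T - X" unfolding e(5) by blast
    ultimately show ?thesis using X e(1,5,9) by blast
  qed
  have UI: "\<Union>(g (T, X)) = T \<and> \<Inter>(g (T, X)) = T - X" if p: "(T, X) \<in> ?Q" for T X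
  proof -
    have X: "X \<subseteq> T" "card X = 3" using Q[OF p] by blast+
    obtain a b where ab: "a \<in> X" "b \<in> X" "a \<noteq> b" using card_3E[of X] X(2) by (metis order_refl)
    have "\<Union>(g (T, X)) = T" using X(1) by (auto simp: g_def)
    moreover have "\<Inter>(g (T, X)) = T - X" using X(1) ab by (auto simp: g_def)
    ultimately show ?thesis by blast
  qed
  have inj: "inj_on g ?Q"
  proof (rule inj_onI)
    fix p p' assume p: "p \<in> ?Q" and p': "p' \<in> ?Q" and e: "g p = g p'"
    obtain T X where P: "p = (T, X)" by (cases p)
    obtain T' X' where P': "p' = (T', X')" by (cases p')
    have u: "\<Union>(g p) = T" "\<Inter>(g p) = T - X" "\<Union>(g p') = T'" "\<Inter>(g p') = T' - X'"
      using UI p p' P P' by blast+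
    have TT: "T = T'" "T - X = T' - X'" using u e by simp_all
    have "X \<subseteq> T" "X' \<subseteq> T'" using Q p p' P P' by blast+
    then have "X = X'" using TT by blast
    then show "p = p'" using P P' TT by simp
  qed
  have img: "g ` ?Q = {\<sigma> \<in> vr. Lo_cell \<sigma>}"
  proof (intro equalityI subsetI)
    fix \<sigma> assume "\<sigma> \<in> g ` ?Q"
    then obtain T X where p: "(T, X) \<in> ?Q" and s: "\<sigma> = g (T, X)" by auto
    have X: "X \<subseteq> T" "card X = 3" "finite X" and T: "T \<in> Hi" using Q[OF p] by blast+
    obtain j where j: "1 \<le> j" "j \<notin> T" "{1..<j} \<subseteq> T - X" using Q[OF p] by blast
    note td = HiD[OF T]
    let ?D = "T - X" and ?\<tau> = "(\<lambda>x. insert x (T - X)) ` X"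
    have s': "\<sigma> = insert T ?\<tau>" using s by (simp add: g_def)
    have cD: "card ?D = n - 1" using td X by (simp add: card_Diff_subset)
    have lo: "N \<in> Lo \<and> ?D \<subseteq> N \<and> N \<subseteq> T" if N: "N \<in> ?\<tau>" for N
    proof -
      obtain x where x: "x \<in> X" "N = insert x ?D" using N by blast
      have "card N = n" using x cD td n_pos by simp
      moreover have NT: "N \<subseteq> T" using x X(1) by blast
      ultimately have "N \<in> Lo" using td by (intro LoI) blast+
      then show ?thesis using NT x(2) by blast
    qed
    have X3: "X \<noteq> {}" using X(2) by auto
    have Ut: "\<Union>?\<tau> = T" using X(1) X3 by auto
    have inj: "inj_on (\<lambda>x. insert x (T - X)) X" by (rule inj_onI) blast
    have ct: "card ?\<tau> = 3" using X(2) card_image[OF inj] by simp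
    have v: "\<sigma> \<in> vr"
    proof (rule vrI)
      show "finite \<sigma>" "\<sigma> \<noteq> {}" unfolding s' using X(3) by auto
      show "\<sigma> \<subseteq> Lo \<union> Hi" unfolding s' using lo T by blast
      fix A B assume AB: "A \<in> \<sigma>" "B \<in> \<sigma>"
      have tau: "C \<in> ?\<tau>" if "C \<in> \<sigma>" "C \<in> Lo" for C using that s' Lo_Hi T by blast
      have top: "C = T" if "C \<in> \<sigma>" "C \<in> Hi" for C using that s' lo[of C] Lo_Hi[of C] by blast
      show "card (A \<union> B) \<le> Suc n" if L: "A \<in> Lo" "B \<in> Lo"
      proof -
        obtain x y where "A = insert x ?D" "B = insert y ?D" using tau[OF AB(1) L(1)] tau[OF AB(2) L(2)] by blast
        then have "A \<union> B = insert x (insert y ?D)" by blast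
        moreover have "finite ?D" using td by simp
        ultimately have "card (A \<union> B) \<le> Suc (Suc (card ?D))" using card_insert_le_m1 by (simp add: card_insert_if)
        then show ?thesis using cD n_pos by simp
      qed
      show "card (A \<union> B) \<le> Suc (Suc (Suc n))" if "A \<in> Hi" "B \<in> Hi"
        using top[OF AB(1) that(1)] top[OF AB(2) that(2)] td by simp
      show "A \<subseteq> B" if "A \<in> Lo" "B \<in> Hi" using lo[OF tau[OF AB(1) that(1)]] top[OF AB(2) that(2)] by blast
    qed
    have "initial_gap \<sigma>" unfolding initial_gap_def
    proof (intro exI[of _ j] conjI j(1))
      have "\<Union>\<sigma> = T" "\<Inter>\<sigma> = T - X" using UI[OF p] s by simp_all
      then show "j \<notin> \<Union>\<sigma>" "{1..<j} \<subseteq> \<Inter>\<sigma>" using j by simp_all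
    qed
    moreover have "\<exists>\<tau>. \<sigma> = insert (\<Union>\<tau>) \<tau> \<and> \<Union>\<tau> \<in> Hi \<and> \<tau> \<subseteq> Lo \<and> card \<tau> = 3"
      using s' Ut T lo ct by (intro exI[of _ ?\<tau>]) auto
    ultimately show "\<sigma> \<in> {\<sigma> \<in> vr. Lo_cell \<sigma>}" using v by (simp add: Lo_cell_def)
  next
    fix \<sigma> assume "\<sigma> \<in> {\<sigma> \<in> vr. Lo_cell \<sigma>}"
    then have v: "\<sigma> \<in> vr" and c: "Lo_cell \<sigma>" by auto
    obtain \<tau> where t: "\<sigma> = insert (\<Union>\<tau>) \<tau>" "\<Union>\<tau> \<in> Hi" "\<tau> \<subseteq> Lo" "card \<tau> = 3"
      using c by (auto simp: Lo_cell_def)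
    obtain j where j: "1 \<le> j" "j \<notin> \<Union>\<sigma>" "{1..<j} \<subseteq> \<Inter>\<sigma>" using c unfolding Lo_cell_def initial_gap_def by blast
    have tr: "\<tau> \<subseteq> \<sigma>" using t(1) by blast
    have cU: "card (\<Union>\<tau>) = n + 2" using HiD[OF t(2)] by simp
    note L = Lo_triple[OF v t(3) tr t(4) cU]
    have ne: "\<tau> \<noteq> {}" using t(4) by auto
    have US: "\<Union>\<sigma> = \<Union>\<tau>" using t(1) by blast
    have IS: "\<Inter>\<sigma> = \<Inter>\<tau>" unfolding t(1) using L(4) by auto
    let ?T = "\<Union>\<tau>" and ?X = "\<Union>\<tau> - \<Inter>\<tau>"
    have fI: "finite (\<Inter>\<tau>)" by (rule finite_subset[OF L(4)]) (use HiD[OF t(2)] in blast)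
    have cX: "card ?X = 3" using cU L(1,4) fI n_pos by (simp add: card_Diff_subset)
    have "card {1..<j} \<le> card (\<Inter>\<tau>)" using j(3) IS fI by (intro card_mono) auto
    then have jn: "j \<le> n" using L(1) n_pos by simp
    have Q': "(?T, ?X) \<in> ?Q"
    proof (rule gap_pairsI[OF j(1) jn])
      show "?T \<subseteq> {1..m}" "card ?T = n + 2" "n \<le> n + 2" using HiD[OF t(2)] by auto
      show "j \<notin> ?T" using j(2) US by simp
      show "{1..<j} \<subseteq> ?T" using j(3) IS L(4) by blast
      show "?X \<in> ?Y (?T - {1..<j})" using cX j(3) IS by auto
    qed
    have "?T - ?X = \<Inter>\<tau>" using L(4) by blast
    then have "g (?T, ?X) = insert ?T ((\<lambda>x. insert x (\<Inter>\<tau>)) ` ?X)" by (simp only: g_def fst_conv snd_conv)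
    also have "\<dots> = \<sigma>" using t(1) L(5) by simp
    finally have gs: "g (\<Union>\<tau>, \<Union>\<tau> - \<Inter>\<tau>) = \<sigma>" .
    show "\<sigma> \<in> g ` ?Q" using imageI[OF Q', of g] unfolding gs .
  qed
  have "card {\<sigma> \<in> vr. Lo_cell \<sigma>} = card ?Q" unfolding img[symmetric] by (rule card_image[OF inj])
  also have "\<dots> = (\<Sum>j=1..n. ((m - j) choose (n + 2 + 1 - j)) * ((n + 2 + 1 - j) choose 3))"
    by (rule card_gap_pairs) (simp add: n_subsets)
  also have "n + 2 + 1 = n + 3" by simp
  finally show ?thesis .
qed

text \<open>Here \<open>X\<close> is the set of the four elements omitted by the vertices. It
  contains the maximum, since the facet without the maximum belongs to the cell; this leaves three
  elements to be chosen from the other \<open>n + 3 - j\<close> elements above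
  \<open>j\<close>.\<close>

lemma card_Hi_cells:
  "card {\<sigma> \<in> vr. Hi_cell \<sigma>} = (\<Sum>j=1..n. ((m - j) choose (n + 4 - j)) * ((n + 3 - j) choose 3))"
proof -
  let ?Y = "\<lambda>S. if S = {} then {} else {X. X \<subseteq> S \<and> card X = Suc 3 \<and> Max S \<in> X}"
  let ?Q = "gap_pairs m n (n + 3) ?Y"
  define g where "g p = (\<lambda>x. fst p - {x}) ` snd p" for p :: "nat set \<times> nat set"
  have Q: "X \<subseteq> B \<and> card X = 4 \<and> finite X \<and> B \<subseteq> {1..m} \<and> card B = n + 3 \<and> Max B \<in> X \<and>
      (\<exists>j. 1 \<le> j \<and> j \<notin> B \<and> {1..<j} \<subseteq> B - X)"
    if p: "(B, X) \<in> ?Q" for B X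
  proof -
    obtain j S where e: "1 \<le> j" "j \<le> n" "S \<subseteq> {j<..m}" "card S = n + 3 + 1 - j" "B = {1..<j} \<union> S" "X \<in> ?Y S"
      "B \<subseteq> {1..m}" "card B = n + 3" "j \<notin> B"
      using p by (rule gap_pairsE) simp
    have S: "S \<noteq> {}" "finite S" using e(6) e(3) finite_subset by (auto split: if_splits)
    have X: "X \<subseteq> S" "card X = 4" "Max S \<in> X" using e(6) S(1) by auto
    have "finite X" using X(2) card.infinite by fastforce
    moreover have "Max B = Max S"
    proof (rule Max_eqI)
      show "finite B" by (rule finite_subset[OF e(7)]) simp
      show "Max S \<in> B" unfolding e(5) using S by simp
      have "Max S \<in> S" using S by (intro Max_in)
      then have "j < Max S" using e(3) by auto
      then show "y \<le> Max S" if "y \<in> B" for y using that S unfolding e(5) by auto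
    qed
    moreover have "X \<inter> {1..<j} = {}" using X(1) e(3) by auto
    then have "{1..<j} \<subseteq> B - X" unfolding e(5) by blast
    moreover have "X \<subseteq> B" using X(1) e(5) by blast
    ultimately show ?thesis using X e(1,7,8,9) by auto
  qed
  have UI: "\<Union>(g (B, X)) = B \<and> \<Inter>(g (B, X)) = B - X" if p: "(B, X) \<in> ?Q" for B X
  proof -
    have X: "X \<subseteq> B" "card X = 4" using Q[OF p] by blast+
    have "card X \<ge> 3" using X(2) by simp
    then obtain a b where ab: "a \<in> X" "b \<in> X" "a \<noteq> b" by (rule card_3E)
    have "\<Union>(g (B, X)) = B" using X(1) ab by (auto simp: g_def)
    moreover have "\<Inter>(g (B, X)) = B - X" using X(1) ab by (auto simp: g_def)
    ultimately show ?thesis by blast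
  qed
  have inj: "inj_on g ?Q"
  proof (rule inj_onI)
    fix p p' assume p: "p \<in> ?Q" and p': "p' \<in> ?Q" and e: "g p = g p'"
    obtain T X where P: "p = (T, X)" by (cases p)
    obtain T' X' where P': "p' = (T', X')" by (cases p')
    have u: "\<Union>(g p) = T" "\<Inter>(g p) = T - X" "\<Union>(g p') = T'" "\<Inter>(g p') = T' - X'"
      using UI p p' P P' by blast+
    have TT: "T = T'" "T - X = T' - X'" using u e by simp_all
    have "X \<subseteq> T" "X' \<subseteq> T'" using Q p p' P P' by blast+
    then have "X = X'" using TT by blast
    then show "p = p'" using P P' TT by simp
  qed
  have img: "g ` ?Q = {\<sigma> \<in> vr. Hi_cell \<sigma>}"
  proof (intro equalityI subsetI)
    fix \<sigma> assume "\<sigma> \<in> g ` ?Q"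
    then obtain B X where p: "(B, X) \<in> ?Q" and s: "\<sigma> = g (B, X)" by auto
    have X: "X \<subseteq> B" "card X = 4" "finite X" and B: "B \<subseteq> {1..m}" "card B = n + 3" "Max B \<in> X"
      using Q[OF p] by blast+
    obtain j where j: "1 \<le> j" "j \<notin> B" "{1..<j} \<subseteq> B - X" using Q[OF p] by blast
    have fB: "finite B" by (rule finite_subset[OF B(1)]) simp
    have U: "\<Union>\<sigma> = B" "\<Inter>\<sigma> = B - X" using UI[OF p] s by simp_all
    have hi: "T \<in> Hi \<and> T \<subseteq> B" if T: "T \<in> \<sigma>" for T
    proof -
      obtain x where x: "x \<in> X" "T = B - {x}" using T s by (auto simp: g_def)
      have "x \<in> B" using x X by blast
      then have "card T = Suc (Suc n)" using x B(2) fB by simp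
      moreover have TB: "T \<subseteq> B" using x by blast
      ultimately have "T \<in> Hi" using B(1) by (intro HiI) blast+
      then show ?thesis using TB by blast
    qed
    have inj: "inj_on (\<lambda>x. B - {x}) X" by (rule inj_onI) (use X(1) in blast)
    have cs: "card \<sigma> = 4" using X(2) card_image[OF inj] s by (simp add: g_def)
    have v: "\<sigma> \<in> vr"
    proof (rule vrI)
      show "finite \<sigma>" using cs card.infinite by fastforce
      show "\<sigma> \<noteq> {}" using cs by auto
      show "\<sigma> \<subseteq> Lo \<union> Hi" using hi by blast
      fix A A' assume AB: "A \<in> \<sigma>" "A' \<in> \<sigma>"
      show "card (A \<union> A') \<le> Suc n" if "A \<in> Lo" using hi[OF AB(1)] Lo_Hi[OF that] by blast
      show "A \<subseteq> A'" if "A \<in> Lo" using hi[OF AB(1)] Lo_Hi[OF that] by blast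
      have "card (A \<union> A') \<le> card B" using hi[OF AB(1)] hi[OF AB(2)] fB by (intro card_mono) auto
      then show "card (A \<union> A') \<le> Suc (Suc (Suc n))" using B(2) by simp
    qed
    have "initial_gap \<sigma>" unfolding initial_gap_def U using j by blast
    then have "Hi_cell \<sigma>" unfolding Hi_cell_def U using hi cs B by auto
    then show "\<sigma> \<in> {\<sigma> \<in> vr. Hi_cell \<sigma>}" using v by simp
  next
    fix \<sigma> assume "\<sigma> \<in> {\<sigma> \<in> vr. Hi_cell \<sigma>}"
    then have v: "\<sigma> \<in> vr" and c: "Hi_cell \<sigma>" by auto
    have E: "\<sigma> \<subseteq> Hi" "card \<sigma> = 4" "card (\<Union>\<sigma>) = n + 3" "Max (\<Union>\<sigma>) \<notin> \<Inter>\<sigma>" using c by (auto simp: Hi_cell_def)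
    have ne: "\<sigma> \<noteq> {}" using E(2) by auto
    note F = Hi_facets[OF E(1,3) ne]
    obtain j where j: "1 \<le> j" "j \<notin> \<Union>\<sigma>" "{1..<j} \<subseteq> \<Inter>\<sigma>" using c unfolding Hi_cell_def initial_gap_def by blast
    let ?B = "\<Union>\<sigma>" and ?X = "\<Union>\<sigma> - \<Inter>\<sigma>"
    have cI: "card (\<Inter>\<sigma>) = n - 1" using F(5) E(2) by simp
    have fI: "finite (\<Inter>\<sigma>)" by (rule finite_subset[OF F(3,1)])
    have cX: "card ?X = 4" using E(3) cI F(3) fI n_pos by (simp add: card_Diff_subset)
    have "card {1..<j} \<le> card (\<Inter>\<sigma>)" using j(3) fI by (intro card_mono) auto
    then have jn: "j \<le> n" using cI n_pos by simp
    have Bne: "?B \<noteq> {}" using E(3) by (metis card.empty add_is_0 zero_neq_numeral)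
    have mB: "Max ?B \<in> ?B" using F(1) Bne by (intro Max_in)
    then have mX: "Max ?B \<in> ?X" using E(4) by (rule DiffI)
    let ?S = "?B - {1..<j}"
    have mS: "Max ?B \<in> ?S" using mX j(3) by blast
    have MS: "Max ?S = Max ?B"
    proof (rule Max_eqI[OF _ _ mS])
      show "finite ?S" using F(1) by simp
      show "y \<le> Max ?B" if "y \<in> ?S" for y using F(1) that by (intro Max_ge) auto
    qed
    have Q': "(?B, ?X) \<in> ?Q"
    proof (rule gap_pairsI[OF j(1) jn])
      show "?B \<subseteq> {1..m}" using E(1) HiD by blast
      show "card ?B = n + 3" "n \<le> n + 3" using E(3) by auto
      show "j \<notin> ?B" by (rule j(2))
      show "{1..<j} \<subseteq> ?B" using j(3) F(3) by (rule subset_trans)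
      have "?S \<noteq> {}" using mS by blast
      moreover have "?X \<subseteq> ?S" using j(3) by blast
      moreover have "card ?X = Suc 3" using cX by simp
      ultimately show "?X \<in> ?Y ?S" using mX MS by (simp only: if_False mem_Collect_eq simp_thms)
    qed
    have "g (?B, ?X) = (\<lambda>x. ?B - {x}) ` ?X" by (simp only: g_def fst_conv snd_conv)
    also have "\<dots> = \<sigma>" by (rule F(4)[symmetric])
    finally have gs: "g (\<Union>\<sigma>, \<Union>\<sigma> - \<Inter>\<sigma>) = \<sigma>" .
    show "\<sigma> \<in> g ` ?Q" using imageI[OF Q', of g] unfolding gs .
  qed
  have "card {\<sigma> \<in> vr. Hi_cell \<sigma>} = card ?Q" unfolding img[symmetric] by (rule card_image[OF inj])
  also have "\<dots> = (\<Sum>j=1..n. ((m - j) choose (n + 3 + 1 - j)) * ((n + 3 + 1 - j - 1) choose 3))"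
  proof (rule card_gap_pairs)
    fix S :: "nat set" assume S: "finite S"
    show "finite (?Y S) \<and> card (?Y S) = (card S - 1) choose 3"
    proof (cases "S = {}")
      case False
      then show ?thesis using card_subsets_containing[OF S Max_in[OF S False], of 3] S by simp
    qed simp
  qed
  also have "\<dots> = (\<Sum>j=1..n. ((m - j) choose (n + 4 - j)) * ((n + 3 - j) choose 3))"
    by (intro sum.cong refl) (simp add: add.commute)
  finally show ?thesis .
qed

text \<open>For equal \<open>j\<close> the two counts differ in one binomial factor only and combine
  by Pascal's rule; the substitution \<open>k = n + 1 - j\<close> brings the sum into the shape of
  the values of \<open>o_num\<close>.\<close>

lemma card_cells:
  "card cells = (\<Sum>k=1..n. ((m + k - n) choose (k + 3)) * ((k + 2) choose 3))"
proof -
  have "cells = {\<sigma> \<in> vr. Lo_cell \<sigma>} \<union> {\<sigma> \<in> vr. Hi_cell \<sigma>}" by (auto simp: cells_def)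
  moreover have "{\<sigma> \<in> vr. Lo_cell \<sigma>} \<inter> {\<sigma> \<in> vr. Hi_cell \<sigma>} = {}"
  proof -
    have False if "Lo_cell \<sigma>" "Hi_cell \<sigma>" for \<sigma>
    proof -
      obtain \<tau> where t: "\<sigma> = insert (\<Union>\<tau>) \<tau>" "\<tau> \<subseteq> Lo" "card \<tau> = 3" using \<open>Lo_cell \<sigma>\<close> by (auto simp: Lo_cell_def)
      have "\<tau> \<noteq> {}" using t(3) by auto
      then obtain N where "N \<in> \<tau>" by blast
      then have "N \<in> Lo" "N \<in> Hi" using t \<open>Hi_cell \<sigma>\<close> by (auto simp: Hi_cell_def)
      then show False using Lo_Hi by blast
    qed
    then show ?thesis by blast
  qed
  ultimately have "card cells = card {\<sigma> \<in> vr. Lo_cell \<sigma>} + card {\<sigma> \<in> vr. Hi_cell \<sigma>}"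
    using finite_vr by (simp add: card_Un_disjoint)
  also have "\<dots> = (\<Sum>j=1..n. (((m - j) choose (n + 3 - j)) + ((m - j) choose (n + 4 - j))) * ((n + 3 - j) choose 3))"
    unfolding card_Lo_cells card_Hi_cells by (simp add: sum.distrib algebra_simps)
  also have "\<dots> = (\<Sum>j=1..n. ((m + 1 - j) choose (n + 4 - j)) * ((n + 3 - j) choose 3))"
  proof (rule sum.cong)
    fix j assume j: "j \<in> {1..n}"
    have "m + 1 - j = Suc (m - j)" "n + 4 - j = Suc (n + 3 - j)" using j n_less by auto
    then show "(((m - j) choose (n + 3 - j)) + ((m - j) choose (n + 4 - j))) * ((n + 3 - j) choose 3)
        = ((m + 1 - j) choose (n + 4 - j)) * ((n + 3 - j) choose 3)" by simp
  qed simp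
  also have "\<dots> = (\<Sum>k=1..n. ((m + k - n) choose (k + 3)) * ((k + 2) choose 3))"
  proof (rule sum.reindex_bij_witness[where i = "\<lambda>k. n + 1 - k" and j = "\<lambda>j. n + 1 - j"])
    fix j assume j: "j \<in> {1..n}"
    have "m + (n + 1 - j) - n = m + 1 - j" "n + 1 - j + 3 = n + 4 - j" "n + 1 - j + 2 = n + 3 - j" using j n_less by auto
    then show "((m + (n + 1 - j) - n) choose (n + 1 - j + 3)) * ((n + 1 - j + 2) choose 3) =
        ((m + 1 - j) choose (n + 4 - j)) * ((n + 3 - j) choose 3)" by simp
  qed auto
  finally show ?thesis .
qed

end

text \<open>The elements of \<open>A\<close> below \<open>z\<close> are \<open>i 1, \<dots>, i (l - 1)\<close> exactly if \<open>z\<close> lies in the \<open>l\<close>-th gap.\<close>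
lemma gap_eq_card:
  assumes A: "finite A" "A \<subseteq> {1..}" and l: "1 \<le> l" "l \<le> card A"
  shows "gap A l = card {z. 1 \<le> z \<and> z \<notin> A \<and> card {a \<in> A. a < z} = l - 1}"
proof -
  define xs where "xs = sorted_list_of_set A"
  have len: "length xs = card A" and set: "set xs = A" and srt: "sorted_wrt (<) xs"
    using A(1) by (simp_all add: xs_def)
  have mono: "xs ! i < xs ! k" if "i < k" "k < card A" for i k
    using sorted_wrt_nth_less[OF srt] that len by simp
  have mem: "a \<in> A \<longleftrightarrow> (\<exists>i<card A. a = xs ! i)" for a
    using set len by (auto simp: in_set_conv_nth)
  have nth: "xs ! i \<in> A" if "i < card A" for i using that set len nth_mem by metis
  have below: "{a \<in> A. a < xs ! i} = (\<lambda>k. xs ! k) ` {..<i}" if "i < card A" for i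
  proof (intro equalityI subsetI)
    fix a assume "a \<in> {a \<in> A. a < xs ! i}"
    then obtain k where k: "k < card A" "a = xs ! k" "xs ! k < xs ! i" using mem by auto
    have "k < i"
    proof (rule ccontr)
      assume "\<not> k < i"
      then have "k = i \<or> i < k" by linarith
      then show False using k mono[of i k] by auto
    qed
    then show "a \<in> (\<lambda>k. xs ! k) ` {..<i}" using k by simp
  next
    fix a assume "a \<in> (\<lambda>k. xs ! k) ` {..<i}"
    then obtain k where k: "k < i" "a = xs ! k" by auto
    then have "a \<in> A" using nth[of k] that by simp
    then show "a \<in> {a \<in> A. a < xs ! i}" using mono[of k i] k that by simp
  qed
  have inj: "inj_on (\<lambda>k. xs ! k) {..<i}" if "i \<le> card A" for i
  proof (rule linorder_inj_onI)
    show "xs ! x \<noteq> xs ! y" if "x < y" "x \<in> {..<i}" "y \<in> {..<i}" for x y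
      using mono[of x y] that \<open>i \<le> card A\<close> by simp
  qed auto
  have cb: "card {a \<in> A. a < xs ! i} = i" if "i < card A" for i
    unfolding below[OF that] using card_image[OF inj[of i]] that by simp
  let ?Z = "{z. 1 \<le> z \<and> z \<notin> A \<and> card {a \<in> A. a < z} = l - 1}"
  have upper: "z < xs ! (l - 1)" if z: "z \<in> ?Z" for z
  proof (rule ccontr)
    assume "\<not> z < xs ! (l - 1)"
    moreover have m: "xs ! (l - 1) \<in> A" using nth[of "l - 1"] l by simp
    ultimately have "xs ! (l - 1) < z" using z by (cases "z = xs ! (l - 1)") auto
    then have "insert (xs ! (l - 1)) {a \<in> A. a < xs ! (l - 1)} \<subseteq> {a \<in> A. a < z}" using m by auto
    then have "card (insert (xs ! (l - 1)) {a \<in> A. a < xs ! (l - 1)}) \<le> card {a \<in> A. a < z}"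
      using A(1) by (intro card_mono) auto
    then show False using cb[of "l - 1"] l z A(1) by simp
  qed
  show ?thesis
  proof (cases "l = 1")
    case True
    have "?Z = {1..<xs ! 0}"
    proof (intro equalityI subsetI)
      fix z assume "z \<in> ?Z"
      then show "z \<in> {1..<xs ! 0}" using upper[of z] True by simp
    next
      fix z assume z: "z \<in> {1..<xs ! 0}"
      have "{a \<in> A. a < z} \<subseteq> {a \<in> A. a < xs ! 0}" using z by auto
      then have e: "{a \<in> A. a < z} = {}" using below[of 0] l True by simp
      have "z \<notin> A"
      proof
        assume "z \<in> A"
        then have "z \<in> {a \<in> A. a < xs ! 0}" using z by simp
        then show False using below[of 0] l True by simp
      qed
      then show "z \<in> ?Z" using e z True by simp
    qed
    then show ?thesis using True by (simp add: gap_def xs_def)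
  next
    case False
    then have l2: "2 \<le> l" using l by simp
    let ?p = "xs ! (l - 2)"
    have pm: "?p \<in> A" using nth[of "l - 2"] l l2 by simp
    have lb: "l - 2 < card A" "l - 1 < card A" using l l2 by linarith+
    have "?Z = {?p + 1..<xs ! (l - 1)}"
    proof (intro equalityI subsetI)
      fix z assume z: "z \<in> ?Z"
      have "?p < z"
      proof (rule ccontr)
        assume "\<not> ?p < z"
        then have "{a \<in> A. a < z} \<subseteq> {a \<in> A. a < ?p}" by auto
        then have "card {a \<in> A. a < z} \<le> card {a \<in> A. a < ?p}" using A(1) by (intro card_mono) auto
        then show False using cb[of "l - 2"] l l2 z by simp
      qed
      then show "z \<in> {?p + 1..<xs ! (l - 1)}" using upper[OF z] by simp
    next
      fix z assume z: "z \<in> {?p + 1..<xs ! (l - 1)}"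
      have nA: "z \<notin> A"
      proof
        assume "z \<in> A"
        then obtain k where k: "k < card A" "z = xs ! k" using mem by auto
        have "\<not> k \<le> l - 2" using mono[of k "l - 2"] z k lb by (cases "k = l - 2") auto
        moreover have "\<not> l - 1 \<le> k" using mono[of "l - 1" k] z k by (cases "k = l - 1") auto
        ultimately show False by linarith
      qed
      have "{a \<in> A. a < z} = insert ?p {a \<in> A. a < ?p}"
      proof (intro equalityI subsetI)
        fix a assume a: "a \<in> {a \<in> A. a < z}"
        then have "a \<in> {a \<in> A. a < xs ! (l - 1)}" using z by simp
        then have "a \<in> (\<lambda>k. xs ! k) ` {..<l - 1}" unfolding below[OF lb(2)] .
        then obtain k where k: "k < l - 1" "a = xs ! k" by auto
        show "a \<in> insert ?p {a \<in> A. a < ?p}"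
        proof (cases "k = l - 2")
          case False
          then have "k < l - 2" using k(1) by linarith
          then show ?thesis using mono[of k "l - 2"] k(2) lb a by simp
        qed (use k in simp)
      qed (use z pm in auto)
      then have "card {a \<in> A. a < z} = l - 1" using cb[of "l - 2"] A(1) l l2 by simp
      then show "z \<in> ?Z" using nA z by simp
    qed
    moreover have "gap A l = xs ! (l - 1) - (?p + 1)"
      using False by (simp add: gap_def xs_def Let_def diff_diff_add numeral_2_eq_2)
    ultimately show ?thesis by simp
  qed
qed

section \<open>A closed form for \<open>o_num\<close>\<close>

definition above :: "nat set \<Rightarrow> nat \<Rightarrow> nat" where
  "above A z = card {a \<in> A. z < a}"

text \<open>The hockey-stick identity, the binomials with \<open>k < 2\<close> being zero.\<close>

lemma sum_choose_2: "2 \<le> p \<Longrightarrow> (\<Sum>k = 2..p - 2. k choose 2) = (p - 1) choose 3"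
proof -
  have "(\<Sum>k = 2..q. k choose 2) = Suc q choose 3" for q
  proof (induction q)
    case (Suc q)
    show ?case
    proof (cases "2 \<le> Suc q")
      case True
      then show ?thesis using Suc by (simp add: numeral_3_eq_3 numeral_2_eq_2)
    qed (simp add: numeral_3_eq_3)
  qed (simp add: numeral_3_eq_3)
  moreover assume "2 \<le> p"
  ultimately show ?thesis by (simp add: Suc_diff_Suc numeral_2_eq_2)
qed

text \<open>The product \<open>gap A l * ((p - l) choose 2)\<close> is a sum over the points
  \<open>z\<close> of the \<open>l\<close>-th gap. Such a \<open>z\<close> has \<open>l - 1\<close>
  elements of \<open>A\<close> below it, so \<open>p - l\<close> is one less than the number of
  elements above, which no longer refers to the enumeration of \<open>A\<close>.\<close>

lemma s_num_eq:
  assumes A: "A \<subseteq> {1..m}" "card A = p" "2 \<le> p"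
  shows "s_num A = ((p - 1) choose 3) + (\<Sum>z\<in>{1..m} - A. (above A z - 1) choose 2)"
proof -
  have fA: "finite A" using A(1) by (rule finite_subset) simp
  define lev where "lev z = card {a \<in> A. a < z} + 1" for z
  have lev_above: "lev z + above A z = p + 1" if "z \<notin> A" for z
  proof -
    have "A = {a \<in> A. a < z} \<union> {a \<in> A. z < a}" using that by (auto simp: not_less_iff_gr_or_eq)
    then have "p = card {a \<in> A. a < z} + card {a \<in> A. z < a}"
      using fA A(2) card_Un_disjoint[of "{a \<in> A. a < z}" "{a \<in> A. z < a}"] by force
    then show ?thesis by (simp add: lev_def above_def)
  qed
  have lev_le: "lev z \<in> {1..p + 1}" for z
    using card_mono[OF fA, of "{a \<in> A. a < z}"] A(2) by (auto simp: lev_def)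
  let ?Z = "{1..m} - A"
  have "(\<Sum>z\<in>?Z. (above A z - 1) choose 2) = (\<Sum>z\<in>?Z. (p - lev z) choose 2)"
  proof (rule sum.cong)
    fix z assume "z \<in> ?Z"
    then have "above A z - 1 = p - lev z" using lev_above[of z] by simp
    then show "(above A z - 1) choose 2 = (p - lev z) choose 2" by simp
  qed simp
  also have "\<dots> = (\<Sum>l\<in>{1..p + 1}. \<Sum>z\<in>{z \<in> ?Z. lev z = l}. (p - lev z) choose 2)"
    by (rule sum.group[symmetric]) (use lev_le in auto)
  also have "\<dots> = (\<Sum>l\<in>{1..p + 1}. card {z \<in> ?Z. lev z = l} * ((p - l) choose 2))"
    by (intro sum.cong) auto
  \<comment> \<open>Levels from \<open>p - 1\<close> on contribute \<open>0\<close>, because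
    \<open>p - l\<close> is then less than \<open>2\<close>. Level \<open>p + 1\<close>, in
    truncated subtraction, collects the points above all of \<open>A\<close>, which belong to no
    gap.\<close>
  also have "\<dots> = (\<Sum>l\<in>{1..p - 2}. card {z \<in> ?Z. lev z = l} * ((p - l) choose 2))"
  proof (rule sum.mono_neutral_right)
    show "\<forall>l\<in>{1..p + 1} - {1..p - 2}. card {z \<in> ?Z. lev z = l} * ((p - l) choose 2) = 0"
    proof
      fix l assume "l \<in> {1..p + 1} - {1..p - 2}"
      then have "p - l < 2" by auto
      then show "card {z \<in> ?Z. lev z = l} * ((p - l) choose 2) = 0" by (simp add: binomial_eq_0)
    qed
  qed auto
  also have "\<dots> = (\<Sum>l = 1..p - 2. gap A l * ((p - l) choose 2))"
  proof (rule sum.cong)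
    fix l assume l: "l \<in> {1..p - 2}"
    have "{z \<in> ?Z. lev z = l} = {z. 1 \<le> z \<and> z \<notin> A \<and> card {a \<in> A. a < z} = l - 1}"
    proof (intro equalityI subsetI)
      fix z assume z: "z \<in> {z. 1 \<le> z \<and> z \<notin> A \<and> card {a \<in> A. a < z} = l - 1}"
      have "z \<le> m"
      proof (rule ccontr)
        assume "\<not> z \<le> m"
        then have "{a \<in> A. a < z} = A" using A(1) by auto
        then show False using z l A by auto
      qed
      then show "z \<in> {z \<in> ?Z. lev z = l}" using z l by (auto simp: lev_def)
    qed (use l in \<open>auto simp: lev_def\<close>)
    then have "card {z \<in> ?Z. lev z = l} = gap A l"
      using gap_eq_card[of A l] fA A l by (auto simp: subset_iff)
    then show "card {z \<in> ?Z. lev z = l} * ((p - l) choose 2) = gap A l * ((p - l) choose 2)" by simp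
  qed simp
  finally show ?thesis using sum_choose_2[OF A(3)] A(2) by (simp add: s_num_def Let_def)
qed

text \<open>\<open>above B\<close> numbers the elements of \<open>B\<close> from the top, starting
  at \<open>0\<close>, and takes each value below \<open>card B\<close> exactly once.\<close>

lemma sum_above:
  fixes B :: "nat set"
  assumes "finite B"
  shows "(\<Sum>z\<in>B. f (above B z)) = (\<Sum>r<card B. f r)"
  using assms
proof (induction "card B" arbitrary: B)
  case (Suc k)
  have ne: "B \<noteq> {}" using Suc.hyps(2) by auto
  let ?x = "Min B" and ?B = "B - {Min B}"
  have x: "?x \<in> B" using ne Suc.prems by simp
  have gt: "?x < b" if "b \<in> ?B" for b using that Suc.prems Min_le[of B b] by (auto simp: order.not_eq_order_implies_strict)
  have c: "card ?B = k" using Suc.hyps(2) x Suc.prems by simp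
  have "above B z = above ?B z" if "z \<in> ?B" for z
  proof -
    have "{a \<in> B. z < a} = {a \<in> ?B. z < a}" using gt[OF that] by auto
    then show ?thesis by (simp add: above_def)
  qed
  then have "(\<Sum>z\<in>?B. f (above B z)) = (\<Sum>z\<in>?B. f (above ?B z))" by (intro sum.cong) auto
  also have "\<dots> = (\<Sum>r<k. f r)" using Suc.hyps(1)[of ?B] c Suc.prems by simp
  finally have 1: "(\<Sum>z\<in>?B. f (above B z)) = (\<Sum>r<k. f r)" .
  have "{a \<in> B. ?x < a} = ?B" using gt by auto
  then have 2: "above B ?x = k" using c by (simp add: above_def)
  have "(\<Sum>z\<in>B. f (above B z)) = f (above B ?x) + (\<Sum>z\<in>?B. f (above B z))"
    using sum.remove[OF Suc.prems x] by simp
  then show ?case using 1 2 Suc.hyps(2)[symmetric] by (simp add: add.commute)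
qed simp

text \<open>The hockey-stick identity shifted by one; with truncated subtraction the additional term
  at \<open>r = 0\<close> is \<open>0\<close>.\<close>

lemma sum_choose_2_pred: "(\<Sum>r<Suc p. (r - 1) choose 2) = p choose 3"
proof (induction p)
  case (Suc p)
  then show ?case by (simp add: numeral_3_eq_3 numeral_2_eq_2)
qed (simp add: numeral_3_eq_3)

lemma card_above_insert: "z \<notin> A \<Longrightarrow> above (insert z A) z = above A z"
proof -
  have "{a \<in> insert z A. z < a} = {a \<in> A. z < a}" by auto
  then show ?thesis by (simp add: above_def)
qed

text \<open>A pair \<open>(A, z)\<close> with \<open>z \<notin> A\<close> is the same as the set \<open>insert z A\<close> with a marked element.\<close>
lemma sum_marked:
  fixes V :: "nat set"
  assumes V: "finite V"
  shows "(\<Sum>A\<in>{A. A \<subseteq> V \<and> card A = p}. \<Sum>z\<in>V - A. f (above A z)) =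
    (\<Sum>B\<in>{B. B \<subseteq> V \<and> card B = Suc p}. \<Sum>z\<in>B. f (above B z))"
proof -
  have fin: "finite {A. A \<subseteq> V \<and> card A = q}" for q using V by simp
  have fs: "finite A" if "A \<in> {A. A \<subseteq> V \<and> card A = q}" for A q using that V finite_subset by auto
  have "(\<Sum>A\<in>{A. A \<subseteq> V \<and> card A = p}. \<Sum>z\<in>V - A. f (above A z)) =
      (\<Sum>(A, z)\<in>(SIGMA A:{A. A \<subseteq> V \<and> card A = p}. V - A). f (above A z))"
    using fin V by (subst sum.Sigma) auto
  also have "\<dots> = (\<Sum>(B, z)\<in>(SIGMA B:{B. B \<subseteq> V \<and> card B = Suc p}. B). f (above B z))"
  proof (rule sum.reindex_bij_witness[where i = "\<lambda>(B, z). (B - {z}, z)" and j = "\<lambda>(A, z). (insert z A, z)"])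
    fix a assume a: "a \<in> (SIGMA A:{A. A \<subseteq> V \<and> card A = p}. V - A)"
    obtain A z where [simp]: "a = (A, z)" by (cases a)
    have A: "A \<subseteq> V" "card A = p" "z \<in> V" "z \<notin> A" using a by auto
    have fA: "finite A" using A(1) V by (rule finite_subset)
    show "(case case a of (A, z) \<Rightarrow> (insert z A, z) of (B, z) \<Rightarrow> (B - {z}, z)) = a" using A by simp
    show "(case a of (A, z) \<Rightarrow> (insert z A, z)) \<in> (SIGMA B:{B. B \<subseteq> V \<and> card B = Suc p}. B)"
      using A fA by simp
    show "(case case a of (A, z) \<Rightarrow> (insert z A, z) of (B, z) \<Rightarrow> f (above B z)) = (case a of (A, z) \<Rightarrow> f (above A z))"
      using card_above_insert[OF A(4)] by simp
  next
    fix b assume b: "b \<in> (SIGMA B:{B. B \<subseteq> V \<and> card B = Suc p}. B)"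
    obtain B z where [simp]: "b = (B, z)" by (cases b)
    have B: "B \<subseteq> V" "card B = Suc p" "z \<in> B" using b by auto
    have fB: "finite B" using B(1) V by (rule finite_subset)
    show "(case case b of (B, z) \<Rightarrow> (B - {z}, z) of (A, z) \<Rightarrow> (insert z A, z)) = b" using B by (simp add: insert_absorb)
    show "(case b of (B, z) \<Rightarrow> (B - {z}, z)) \<in> (SIGMA A:{A. A \<subseteq> V \<and> card A = p}. V - A)"
      using B fB by auto
  qed
  also have "\<dots> = (\<Sum>B\<in>{B. B \<subseteq> V \<and> card B = Suc p}. \<Sum>z\<in>B. f (above B z))"
    by (rule sum.Sigma[symmetric, OF fin ballI]) (rule fs)
  finally show ?thesis .
qed

text \<open>The sets \<open>A\<close> avoid \<open>1\<close>, which is therefore a gap point below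
  all of \<open>A\<close> and contributes \<open>(n + 1) choose 2\<close>; with the constant term
  this makes \<open>(n + 2) choose 3\<close> for each \<open>A\<close>. The other gap points
  \<open>z\<close> are regrouped by the sets \<open>insert z A\<close>, and each of these
  contributes \<open>(n + 2) choose 3\<close> once more. So that number is multiplied by the count
  of subsets of \<open>{2..m}\<close> of sizes \<open>n + 2\<close> and \<open>n + 3\<close>, which
  Pascal's rule adds up.\<close>

lemma o_num_eq:
  assumes "1 \<le> m"
  shows "o_num m n = (m choose (n + 3)) * ((n + 2) choose 3)"
proof -
  let ?p = "n + 2" and ?V = "{2..m}"
  have idx: "{A \<in> slice m (n + 2). 2 \<le> Min A} = {A. A \<subseteq> ?V \<and> card A = ?p}"
  proof (intro equalityI subsetI)
    fix A assume "A \<in> {A \<in> slice m (n + 2). 2 \<le> Min A}"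
    then have A: "A \<subseteq> {1..m}" "card A = ?p" "2 \<le> Min A" by (simp_all add: slice_def)
    have fA: "finite A" by (rule finite_subset[OF A(1)]) simp
    have "2 \<le> a" if "a \<in> A" for a using A(3) Min_le[OF fA that] by linarith
    then show "A \<in> {A. A \<subseteq> ?V \<and> card A = ?p}" using A(1,2) by auto
  next
    fix A assume "A \<in> {A. A \<subseteq> ?V \<and> card A = ?p}"
    then have A: "A \<subseteq> ?V" "card A = ?p" by simp_all
    have fA: "finite A" by (rule finite_subset[OF A(1)]) simp
    have "A \<noteq> {}" using A(2) by auto
    then have "Min A \<in> A" using fA by (intro Min_in)
    then have "2 \<le> Min A" using A(1) by auto
    moreover have "A \<subseteq> {1..m}" using A(1) by auto
    ultimately show "A \<in> {A \<in> slice m (n + 2). 2 \<le> Min A}" using A(2) by (simp add: slice_def)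
  qed
  have s: "s_num A = ((?p - 1) choose 3) + ((?p - 1) choose 2) + (\<Sum>z\<in>?V - A. (above A z - 1) choose 2)"
    if A: "A \<in> {A. A \<subseteq> ?V \<and> card A = ?p}" for A
  proof -
    have AV: "A \<subseteq> ?V" "card A = ?p" using A by simp_all
    have sub: "A \<subseteq> {1..m}" using AV(1) by auto
    have "1 \<notin> A" using AV(1) by auto
    moreover have "{1..m} = insert 1 ?V" using assms by auto
    ultimately have V: "{1..m} - A = insert 1 (?V - A)" by auto
    have "above A 1 = ?p"
    proof -
      have "{a \<in> A. 1 < a} = A" using AV(1) by auto
      then show ?thesis using AV(2) by (simp add: above_def)
    qed
    then have "(\<Sum>z\<in>{1..m} - A. (above A z - 1) choose 2) =
        ((?p - 1) choose 2) + (\<Sum>z\<in>?V - A. (above A z - 1) choose 2)"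
      unfolding V by (subst sum.insert) auto
    then show ?thesis using s_num_eq[OF sub, of ?p] AV(2) by simp
  qed
  have pas: "((?p - 1) choose 3) + ((?p - 1) choose 2) = ?p choose 3"
    by (simp add: numeral_3_eq_3 numeral_2_eq_2)
  have "o_num m n = (\<Sum>A\<in>{A. A \<subseteq> ?V \<and> card A = ?p}. (?p choose 3) + (\<Sum>z\<in>?V - A. (above A z - 1) choose 2))"
    unfolding o_num_def idx using s pas by (intro sum.cong) auto
  also have "\<dots> = ((m - 1) choose ?p) * (?p choose 3)
      + (\<Sum>A\<in>{A. A \<subseteq> ?V \<and> card A = ?p}. \<Sum>z\<in>?V - A. (above A z - 1) choose 2)"
    by (simp add: sum.distrib n_subsets)
  also have "(\<Sum>A\<in>{A. A \<subseteq> ?V \<and> card A = ?p}. \<Sum>z\<in>?V - A. (above A z - 1) choose 2)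
      = (\<Sum>B\<in>{B. B \<subseteq> ?V \<and> card B = Suc ?p}. \<Sum>z\<in>B. (above B z - 1) choose 2)"
    by (rule sum_marked) simp
  also have "\<dots> = (\<Sum>B\<in>{B. B \<subseteq> ?V \<and> card B = Suc ?p}. ?p choose 3)"
  proof (rule sum.cong)
    fix B assume B: "B \<in> {B. B \<subseteq> ?V \<and> card B = Suc ?p}"
    then have "finite B" using finite_subset[of B ?V] by auto
    then have "(\<Sum>z\<in>B. (above B z - 1) choose 2) = (\<Sum>r<card B. (r - 1) choose 2)" by (rule sum_above)
    then show "(\<Sum>z\<in>B. (above B z - 1) choose 2) = ?p choose 3" using B sum_choose_2_pred[of ?p] by simp
  qed simp
  also have "\<dots> = ((m - 1) choose Suc ?p) * (?p choose 3)" by (simp add: n_subsets)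
  finally have "o_num m n = (((m - 1) choose ?p) + ((m - 1) choose Suc ?p)) * (?p choose 3)"
    by (simp only: distrib_right)
  also have "((m - 1) choose ?p) + ((m - 1) choose Suc ?p) = Suc (m - 1) choose Suc ?p" by simp
  finally show ?thesis using assms by (simp add: numeral_3_eq_3)
qed

section \<open>Assembly of the homotopy types and the numbers\<close>

lemma (in two_slices) VR_two_slices_eq: "VR_two_slices m n = top_of_set (geom vr)"
  unfolding VR_two_slices_def vr_def[symmetric] by (rule realization_eq_geom[OF finite_vr])

definition sphere_count :: "nat \<Rightarrow> nat \<Rightarrow> nat" where
  "sphere_count m n = (\<Sum>k = 1..n. ((m + k - n) choose (k + 3)) * ((k + 2) choose 3))"

text \<open>By \<open>o_num_eq\<close> the summands from \<open>k = 2\<close> on are values of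
  \<open>o_num\<close>; in the summand for \<open>k = 1\<close> the second factor is
  \<open>3 choose 3 = 1\<close>.\<close>

lemma sphere_count_eq:
  assumes "1 \<le> n" "n < m"
  shows "sphere_count m n = (\<Sum>k = 2..n. o_num (m + k - n) k) + ((m + 1 - n) choose 4)"
proof -
  have three: "Suc (Suc (Suc 0)) choose 3 = 1" by (simp add: numeral_3_eq_3)
  have "sphere_count m n = ((m + 1 - n) choose 4) + (\<Sum>k = 2..n. ((m + k - n) choose (k + 3)) * ((k + 2) choose 3))"
    unfolding sphere_count_def sum.atLeast_Suc_atMost[OF assms(1)] Suc_1 by (simp add: three)
  also have "(\<Sum>k = 2..n. ((m + k - n) choose (k + 3)) * ((k + 2) choose 3)) = (\<Sum>k = 2..n. o_num (m + k - n) k)"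
  proof (rule sum.cong)
    fix k assume "k \<in> {2..n}"
    then have "1 \<le> m + k - n" using assms(2) by auto
    then show "((m + k - n) choose (k + 3)) * ((k + 2) choose 3) = o_num (m + k - n) k"
      by (simp only: o_num_eq)
  qed simp
  finally show ?thesis by simp
qed

text \<open>The summands depend on \<open>m\<close> and \<open>n\<close> only through
  \<open>m - n\<close>, so lowering both by one just drops the last summand, and this is
  \<open>o_num m n\<close>.\<close>

lemma sphere_count_rec:
  assumes "2 \<le> n" "n < m"
  shows "sphere_count m n = sphere_count (m - 1) (n - 1) + o_num m n"
proof -
  obtain k where n: "n = Suc k" using assms(1) by (cases n) auto
  obtain l where m: "m = Suc l" using assms(2) by (cases m) auto
  have "sphere_count m n = sphere_count l k + (m choose (n + 3)) * ((n + 2) choose 3)"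
    unfolding sphere_count_def n m by simp
  then show ?thesis using o_num_eq[of m n] assms n m by simp
qed

lemma VR_two_slices_homotopy_equivalent:
  assumes "1 \<le> n" "n + 1 < m"
  shows "VR_two_slices m n homotopy_equivalent_space wedge_S3 (sphere_count m n)"
proof -
  interpret two_slices m n using assms by unfold_locales
  have 1: "VR_two_slices m n homotopy_equivalent_space top_of_set (sphere_axes (sphere_count m n))"
    unfolding VR_two_slices_eq sphere_count_def card_cells[symmetric] by (rule vr_homotopy_eqv)
  have 2: "top_of_set (sphere_axes k) homotopy_equivalent_space wedge_S3 k" for k
    using wedge_S3_homeomorphic_axes[of k] homeomorphic_imp_homotopy_equivalent_space
      homotopy_equivalent_space_sym by blast
  show ?thesis by (rule homotopy_eqv_trans[OF 1 2])
qed

lemma VR_two_slices_wedge: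
  assumes "1 \<le> n" "n + 1 < m" and x: "x \<in> topspace (VR_two_slices m n)"
  shows "wedge (VR_two_slices m n) x (wedge_S3 b) None homotopy_equivalent_space wedge_S3 (sphere_count m n + b)"
proof -
  interpret two_slices m n using assms by unfold_locales
  have "geom vr homotopy_eqv sphere_axes (sphere_count m n)"
    unfolding sphere_count_def card_cells[symmetric] by (rule vr_homotopy_eqv)
  then show ?thesis
    using wedge_with_spheres[OF complex_vr finite_vr] x unfolding VR_two_slices_eq by simp
qed

theorem theorem18:
  fixes m n :: nat
  assumes "1 \<le> n" and "n + 3 < m"
  shows "(\<exists>k. VR_two_slices m n homotopy_equivalent_space wedge_S3 k) \<and>
    (n = 1 \<longrightarrow> VR_two_slices m n homotopy_equivalent_space wedge_S3 (m choose 4)) \<and>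
    (2 \<le> n \<longrightarrow> (\<forall>x \<in> topspace (VR_two_slices (m - 1) (n - 1)).
       VR_two_slices m n homotopy_equivalent_space
         wedge (VR_two_slices (m - 1) (n - 1)) x (wedge_S3 (o_num m n)) None)) \<and>
    VR_two_slices m n homotopy_equivalent_space
      wedge_S3 ((\<Sum>k = 2..n. o_num (m + k - n) k) + ((m + 1 - n) choose 4))"
proof -
  have main: "VR_two_slices m n homotopy_equivalent_space wedge_S3 (sphere_count m n)"
    using assms by (intro VR_two_slices_homotopy_equivalent) auto
  have count: "sphere_count m n = (\<Sum>k = 2..n. o_num (m + k - n) k) + ((m + 1 - n) choose 4)"
    using assms by (intro sphere_count_eq) auto
  \<comment> \<open>Both sides are equivalent to the same wedge of spheres: the one on the right has
    the spheres of the smaller complex and \<open>o_num m n\<close> further ones.\<close>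
  have rec: "VR_two_slices m n homotopy_equivalent_space
      wedge (VR_two_slices (m - 1) (n - 1)) x (wedge_S3 (o_num m n)) None"
    if "2 \<le> n" and x: "x \<in> topspace (VR_two_slices (m - 1) (n - 1))" for x
  proof -
    have "wedge (VR_two_slices (m - 1) (n - 1)) x (wedge_S3 (o_num m n)) None
        homotopy_equivalent_space wedge_S3 (sphere_count (m - 1) (n - 1) + o_num m n)"
      by (rule VR_two_slices_wedge[OF _ _ x]) (use assms that(1) in auto)
    moreover have "sphere_count (m - 1) (n - 1) + o_num m n = sphere_count m n"
      using sphere_count_rec[of n m] assms that(1) by simp
    ultimately have "wedge_S3 (sphere_count m n) homotopy_equivalent_space
        wedge (VR_two_slices (m - 1) (n - 1)) x (wedge_S3 (o_num m n)) None"
      using homotopy_equivalent_space_sym by metis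
    then show ?thesis by (rule homotopy_eqv_trans[OF main])
  qed
  have one: "VR_two_slices m n homotopy_equivalent_space wedge_S3 (m choose 4)" if "n = 1"
    using main count that by simp
  show ?thesis using main[unfolded count] main one rec by blast
qed

end
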